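(* Let $d\ge 2$ and let $p\in(1,\infty]$, $q\in(\frac d2,\infty]$ satisfy $\frac1p+\frac1q<\frac{2}{d-1}$. There exist $N=N(d)\in\mathbb N$ and a function $\theta_{\rm P}:(0,\infty)\times(0,\infty)\to(0,1)$ (depending only on $d,p,q$), continuous and monotonically increasing in both variables, such that the following holds for every $\omega\in\Omega$. Let $t_0\in\mathbb R$, $x_0\in\mathbb Z^d$, $n\ge N$, set $Q(r):=[t_0-r^2,t_0]\times B(x_0,r)$ for $r>0$, and let $u$ satisfy $\partial_t u-\mathcal L^\omega u=0$ in $Q(n)$. Then $$\operatorname{osc}\bigl(u,Q(\tfrac18 n)\bigr)\le \theta_{\rm P}\,\operatorname{osc}\bigl(u,Q(n)\bigr),\qquad \theta_{\rm P}=\theta_{\rm P}\bigl(\|\omega\|_{\underline L^p(B(x_0,n))},\|\omega^{-1}\|_{\underline L^q(B(x_0,n))}\bigr).$$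
   Context: $\mathbb B^d=\{\{x,y\}: x,y\in\mathbb Z^d,\ |x-y|=1\}$ is the set of nearest-neighbour bonds and $\Omega=(0,\infty)^{\mathbb B^d}$ the set of conductances; $\omega(x,y)=\omega(y,x):=\omega(\{x,y\})$ if $\{x,y\}\in\mathbb B^d$ and $\omega(x,y):=0$ otherwise. The operator $\mathcal L^\omega$ is $(\mathcal L^\omega u)(x)=\sum_{y\in\mathbb Z^d}\omega(x,y)(u(y)-u(x))$. For a function $u=u(t,x)=u_t(x)$ and a time interval $I$ and $V\subset\mathbb Z^d$, the equation $\partial_t u-\mathcal L^\omega u=0$ in $I\times V$ means that it holds at every $(t,x)\in I\times V$, where $u(\cdot,x)$ is differentiable in time for $x\in V$ and $u$ is also defined at the lattice neighbours of $V$ so that $\mathcal L^\omega u$ makes sense. For $y\in\mathbb Z^d$ and real $r\ge0$, $B(y,r)=y+([-r,r]\cap\mathbb Z)^d$. For finite $S\subset\mathbb Z^d$, let $S_{\mathbb B^d}$ be the set of bonds with both endpoints in $S$; for $F:\mathbb B^d\to\mathbb R$ and $r\in(0,\infty)$, $\|F\|_{\underline L^r(S)}:=\bigl(\frac1{|S_{\mathbb B^d}|}\sum_{e\in S_{\mathbb B^d}}|F(e)|^r\bigr)^{1/r}$, and $\|F\|_{\underline L^\infty(S)}:=\sup_{e\in S_{\mathbb B^d}}|F(e)|$. $\omega^{-1}$ is the pointwise reciprocal. $\operatorname{osc}(u,Q):=\max_{(t,x)\in Q}u(t,x)-\min_{(t,x)\in Q}u(t,x)$. *)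

theory Defs
  imports "HOL-Analysis.Analysis"
begin

text \<open>
  The lattice is the type \<open>int ^ 'd\<close>, of dimension \<open>CARD('d)\<close>. Since \<open>int\<close> carries no metric
  structure in the library, the Euclidean distance of lattice points is taken in \<open>real ^ 'd\<close>.
\<close>

definition of_lattice :: "int ^ 'd \<Rightarrow> real ^ 'd"
  where "of_lattice x = (\<chi> i. real_of_int (x $ i))"

definition bonds :: "(int ^ 'd) set set"
  where "bonds = {{x, y} | x y. norm (of_lattice x - of_lattice y) = 1}"

text \<open>
  Conductances are represented by total functions; their values outside \<open>bonds\<close> are never used.
\<close>

definition conductances :: "((int ^ 'd) set \<Rightarrow> real) set"
  where "conductances = bonds \<rightarrow> {0<..}"

definition cond :: "((int ^ 'd) set \<Rightarrow> real) \<Rightarrow> int ^ 'd \<Rightarrow> int ^ 'd \<Rightarrow> real"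
  where "cond \<omega> x y = (if {x, y} \<in> bonds then \<omega> {x, y} else 0)"

definition generator :: "((int ^ 'd) set \<Rightarrow> real) \<Rightarrow> (int ^ 'd \<Rightarrow> real) \<Rightarrow> int ^ 'd \<Rightarrow> real"
  where "generator \<omega> u x = (\<Sum>\<^sub>\<infinity>y\<in>UNIV. cond \<omega> x y * (u y - u x))"

text \<open>
  Being taken within \<open>I\<close>, the derivative is one-sided at the end points of a closed interval.
\<close>

definition solves_heat_eq ::
    "((int ^ 'd) set \<Rightarrow> real) \<Rightarrow> (real \<Rightarrow> int ^ 'd \<Rightarrow> real) \<Rightarrow> real set \<Rightarrow> (int ^ 'd) set \<Rightarrow> bool"
  where "solves_heat_eq \<omega> u I V \<longleftrightarrow>
    (\<forall>t\<in>I. \<forall>x\<in>V. ((\<lambda>s. u s x) has_real_derivative generator \<omega> (u t) x) (at t within I))"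

definition cube :: "int ^ 'd \<Rightarrow> real \<Rightarrow> (int ^ 'd) set"
  where "cube y r = {x. \<forall>i. real_of_int (x $ i - y $ i) \<in> {-r..r}}"

definition bonds_in :: "(int ^ 'd) set \<Rightarrow> (int ^ 'd) set set"
  where "bonds_in S = {e \<in> bonds. e \<subseteq> S}"

definition avg_norm :: "ereal \<Rightarrow> (int ^ 'd) set \<Rightarrow> ((int ^ 'd) set \<Rightarrow> real) \<Rightarrow> real"
  where "avg_norm r S F =
    (if r = \<infinity> then SUP e\<in>bonds_in S. \<bar>F e\<bar>
     else (1 / real (card (bonds_in S)) * (\<Sum>e\<in>bonds_in S. \<bar>F e\<bar> powr real_of_ereal r))
            powr (1 / real_of_ereal r))"

definition cylinder :: "real \<Rightarrow> int ^ 'd \<Rightarrow> real \<Rightarrow> (real \<times> (int ^ 'd)) set"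
  where "cylinder t0 x0 r = {t0 - r\<^sup>2..t0} \<times> cube x0 r"

text \<open>
  The supremum and infimum are a maximum and a minimum whenever these exist (see \<open>osc_eq\<close>), in
  particular on cylinders for functions that are continuous in time.
\<close>

definition osc :: "(real \<Rightarrow> int ^ 'd \<Rightarrow> real) \<Rightarrow> (real \<times> (int ^ 'd)) set \<Rightarrow> real"
  where "osc u Q = (SUP (t, x)\<in>Q. u t x) - (INF (t, x)\<in>Q. u t x)"

lemma osc_eq:
  assumes "(t1, x1) \<in> Q" "(t2, x2) \<in> Q"
    and "\<And>t x. (t, x) \<in> Q \<Longrightarrow> u t2 x2 \<le> u t x \<and> u t x \<le> u t1 x1"
  shows "osc u Q = u t1 x1 - u t2 x2"
proof -
  have "(SUP (t, x)\<in>Q. u t x) = u t1 x1"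
    by (rule cSup_eq_maximum) (use assms in force)+
  moreover have "(INF (t, x)\<in>Q. u t x) = u t2 x2"
    by (rule cInf_eq_minimum) (use assms in force)+
  ultimately show ?thesis
    unfolding osc_def by simp
qed

lemma mem_bonds_iff:
  "{x, y} \<in> bonds \<longleftrightarrow> norm (of_lattice x - of_lattice y) = 1"
  unfolding bonds_def by (auto simp: doubleton_eq_iff norm_minus_commute)

lemma finite_cube: "finite (cube y r)"
proof -
  let ?A = "\<lambda>i. {y $ i - \<lceil>\<bar>r\<bar>\<rceil>..y $ i + \<lceil>\<bar>r\<bar>\<rceil>}"
  have "vec_nth x \<in> (\<Pi>\<^sub>E i\<in>UNIV. ?A i)" if "x \<in> cube y r" for x
  proof -
    have "x $ i \<in> ?A i" for i
    proof -
      have "- r \<le> real_of_int (x $ i - y $ i)" "real_of_int (x $ i - y $ i) \<le> r"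
        using that by (auto simp: cube_def)
      moreover have "\<bar>r\<bar> \<le> real_of_int \<lceil>\<bar>r\<bar>\<rceil>"
        by simp
      ultimately have "real_of_int (x $ i - y $ i) \<le> real_of_int \<lceil>\<bar>r\<bar>\<rceil>"
          "real_of_int (- \<lceil>\<bar>r\<bar>\<rceil>) \<le> real_of_int (x $ i - y $ i)"
        by linarith+
      then have "x $ i - y $ i \<le> \<lceil>\<bar>r\<bar>\<rceil>" "- \<lceil>\<bar>r\<bar>\<rceil> \<le> x $ i - y $ i"
        by (simp_all only: of_int_le_iff)
      then show ?thesis
        by simp
    qed
    then show ?thesis
      by (simp add: PiE_def)
  qed
  then have "vec_nth ` cube y r \<subseteq> (\<Pi>\<^sub>E i\<in>UNIV. ?A i)"
    by blast
  moreover have "finite (\<Pi>\<^sub>E i\<in>UNIV. ?A i)"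
    by (intro finite_PiE) auto
  ultimately have "finite (vec_nth ` cube y r)"
    by (rule finite_subset)
  then show ?thesis
    by (rule finite_imageD) (simp add: inj_on_def vec_nth_inject)
qed

lemma finite_neighbours: "finite {y. {x, y} \<in> bonds}"
proof (rule finite_subset)
  show "{y. {x, y} \<in> bonds} \<subseteq> cube x 1"
  proof
    fix y assume "y \<in> {y. {x, y} \<in> bonds}"
    then have *: "norm (of_lattice x - of_lattice y) = 1"
      by (simp add: mem_bonds_iff)
    have "\<bar>real_of_int (y $ i - x $ i)\<bar> \<le> 1" for i
      using component_le_norm_cart[of "of_lattice x - of_lattice y" i] *
      by (simp add: of_lattice_def abs_minus_commute)
    then show "y \<in> cube x 1"
      by (auto simp: cube_def abs_le_iff simp del: of_int_diff)
  qed
qed (rule finite_cube)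

lemma generator_eq_sum:
  "generator \<omega> u x = (\<Sum>y | {x, y} \<in> bonds. \<omega> {x, y} * (u y - u x))"
proof -
  have "generator \<omega> u x = (\<Sum>\<^sub>\<infinity>y\<in>{y. {x, y} \<in> bonds}. \<omega> {x, y} * (u y - u x))"
    unfolding generator_def by (rule infsum_cong_neutral) (auto simp: cond_def)
  then show ?thesis
    by (simp add: finite_neighbours)
qed

end

(*
  De Giorgi iteration. By affine invariance let 0 <= h <= 1 solve the equation. At time t0 - n^2/2 at
  least half of the sites, weighted by the square of a cutoff, satisfy h >= 1/2, possibly after passing
  to 1 - h. Testing with 1/(h + delta) shows that - ln (h + delta) is a subsolution with controlled
  energy: first, h stays above some delta' on a fixed fraction of the sites at all later times, and
  then, by an L^1 Poincare inequality for functions vanishing on a fraction of a box, {h < delta} has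
  small space-time measure if delta is small. These steps only use the L^1 norms of the conductances
  and of their reciprocals.

  It remains to pass from small measure to h >= delta / 4 by iterating over truncations (u - k)_+ of
  u = 1 - h / delta on shrinking cylinders. The Caccioppoli inequality produces the term
  sum omega w^2 |grad eta|^2. Let the cutoff eta be a product of functions of one coordinate that are
  constant except on good hyperplanes, namely those on which the sums of omega^p and omega^-q are
  comparable to their averages over all parallel hyperplanes; most hyperplanes are good. On each good
  hyperplane Hoelder's inequality and the weighted Sobolev inequality in dimension d - 1 bound the
  term by the energy and the L^2 norm of w, and this is where 1/p + 1/q < 2/(d - 1) enters. The gain
  between two levels comes from the Sobolev inequality in dimension d and needs q > d/2. The
  iteration stops when the gap between two consecutive boxes is a single lattice spacing; by then the
  L^2 norm is so small that it controls the supremum.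
*)

theory Submission
  imports Defs
begin

section \<open>Means and Hoelder inequalities\<close>

text \<open>The dimension d - 1 enters as follows. For a cutoff whose slope is everywhere of order 1
  / n, bounding sum omega w^2 |grad eta|^2 by Hoelder and Sobolev would ask for 1/p + 1/q < 2/d; on
  hyperplanes the same computation takes place one dimension lower. The cutoff has to be chosen from
  the conductances alone, before the solution: then it is constant in time and serves all times at
  once. On each hyperplane the bound is a product of powers of the energy and of the L^2 norm. To
  sum it over hyperplanes and integrate it in time, it is linearised by Young's inequality at the a
  priori sizes A and B of the time integrals. What survives is A^tau B^(1 - tau), and tau < 1 makes
  the recursion superlinear. Boxes may be degenerate in some directions, so that one Sobolev
  inequality serves a box as well as its hyperplanes. The j-th step of the iteration needs 2^(j + 4)
  \<le> n, hence N = 16. Constants are first obtained for norms below a fixed bound; theta is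
  assembled from them at the end.\<close>

definition mean :: "'a set \<Rightarrow> ('a \<Rightarrow> real) \<Rightarrow> real"
  where "mean S f = (\<Sum>x\<in>S. f x) / real (card S)"

lemma mean_nonneg: "(\<And>x. x \<in> S \<Longrightarrow> 0 \<le> f x) \<Longrightarrow> 0 \<le> mean S f"
  unfolding mean_def by (intro divide_nonneg_nonneg sum_nonneg) auto

lemma mean_mono: "(\<And>x. x \<in> S \<Longrightarrow> f x \<le> g x) \<Longrightarrow> mean S f \<le> mean S g"
  unfolding mean_def by (intro divide_right_mono sum_mono) auto

lemma mean_cong: "(\<And>x. x \<in> S \<Longrightarrow> f x = g x) \<Longrightarrow> mean S f = mean S g"
  unfolding mean_def by (simp cong: sum.cong)

lemma mean_add: "mean S (\<lambda>x. f x + g x) = mean S f + mean S g"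
  unfolding mean_def by (simp add: sum.distrib add_divide_distrib)

lemma mean_cmult: "mean S (\<lambda>x. c * f x) = c * mean S f"
  unfolding mean_def by (simp add: sum_distrib_left)

lemma mean_const: "finite S \<Longrightarrow> S \<noteq> {} \<Longrightarrow> mean S (\<lambda>x. c) = c"
  unfolding mean_def by simp

lemma mean_sum: "mean S (\<lambda>x. \<Sum>i\<in>I. f i x) = (\<Sum>i\<in>I. mean S (f i))"
  unfolding mean_def by (simp add: sum.swap[of _ S] sum_divide_distrib)

lemma abs_mean_le: "\<bar>mean S f\<bar> \<le> mean S (\<lambda>x. \<bar>f x\<bar>)"
  unfolding mean_def by (simp add: divide_right_mono)

lemma sum_eq_card_mean: "finite S \<Longrightarrow> S \<noteq> {} \<Longrightarrow> (\<Sum>x\<in>S. f x) = real (card S) * mean S f"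
  unfolding mean_def by simp

lemma mean_eq_0D:
  assumes "finite S" "mean S f = 0" "\<And>x. x \<in> S \<Longrightarrow> 0 \<le> f x" "x \<in> S"
  shows "f x = 0"
proof -
  have "card S \<noteq> 0" using assms by auto
  then have "(\<Sum>x\<in>S. f x) = 0" using assms(2) by (simp add: mean_def)
  then show ?thesis using assms sum_nonneg_eq_0_iff[of S f] by auto
qed

text \<open>The missing weight \<open>1 - sum \<theta> I\<close> is carried by the number 1.
  Concavity of \<open>ln\<close> enters through its tangent at the right-hand side \<open>m\<close>
  itself, which makes the bound close.\<close>

lemma weighted_am_gm:
  fixes \<theta> x :: "'a \<Rightarrow> real"
  assumes I: "finite I" and \<theta>: "\<And>i. i \<in> I \<Longrightarrow> 0 \<le> \<theta> i" "sum \<theta> I \<le> 1"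
    and x: "\<And>i. i \<in> I \<Longrightarrow> 0 \<le> x i"
  shows "(\<Prod>i\<in>I. x i powr \<theta> i) \<le> 1 - sum \<theta> I + (\<Sum>i\<in>I. \<theta> i * x i)"
proof (cases "\<exists>i\<in>I. x i = 0")
  case True
  then have "(\<Prod>i\<in>I. x i powr \<theta> i) = 0"
    using I by (metis powr_0 prod_zero_iff)
  moreover have "0 \<le> (\<Sum>i\<in>I. \<theta> i * x i)"
    using \<theta> x by (intro sum_nonneg mult_nonneg_nonneg) auto
  ultimately show ?thesis using \<theta> by linarith
next
  case False
  then have pos: "x i > 0" if "i \<in> I" for i
    using x that by (metis less_eq_real_def)
  define m where "m = 1 - sum \<theta> I + (\<Sum>i\<in>I. \<theta> i * x i)"
  have nn: "0 \<le> (\<Sum>i\<in>I. \<theta> i * x i)"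
    using \<theta> x by (intro sum_nonneg mult_nonneg_nonneg) auto
  have m: "m > 0"
  proof (rule ccontr)
    assume "\<not> m > 0"
    then have *: "sum \<theta> I = 1" "(\<Sum>i\<in>I. \<theta> i * x i) = 0"
      using nn \<theta> unfolding m_def by linarith+
    have "\<theta> i * x i = 0" if "i \<in> I" for i
      using *(2) sum_nonneg_eq_0_iff[OF I, of "\<lambda>i. \<theta> i * x i"] \<theta> x that by auto
    then have "\<theta> i = 0" if "i \<in> I" for i
      using pos that by fastforce
    then show False using *(1) by simp
  qed
  have "(\<Prod>i\<in>I. x i powr \<theta> i) = exp (\<Sum>i\<in>I. \<theta> i * ln (x i))"
    using pos I by (simp add: exp_sum powr_def less_imp_neq[symmetric] cong: prod.cong)
  also have "(\<Sum>i\<in>I. \<theta> i * ln (x i)) \<le> (\<Sum>i\<in>I. \<theta> i * (x i / m - 1 + ln m))"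
  proof (intro sum_mono mult_left_mono)
    fix i assume i: "i \<in> I"
    have "ln (x i / m) \<le> x i / m - 1"
      using pos[OF i] m by (intro ln_le_minus_one) auto
    then show "ln (x i) \<le> x i / m - 1 + ln m"
      using pos[OF i] m by (simp add: ln_div)
    show "0 \<le> \<theta> i" using \<theta> i by auto
  qed
  also have "\<dots> = (\<Sum>i\<in>I. \<theta> i * x i) / m + sum \<theta> I * (ln m - 1)"
    by (simp add: algebra_simps sum.distrib sum_subtractf sum_distrib_left sum_divide_distrib)
  also have "\<dots> = (m - (1 - sum \<theta> I)) / m + sum \<theta> I * (ln m - 1)"
    by (simp add: m_def)
  also have "\<dots> = ln m - (1 - sum \<theta> I) * (ln m - 1 + 1 / m)"
    using m by (simp add: field_simps)
  also have "\<dots> \<le> ln m"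
  proof -
    have "ln (1 / m) \<le> 1 / m - 1"
      using m by (intro ln_le_minus_one) auto
    then have "0 \<le> ln m - 1 + 1 / m" using m by (simp add: ln_div)
    then show ?thesis using \<theta>(2) by simp
  qed
  also have "exp (ln m) = m" using m by simp
  finally show ?thesis unfolding m_def by simp
qed

lemma mean_prod_powr_le:
  fixes h :: "'i \<Rightarrow> 'a \<Rightarrow> real"
  assumes S: "finite S" "S \<noteq> {}" and I: "finite I"
    and \<theta>: "\<And>i. i \<in> I \<Longrightarrow> 0 \<le> \<theta> i" "sum \<theta> I \<le> 1"
    and h: "\<And>i x. i \<in> I \<Longrightarrow> x \<in> S \<Longrightarrow> 0 \<le> h i x"
  shows "mean S (\<lambda>x. \<Prod>i\<in>I. h i x powr \<theta> i) \<le> (\<Prod>i\<in>I. mean S (h i) powr \<theta> i)"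
proof (cases "\<exists>i\<in>I. mean S (h i) = 0")
  case True
  then obtain i where i: "i \<in> I" "mean S (h i) = 0" by blast
  then have "h i x = 0" if "x \<in> S" for x
    using mean_eq_0D[OF S(1), of "h i" x] h that by auto
  then have "(\<Prod>i\<in>I. h i x powr \<theta> i) = 0" if "x \<in> S" for x
    using i I that by (metis powr_0 prod_zero_iff)
  then have "mean S (\<lambda>x. \<Prod>i\<in>I. h i x powr \<theta> i) = 0"
    unfolding mean_def by simp
  then show ?thesis by (simp add: prod_nonneg)
next
  case False
  define m where "m i = mean S (h i)" for i
  have m: "m i > 0" if "i \<in> I" for i
    using False that mean_nonneg[of S "h i"] h unfolding m_def by force
  have "mean S (\<lambda>x. \<Prod>i\<in>I. (h i x / m i) powr \<theta> i)
      \<le> mean S (\<lambda>x. 1 - sum \<theta> I + (\<Sum>i\<in>I. \<theta> i * (h i x / m i)))"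
    using h m by (intro mean_mono weighted_am_gm I \<theta>) (auto simp: less_imp_le)
  also have "\<dots> = 1 - sum \<theta> I + (\<Sum>i\<in>I. mean S (\<lambda>x. (\<theta> i / m i) * h i x))"
    by (simp add: mean_add mean_const[OF S] mean_sum)
  also have "\<dots> = 1 - sum \<theta> I + (\<Sum>i\<in>I. \<theta> i)"
    unfolding mean_cmult using m unfolding m_def by (intro arg_cong2[where f="(+)"] sum.cong refl) force
  finally have *: "mean S (\<lambda>x. \<Prod>i\<in>I. (h i x / m i) powr \<theta> i) \<le> 1" by simp
  have "(\<Prod>i\<in>I. h i x powr \<theta> i) = (\<Prod>i\<in>I. m i powr \<theta> i) * (\<Prod>i\<in>I. (h i x / m i) powr \<theta> i)"
    if "x \<in> S" for x
    unfolding prod.distrib[symmetric]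
  proof (rule prod.cong[OF refl])
    fix i assume "i \<in> I"
    then show "h i x powr \<theta> i = m i powr \<theta> i * (h i x / m i) powr \<theta> i"
      using m[of i] h[of i x] that by (simp add: powr_mult[symmetric])
  qed
  then have "mean S (\<lambda>x. \<Prod>i\<in>I. h i x powr \<theta> i)
     = (\<Prod>i\<in>I. m i powr \<theta> i) * mean S (\<lambda>x. \<Prod>i\<in>I. (h i x / m i) powr \<theta> i)"
    unfolding mean_cmult[symmetric] by (intro mean_cong) auto
  also have "\<dots> \<le> (\<Prod>i\<in>I. m i powr \<theta> i) * 1"
    using * by (intro mult_left_mono prod_nonneg) auto
  finally show ?thesis by (simp add: m_def)
qed

lemma sum_prod_powr_le:
  fixes h :: "'i \<Rightarrow> 'a \<Rightarrow> real"
  assumes S: "finite S" and I: "finite I"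
    and \<theta>: "\<And>i. i \<in> I \<Longrightarrow> 0 \<le> \<theta> i" "sum \<theta> I = 1"
    and h: "\<And>i x. i \<in> I \<Longrightarrow> x \<in> S \<Longrightarrow> 0 \<le> h i x"
  shows "(\<Sum>x\<in>S. \<Prod>i\<in>I. h i x powr \<theta> i) \<le> (\<Prod>i\<in>I. (\<Sum>x\<in>S. h i x) powr \<theta> i)"
proof (cases "S = {}")
  case True
  then show ?thesis by (simp add: prod_nonneg)
next
  case False
  then have c: "real (card S) > 0" using S by (simp add: card_gt_0_iff)
  have "(\<Sum>x\<in>S. \<Prod>i\<in>I. h i x powr \<theta> i) \<le> card S * (\<Prod>i\<in>I. mean S (h i) powr \<theta> i)"
    using mean_prod_powr_le[OF S False I, of \<theta> h] \<theta> h c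
    by (simp add: sum_eq_card_mean[OF S False])
  \<comment> \<open>Exponents of sum 1 distribute the factor \<open>card S\<close> among the
    means.\<close>
  also have "\<dots> = (\<Prod>i\<in>I. real (card S) powr \<theta> i) * (\<Prod>i\<in>I. mean S (h i) powr \<theta> i)"
    using \<theta>(2) c by (simp add: powr_sum[symmetric])
  also have "\<dots> = (\<Prod>i\<in>I. (\<Sum>x\<in>S. h i x) powr \<theta> i)"
    unfolding prod.distrib[symmetric] sum_eq_card_mean[OF S False]
    by (intro prod.cong refl) (simp add: powr_mult mean_nonneg h)
  finally show ?thesis .
qed

lemma sum_powr_mult_le:
  fixes a b :: "'a \<Rightarrow> real"
  assumes "finite S" "0 \<le> s" "0 \<le> t" "s + t = 1"
    and "\<And>x. x \<in> S \<Longrightarrow> 0 \<le> a x" "\<And>x. x \<in> S \<Longrightarrow> 0 \<le> b x"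
  shows "(\<Sum>x\<in>S. a x powr s * b x powr t) \<le> (\<Sum>x\<in>S. a x) powr s * (\<Sum>x\<in>S. b x) powr t"
  using sum_prod_powr_le[of S "{0, 1 :: nat}" "\<lambda>i. if i = 0 then s else t" "\<lambda>i. if i = 0 then a else b"]
    assms by (simp split: if_splits)

lemma sum_powr_mult3_le:
  fixes a b c :: "'a \<Rightarrow> real"
  assumes "finite S" "0 \<le> s" "0 \<le> t" "0 \<le> r" "s + t + r = 1"
    and "\<And>x. x \<in> S \<Longrightarrow> 0 \<le> a x" "\<And>x. x \<in> S \<Longrightarrow> 0 \<le> b x" "\<And>x. x \<in> S \<Longrightarrow> 0 \<le> c x"
  shows "(\<Sum>x\<in>S. a x powr s * b x powr t * c x powr r)
    \<le> (\<Sum>x\<in>S. a x) powr s * (\<Sum>x\<in>S. b x) powr t * (\<Sum>x\<in>S. c x) powr r"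
  using sum_prod_powr_le[of S "{0, 1, 2 :: nat}" "\<lambda>i. if i = 0 then s else if i = 1 then t else r"
      "\<lambda>i. if i = 0 then a else if i = 1 then b else c"]
    assms by (simp add: mult.assoc add.assoc split: if_splits)

text \<open>Young's inequality normalised at reference values \<open>A\<close> and \<open>B\<close>,
  with equality for \<open>a = A\<close>, \<open>b = B\<close>. The right-hand side is linear in
  \<open>a\<close> and \<open>b\<close>, so it can be summed and integrated while \<open>A\<close>
  and \<open>B\<close> stay fixed.\<close>

lemma powr_mult_le_linear:
  fixes a b A B :: real
  assumes "0 \<le> a" "0 \<le> b" "0 < A" "0 < B" "0 \<le> s" "0 \<le> t" "s + t = 1"
  shows "a powr s * b powr t \<le> A powr s * B powr t * (s * (a / A) + t * (b / B))"
proof -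
  have "(a / A) powr s * (b / B) powr t \<le> s * (a / A) + t * (b / B)"
    using weighted_am_gm[of "{0, 1 :: nat}" "\<lambda>i. if i = 0 then s else t"
        "\<lambda>i. if i = 0 then a / A else b / B"] assms by (simp split: if_splits)
  then have "A powr s * B powr t * ((a / A) powr s * (b / B) powr t)
      \<le> A powr s * B powr t * (s * (a / A) + t * (b / B))"
    by (intro mult_left_mono) auto
  moreover have "A powr s * B powr t * ((a / A) powr s * (b / B) powr t) = a powr s * b powr t"
    using assms by (simp add: powr_divide)
  ultimately show ?thesis by simp
qed

section \<open>Coordinate averages on lattice boxes\<close>

definition upd :: "int ^ 'd \<Rightarrow> 'd \<Rightarrow> int \<Rightarrow> int ^ 'd"
  where "upd x j a = (\<chi> i. if i = j then a else x $ i)"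

abbreviation grad :: "(int ^ 'd \<Rightarrow> real) \<Rightarrow> int ^ 'd \<Rightarrow> 'd::finite \<Rightarrow> real"
  where "grad f x i \<equiv> f (x + axis i 1) - f x"

text \<open>Each bond inside \<open>S\<close> is listed exactly once, by its lower end point and its
  direction.\<close>

definition edges :: "(int ^ 'd) set \<Rightarrow> ((int ^ 'd) \<times> 'd) set"
  where "edges S = {(x, i). x \<in> S \<and> x + axis i 1 \<in> S}"

definition coord_mean :: "int ^ 'd \<Rightarrow> int ^ 'd \<Rightarrow> 'd \<Rightarrow> (int ^ 'd \<Rightarrow> real) \<Rightarrow> int ^ 'd \<Rightarrow> real"
  where "coord_mean l h j f x = mean {l $ j..h $ j} (\<lambda>a. f (upd x j a))"

text \<open>Extended by zero on the top face, so that a sum over all sites of a box becomes the sum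
  over its edges of direction \<open>j\<close>.\<close>

definition abs_diff :: "int ^ 'd \<Rightarrow> 'd \<Rightarrow> (int ^ 'd \<Rightarrow> real) \<Rightarrow> int ^ 'd \<Rightarrow> real"
  where "abs_diff h j f x = (if x $ j < h $ j then \<bar>grad f x j\<bar> else 0)"

lemma upd_nth [simp]: "upd x j a $ i = (if i = j then a else x $ i)"
  by (simp add: upd_def)

lemma upd_upd [simp]: "upd (upd x j a) j b = upd x j b"
  by (simp add: vec_eq_iff)

lemma upd_same [simp]: "upd x j (x $ j) = x"
  by (simp add: vec_eq_iff)

lemma upd_commute: "i \<noteq> j \<Longrightarrow> upd (upd x i a) j b = upd (upd x j b) i a"
  by (simp add: vec_eq_iff)

lemma upd_add_axis: "upd x j a + axis j 1 = upd x j (a + 1)"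
  by (simp add: vec_eq_iff axis_def)

lemma mem_box: "x \<in> {l..h :: int ^ 'd} \<longleftrightarrow> (\<forall>i. l $ i \<le> x $ i \<and> x $ i \<le> h $ i)"
  by (auto simp: less_eq_vec_def)

lemma bij_betw_box: "bij_betw vec_lambda (\<Pi>\<^sub>E i\<in>UNIV. {l $ i..h $ i}) {l..h :: int ^ 'd}"
  by (rule bij_betwI[where g = vec_nth]) (auto simp: less_eq_vec_def PiE_iff vec_lambda_inverse vec_nth_inverse)

lemma finite_box [simp]: "finite {l..h :: int ^ 'd::finite}"
  using bij_betw_finite[OF bij_betw_box[of l h]] by (auto intro!: finite_PiE)

lemma card_box: "card {l..h :: int ^ 'd::finite} = (\<Prod>i\<in>UNIV. nat (h $ i - l $ i + 1))"
  using bij_betw_same_card[OF bij_betw_box[of l h]] by (simp add: card_PiE)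

lemma finite_edges: "finite S \<Longrightarrow> finite (edges (S :: (int ^ 'd::finite) set))"
  by (rule finite_subset[of _ "S \<times> UNIV"]) (auto simp: edges_def)

lemma mem_edges_box:
  "(x, j) \<in> edges {l..h :: int ^ 'd} \<longleftrightarrow> x \<in> {l..h} \<and> x $ j < h $ j"
proof -
  have "(\<forall>i. l $ i \<le> (x + axis j 1) $ i \<and> (x + axis j 1) $ i \<le> h $ i) \<longleftrightarrow> x $ j < h $ j"
    if "\<forall>i. l $ i \<le> x $ i \<and> x $ i \<le> h $ i"
    using that by (auto simp: axis_def) (smt (verit))
  then show ?thesis by (auto simp: edges_def mem_box simp del: atLeastAtMost_iff)
qed

lemma sum_edges_box:
  fixes g :: "int ^ 'd::finite \<Rightarrow> 'd \<Rightarrow> real"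
  shows "(\<Sum>(x, j)\<in>edges {l..h}. g x j) = (\<Sum>x\<in>{l..h}. \<Sum>j\<in>UNIV. if x $ j < h $ j then g x j else 0)"
proof -
  have "edges {l..h} = (SIGMA x:{l..h}. {j. x $ j < h $ j})"
    by (auto simp: mem_edges_box simp del: atLeastAtMost_iff)
  then have "(\<Sum>(x, j)\<in>edges {l..h}. g x j) = (\<Sum>x\<in>{l..h}. \<Sum>j\<in>{j. x $ j < h $ j}. g x j)"
    by (simp add: sum.Sigma)
  then show ?thesis by (simp add: sum.If_cases)
qed

lemma sum_coord_mean:
  assumes "l \<le> (h :: int ^ 'd::finite)"
  shows "(\<Sum>x\<in>{l..h}. coord_mean l h j f x) = (\<Sum>x\<in>{l..h}. f x)"
proof -
  let ?I = "{l $ j..h $ j}"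
  have "l $ j \<le> h $ j" using assms by (auto simp: less_eq_vec_def)
  then have ne: "card ?I \<noteq> 0" by simp
  have "(\<Sum>x\<in>{l..h}. \<Sum>a\<in>?I. f (upd x j a)) = (\<Sum>(x, a)\<in>{l..h} \<times> ?I. f (upd x j a))"
    by (simp add: sum.cartesian_product)
  \<comment> \<open>Exchanging the \<open>j\<close>-th coordinate with its replacement is an
    involution of the box times the interval.\<close>
  also have "\<dots> = (\<Sum>(y, b)\<in>{l..h} \<times> ?I. f y)"
    by (rule sum.reindex_bij_witness[where i = "\<lambda>(x, a). (upd x j a, x $ j)" and j = "\<lambda>(x, a). (upd x j a, x $ j)"])
       (auto simp: less_eq_vec_def)
  also have "\<dots> = real (card ?I) * (\<Sum>x\<in>{l..h}. f x)"
    by (simp add: sum.cartesian_product[symmetric] sum_distrib_left)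
  finally show ?thesis
    using ne by (simp add: coord_mean_def mean_def sum_divide_distrib[symmetric])
qed

lemma mean_coord_mean:
  "l \<le> (h :: int ^ 'd::finite) \<Longrightarrow> mean {l..h} (coord_mean l h j f) = mean {l..h} f"
  unfolding mean_def by (simp add: sum_coord_mean)

lemma coord_mean_upd: "coord_mean l h j f (upd x j a) = coord_mean l h j f x"
  by (simp add: coord_mean_def)

lemma iter_mean_nonneg: "(\<And>x. 0 \<le> f x) \<Longrightarrow> 0 \<le> foldr (coord_mean l h) js f x"
  by (induction js arbitrary: x) (auto simp: coord_mean_def intro!: mean_nonneg)

lemma mean_iter_mean:
  "l \<le> (h :: int ^ 'd::finite) \<Longrightarrow> mean {l..h} (foldr (coord_mean l h) js f) = mean {l..h} f"
  by (induction js) (auto simp: mean_coord_mean)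

lemma coord_mean_indep:
  assumes "\<And>x a. f (upd x j a) = f x"
  shows "coord_mean l h i f (upd x j a) = coord_mean l h i f x"
  by (cases "i = j") (simp_all add: coord_mean_def upd_commute[of j i] assms)

lemma iter_mean_indep:
  assumes "j \<in> set js \<or> (\<forall>x a. f (upd x j a) = f x)"
  shows "foldr (coord_mean l h) js f (upd x j a) = foldr (coord_mean l h) js f x"
  using assms
proof (induction js arbitrary: x a)
  case (Cons i js)
  show ?case
  proof (cases "i = j")
    case True
    then show ?thesis by (simp add: coord_mean_upd)
  next
    case False
    then have "\<And>x a. foldr (coord_mean l h) js f (upd x j a) = foldr (coord_mean l h) js f x"
      using Cons by auto
    then show ?thesis by (simp add: coord_mean_indep)
  qed
qed auto

lemma indep_eq:
  fixes F :: "int ^ 'd::finite \<Rightarrow> real"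
  assumes "\<And>j x a. j \<in> K \<Longrightarrow> F (upd x j a) = F x" and "\<And>i. i \<notin> K \<Longrightarrow> x $ i = y $ i"
  shows "F x = F y"
proof -
  have "finite K" by simp
  then show ?thesis using assms
  proof (induction K arbitrary: x)
    case empty
    then have "x = y" by (simp add: vec_eq_iff)
    then show ?case by simp
  next
    case (insert j K)
    have "F (upd x j (y $ j)) = F y"
      using insert.prems by (intro insert.IH) auto
    then show ?case using insert.prems(1)[of j x] by simp
  qed
qed

text \<open>After averaging in every direction on which \<open>f\<close> can still depend, the
  result is constant on the box, and averaging preserves the mean over the box. Directions outside
  \<open>K\<close> have a single coordinate value; in this way a hyperplane counts as a box.\<close>

lemma iter_mean_eq_mean:
  assumes lh: "l \<le> (h :: int ^ 'd::finite)"
    and K: "\<And>i. i \<notin> K \<Longrightarrow> l $ i = h $ i"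
    and ind: "\<And>j. j \<in> K \<Longrightarrow> j \<in> set js \<or> (\<forall>x a. f (upd x j a) = f x)"
    and x: "x \<in> {l..h}"
  shows "foldr (coord_mean l h) js f x = mean {l..h} f"
proof -
  let ?F = "foldr (coord_mean l h) js f"
  have "?F y = ?F x" if "y \<in> {l..h}" for y
  proof (rule indep_eq[of K])
    show "?F (upd z j a) = ?F z" if "j \<in> K" for j z a
      using ind[OF that] by (rule iter_mean_indep)
    show "y $ i = x $ i" if "i \<notin> K" for i
      using K[OF that] \<open>y \<in> {l..h}\<close> x by (auto simp: less_eq_vec_def) (metis order_antisym)
  qed
  then have "mean {l..h} ?F = mean {l..h} (\<lambda>y. ?F x)" by (intro mean_cong)
  also have "\<dots> = ?F x" using lh by (intro mean_const) auto
  finally show ?thesis using mean_iter_mean[OF lh] by simp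
qed

text \<open>
  The coordinates are averaged one after the other. Averaging in the \<open>j\<close>-th coordinate does not affect the
  factor with index \<open>j\<close>, so that Hoelder's inequality is only needed for the other \<open>card K - 1\<close> factors.
\<close>

lemma loomis_whitney:
  fixes l h :: "int ^ 'd::finite"
  assumes lh: "l \<le> h" and K: "\<And>i. i \<notin> K \<Longrightarrow> l $ i = h $ i"
    and \<theta>: "0 \<le> \<theta>" "\<theta> * real (card K - 1) \<le> 1"
    and g: "\<And>i x. 0 \<le> g i x" "\<And>i x a. g i (upd x i a) = g i x"
  shows "mean {l..h} (\<lambda>x. \<Prod>i\<in>K. g i x powr \<theta>) \<le> (\<Prod>i\<in>K. mean {l..h} (g i) powr \<theta>)"
proof -
  define G where "G js i = foldr (coord_mean l h) (removeAll i js) (g i)" for js i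
  have Gn: "0 \<le> G js i x" for js i x
    unfolding G_def by (intro iter_mean_nonneg g)
  have *: "mean {l..h} (\<lambda>x. \<Prod>i\<in>K. g i x powr \<theta>) \<le> mean {l..h} (\<lambda>x. \<Prod>i\<in>K. G js i x powr \<theta>)"
    if "distinct js" "set js \<subseteq> K" for js
    using that
  proof (induction js)
    case Nil
    then show ?case by (simp add: G_def)
  next
    case (Cons j js)
    have jK: "j \<in> K" using Cons.prems by auto
    have ne: "{l $ j..h $ j} \<noteq> {}" using lh by (auto simp: less_eq_vec_def)
    have "mean {l..h} (\<lambda>x. \<Prod>i\<in>K. g i x powr \<theta>) \<le> mean {l..h} (\<lambda>x. \<Prod>i\<in>K. G js i x powr \<theta>)"
      using Cons by auto
    also have "\<dots> = mean {l..h} (coord_mean l h j (\<lambda>x. \<Prod>i\<in>K. G js i x powr \<theta>))"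
      by (simp add: mean_coord_mean[OF lh])
    also have "\<dots> \<le> mean {l..h} (\<lambda>x. \<Prod>i\<in>K. G (j # js) i x powr \<theta>)"
    proof (intro mean_mono)
      fix x
      have Gj: "G js j (upd x j a) = G js j x" for a
        unfolding G_def by (intro iter_mean_indep) (use g in auto)
      have Gj': "G (j # js) j = G js j" by (simp add: G_def)
      have Gi: "G (j # js) i x = mean {l $ j..h $ j} (\<lambda>a. G js i (upd x j a))" if "i \<noteq> j" for i
        using that by (simp add: G_def coord_mean_def)
      have "coord_mean l h j (\<lambda>x. \<Prod>i\<in>K. G js i x powr \<theta>) x
          = mean {l $ j..h $ j} (\<lambda>a. G js j x powr \<theta> * (\<Prod>i\<in>K - {j}. G js i (upd x j a) powr \<theta>))"
        unfolding coord_mean_def using jK by (simp add: prod.remove[of K j] Gj)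
      also have "\<dots> = G js j x powr \<theta> * mean {l $ j..h $ j} (\<lambda>a. \<Prod>i\<in>K - {j}. G js i (upd x j a) powr \<theta>)"
        by (rule mean_cmult)
      also have "\<dots> \<le> G js j x powr \<theta> * (\<Prod>i\<in>K - {j}. mean {l $ j..h $ j} (\<lambda>a. G js i (upd x j a)) powr \<theta>)"
        using \<theta> Gn jK ne by (intro mult_left_mono mean_prod_powr_le) (auto simp: card_Diff_singleton mult.commute)
      also have "\<dots> = (\<Prod>i\<in>K. G (j # js) i x powr \<theta>)"
      proof -
        have "(\<Prod>i\<in>K - {j}. mean {l $ j..h $ j} (\<lambda>a. G js i (upd x j a)) powr \<theta>)
            = (\<Prod>i\<in>K - {j}. G (j # js) i x powr \<theta>)"
          by (intro prod.cong refl) (auto simp: Gi)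
        then show ?thesis using jK by (simp add: prod.remove[of K j] Gj')
      qed
      finally show "coord_mean l h j (\<lambda>x. \<Prod>i\<in>K. G js i x powr \<theta>) x \<le> (\<Prod>i\<in>K. G (j # js) i x powr \<theta>)" .
    qed
    finally show ?case .
  qed
  obtain js where js: "set js = K" "distinct js"
    using finite_distinct_list[of K] by auto
  \<comment> \<open>Once all of \<open>K\<close> has been treated, each \<open>G js i\<close> is
    constant on the box, because \<open>g i\<close> does not depend on coordinate \<open>i\<close>
    from the beginning.\<close>
  have "mean {l..h} (\<lambda>x. \<Prod>i\<in>K. G js i x powr \<theta>) = mean {l..h} (\<lambda>x. \<Prod>i\<in>K. mean {l..h} (g i) powr \<theta>)"
  proof (intro mean_cong prod.cong refl)
    fix x i assume "x \<in> {l..h}" "i \<in> K"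
    then show "G js i x powr \<theta> = mean {l..h} (g i) powr \<theta>"
      unfolding G_def using K g js by (subst iter_mean_eq_mean[OF lh, of K]) auto
  qed
  also have "\<dots> = (\<Prod>i\<in>K. mean {l..h} (g i) powr \<theta>)"
    using lh by (intro mean_const) auto
  finally show ?thesis using *[of js] js by auto
qed

section \<open>Sobolev and Poincare inequalities for the L^1 norm of the gradient\<close>

lemma abs_diff_le_sum:
  fixes g :: "int \<Rightarrow> real"
  assumes "a \<le> b"
  shows "\<bar>g b - g a\<bar> \<le> (\<Sum>c\<in>{a..<b}. \<bar>g (c + 1) - g c\<bar>)"
  using assms
proof (induction b rule: int_ge_induct)
  case (step b)
  have "{a..<b + 1} = insert b {a..<b}" using step by auto
  then show ?case using step by auto
qed auto

text \<open>Both sites lie on one line of direction \<open>j\<close>, and the variation along the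
  whole line is its number of sites times the coordinate mean of \<open>abs_diff\<close>.\<close>

lemma diff_upd_le:
  fixes l h :: "int ^ 'd::finite"
  assumes x: "x \<in> {l..h}" and a: "a \<in> {l $ j..h $ j}"
    and L: "real_of_int (h $ j - l $ j + 1) \<le> L"
  shows "\<bar>f x - f (upd x j a)\<bar> \<le> L * coord_mean l h j (abs_diff h j f) x"
proof -
  let ?I = "{l $ j..h $ j}"
  let ?g = "\<lambda>c. f (upd x j c)"
  have nn: "0 \<le> (\<Sum>c\<in>?I. abs_diff h j f (upd x j c))"
    by (intro sum_nonneg) (simp add: abs_diff_def)
  have *: "\<bar>?g d - ?g c\<bar> \<le> (\<Sum>c\<in>?I. abs_diff h j f (upd x j c))"
    if "c \<le> d" "l $ j \<le> c" "d \<le> h $ j" for c d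
  proof -
    have "\<bar>?g d - ?g c\<bar> \<le> (\<Sum>b\<in>{c..<d}. \<bar>?g (b + 1) - ?g b\<bar>)"
      by (rule abs_diff_le_sum[OF that(1)])
    also have "\<dots> = (\<Sum>b\<in>{c..<d}. abs_diff h j f (upd x j b))"
      using that by (intro sum.cong refl) (auto simp: abs_diff_def upd_add_axis)
    also have "\<dots> \<le> (\<Sum>b\<in>?I. abs_diff h j f (upd x j b))"
      using that by (intro sum_mono2) (auto simp: abs_diff_def)
    finally show ?thesis .
  qed
  have lx: "l $ j \<le> x $ j" "x $ j \<le> h $ j" using x by (auto simp: less_eq_vec_def)
  have "\<bar>f x - f (upd x j a)\<bar> \<le> (\<Sum>c\<in>?I. abs_diff h j f (upd x j c))"
    using *[of a "x $ j"] *[of "x $ j" a] a lx by (cases "a \<le> x $ j") (auto simp: abs_minus_commute)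
  also have "\<dots> = real (card ?I) * coord_mean l h j (abs_diff h j f) x"
    using a unfolding coord_mean_def mean_def by auto
  also have "\<dots> \<le> L * coord_mean l h j (abs_diff h j f) x"
    using L lx unfolding coord_mean_def
    by (intro mult_right_mono mean_nonneg) (auto simp: abs_diff_def)
  finally show ?thesis .
qed

lemma sum_abs_diff:
  fixes l h :: "int ^ 'd::finite"
  shows "(\<Sum>j\<in>UNIV. mean {l..h} (abs_diff h j f))
    = (\<Sum>(x, j)\<in>edges {l..h}. \<bar>grad f x j\<bar>) / card {l..h}"
  unfolding sum_edges_box mean_def abs_diff_def
  by (simp add: sum_divide_distrib[symmetric] sum.swap[of _ UNIV])

text \<open>The argument of Gagliardo and Nirenberg: in every direction \<open>j\<close>,
  \<open>f\<close> is dominated by a function \<open>g j\<close> that does not depend on coordinate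
  \<open>j\<close>. Hence \<open>f powr s\<close> is at most a product of \<open>card K\<close> such
  functions, to which the Loomis-Whitney inequality applies; its condition on the exponent is the
  upper bound on \<open>s\<close>.\<close>

lemma sobolev_W11:
  fixes l h :: "int ^ 'd::finite"
  assumes lh: "l \<le> h" and K: "\<And>i. i \<notin> K \<Longrightarrow> l $ i = h $ i" "K \<noteq> {}"
    and L: "\<And>j. real_of_int (h $ j - l $ j + 1) \<le> L"
    and s: "0 < s" "s * real (card K - 1) \<le> real (card K)"
    and f: "\<And>x. 0 \<le> f x"
  shows "mean {l..h} (\<lambda>x. f x powr s)
    \<le> (mean {l..h} f + L * ((\<Sum>(x, j)\<in>edges {l..h}. \<bar>grad f x j\<bar>) / card {l..h})) powr s"
proof -
  define \<theta> where "\<theta> = s / card K"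
  define g where "g j = coord_mean l h j (\<lambda>x. f x + L * abs_diff h j f x)" for j
  have k: "real (card K) > 0" using K(2) by (simp add: card_gt_0_iff)
  have "1 \<le> L" using L[of undefined] lh by (auto simp: less_eq_vec_def intro: order_trans[rotated])
  then have L0: "0 \<le> L" by simp
  have nn: "0 \<le> abs_diff h j f x" for j x by (simp add: abs_diff_def)
  have fle: "f x \<le> g j x" if "x \<in> {l..h}" for x j
  proof -
    have ne: "{l $ j..h $ j} \<noteq> {}" using lh by (auto simp: less_eq_vec_def)
    have "f x = mean {l $ j..h $ j} (\<lambda>a. f x)" by (rule mean_const[OF _ ne, symmetric]) simp
    also have "\<dots> \<le> mean {l $ j..h $ j} (\<lambda>a. f (upd x j a) + L * coord_mean l h j (abs_diff h j f) x)"
      using diff_upd_le[OF that _ L, where f = f] by (intro mean_mono) fastforce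
    also have "\<dots> = g j x"
      by (simp add: mean_add mean_const[OF _ ne] g_def coord_mean_def mean_cmult)
    finally show ?thesis .
  qed
  have "mean {l..h} (\<lambda>x. f x powr s) \<le> mean {l..h} (\<lambda>x. \<Prod>j\<in>K. g j x powr \<theta>)"
  proof (intro mean_mono)
    fix x assume x: "x \<in> {l..h}"
    have "f x powr s = (\<Prod>j\<in>K. f x powr \<theta>)"
      using k K(2) by (cases "f x = 0") (auto simp: \<theta>_def powr_sum[symmetric] simp del: prod_constant)
    also have "\<dots> \<le> (\<Prod>j\<in>K. g j x powr \<theta>)"
      using fle[OF x] f s k by (intro prod_mono) (auto simp: \<theta>_def intro!: powr_mono2)
    finally show "f x powr s \<le> (\<Prod>j\<in>K. g j x powr \<theta>)" .
  qed
  also have "\<dots> \<le> (\<Prod>j\<in>K. mean {l..h} (g j) powr \<theta>)"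
  proof (rule loomis_whitney[OF lh K(1)])
    show "\<theta> * real (card K - 1) \<le> 1" using s k by (simp add: \<theta>_def field_simps)
    show "0 \<le> g i x" for i x unfolding g_def coord_mean_def
      using f nn L0 by (intro mean_nonneg) auto
  qed (use s k in \<open>auto simp: \<theta>_def g_def coord_mean_upd\<close>)
  also have "\<dots> \<le> (\<Prod>j\<in>K. (mean {l..h} f + L * (\<Sum>j\<in>UNIV. mean {l..h} (abs_diff h j f))) powr \<theta>)"
  proof (intro prod_mono conjI powr_mono2)
    fix j
    have "mean {l..h} (g j) = mean {l..h} f + L * mean {l..h} (abs_diff h j f)"
      by (simp add: g_def mean_coord_mean[OF lh] mean_add mean_cmult)
    also have "\<dots> \<le> mean {l..h} f + L * (\<Sum>j\<in>UNIV. mean {l..h} (abs_diff h j f))"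
      using L0 nn by (intro add_left_mono mult_left_mono member_le_sum) (auto intro!: mean_nonneg)
    finally show "mean {l..h} (g j) \<le> \<dots>" .
    show "0 \<le> mean {l..h} (g j)" unfolding g_def mean_coord_mean[OF lh]
      using f nn L0 by (intro mean_nonneg) auto
  qed (use s k in \<open>auto simp: \<theta>_def\<close>)
  also have "\<dots> = (mean {l..h} f + L * (\<Sum>j\<in>UNIV. mean {l..h} (abs_diff h j f))) powr s"
    (is "_ = ?A powr s")
    using k K(2) by (cases "?A = 0") (auto simp: \<theta>_def powr_sum[symmetric] simp del: prod_constant)
  finally show ?thesis by (simp add: sum_abs_diff)
qed

text \<open>The function is replaced by its average one coordinate at a time. Each replacement costs
  the gradient in that direction by \<open>diff_upd_le\<close>, and the error made before does not
  grow, since averaging preserves means.\<close>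

lemma poincare_L1:
  fixes l h :: "int ^ 'd::finite"
  assumes lh: "l \<le> h" and L: "\<And>j. real_of_int (h $ j - l $ j + 1) \<le> L"
  shows "mean {l..h} (\<lambda>x. \<bar>f x - mean {l..h} f\<bar>)
    \<le> L * ((\<Sum>(x, j)\<in>edges {l..h}. \<bar>grad f x j\<bar>) / card {l..h})"
proof -
  have nn: "0 \<le> abs_diff h j f x" for j x by (simp add: abs_diff_def)
  have *: "mean {l..h} (\<lambda>x. \<bar>f x - foldr (coord_mean l h) js f x\<bar>)
      \<le> L * (\<Sum>j\<leftarrow>js. mean {l..h} (abs_diff h j f))" for js
  proof (induction js)
    case Nil
    then show ?case by (simp add: mean_def)
  next
    case (Cons j js)
    let ?S = "foldr (coord_mean l h) js f"
    have ne: "{l $ j..h $ j} \<noteq> {}" using lh by (auto simp: less_eq_vec_def)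
    have "\<bar>f x - coord_mean l h j ?S x\<bar>
        \<le> L * coord_mean l h j (abs_diff h j f) x + coord_mean l h j (\<lambda>x. \<bar>f x - ?S x\<bar>) x"
      if x: "x \<in> {l..h}" for x
    proof -
      have "f x - coord_mean l h j ?S x = mean {l $ j..h $ j} (\<lambda>a. f x - ?S (upd x j a))"
        using mean_add[of "{l $ j..h $ j}" "\<lambda>a. f x" "\<lambda>a. - 1 * ?S (upd x j a)"]
        unfolding mean_cmult by (simp add: mean_const[OF _ ne] coord_mean_def)
      then have "\<bar>f x - coord_mean l h j ?S x\<bar> \<le> mean {l $ j..h $ j} (\<lambda>a. \<bar>f x - ?S (upd x j a)\<bar>)"
        using abs_mean_le by metis
      also have "\<dots> \<le> mean {l $ j..h $ j} (\<lambda>a. L * coord_mean l h j (abs_diff h j f) x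
           + \<bar>f (upd x j a) - ?S (upd x j a)\<bar>)"
      proof (intro mean_mono)
        fix a assume "a \<in> {l $ j..h $ j}"
        from diff_upd_le[OF x this L, where f = f]
        show "\<bar>f x - ?S (upd x j a)\<bar> \<le> L * coord_mean l h j (abs_diff h j f) x
           + \<bar>f (upd x j a) - ?S (upd x j a)\<bar>" by linarith
      qed
      also have "\<dots> = L * coord_mean l h j (abs_diff h j f) x + coord_mean l h j (\<lambda>x. \<bar>f x - ?S x\<bar>) x"
        by (simp add: mean_add mean_const[OF _ ne] coord_mean_def)
      finally show ?thesis .
    qed
    then have "mean {l..h} (\<lambda>x. \<bar>f x - coord_mean l h j ?S x\<bar>)
        \<le> mean {l..h} (\<lambda>x. L * coord_mean l h j (abs_diff h j f) x + coord_mean l h j (\<lambda>x. \<bar>f x - ?S x\<bar>) x)"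
      by (intro mean_mono)
    also have "\<dots> = L * mean {l..h} (abs_diff h j f) + mean {l..h} (\<lambda>x. \<bar>f x - ?S x\<bar>)"
      by (simp add: mean_add mean_cmult mean_coord_mean[OF lh])
    finally show ?case using Cons by (simp add: distrib_left)
  qed
  obtain js where js: "set js = (UNIV :: 'd set)" "distinct js"
    using finite_distinct_list[of "UNIV :: 'd set"] by auto
  have "mean {l..h} (\<lambda>x. \<bar>f x - mean {l..h} f\<bar>) = mean {l..h} (\<lambda>x. \<bar>f x - foldr (coord_mean l h) js f x\<bar>)"
    by (intro mean_cong) (use js in \<open>subst iter_mean_eq_mean[OF lh, of UNIV], auto\<close>)
  also have "\<dots> \<le> L * (\<Sum>j\<in>UNIV. mean {l..h} (abs_diff h j f))"
    using *[of js] js by (simp add: sum_list_distinct_conv_sum_set)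
  finally show ?thesis by (simp add: sum_abs_diff)
qed

section \<open>A weighted Sobolev inequality\<close>

lemma sum_edges_fst_le:
  fixes S :: "(int ^ 'd::finite) set" and g :: "int ^ 'd \<Rightarrow> real"
  assumes "finite S" "\<And>x. x \<in> S \<Longrightarrow> 0 \<le> g x"
  shows "(\<Sum>(x, j)\<in>edges S. g x) \<le> CARD('d) * (\<Sum>x\<in>S. g x)"
proof -
  have "(\<Sum>(x, j)\<in>edges S. g x) \<le> (\<Sum>(x, j)\<in>S \<times> (UNIV :: 'd set). g x)"
    using assms by (intro sum_mono2) (auto simp: edges_def)
  also have "\<dots> = CARD('d) * (\<Sum>x\<in>S. g x)"
    by (simp add: sum.cartesian_product[symmetric] sum_distrib_left)
  finally show ?thesis .
qed

lemma sum_edges_snd_le: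
  fixes S :: "(int ^ 'd::finite) set" and g :: "int ^ 'd \<Rightarrow> real"
  assumes "finite S" "\<And>x. x \<in> S \<Longrightarrow> 0 \<le> g x"
  shows "(\<Sum>(x, j)\<in>edges S. g (x + axis j 1)) \<le> CARD('d) * (\<Sum>x\<in>S. g x)"
proof -
  let ?f = "\<lambda>(x, j). (x + axis j (1 :: int), j)"
  have inj: "inj_on ?f (edges S)" by (auto simp: inj_on_def)
  have "(\<Sum>(x, j)\<in>edges S. g (x + axis j 1)) = (\<Sum>e\<in>?f ` edges S. g (fst e))"
    unfolding sum.reindex[OF inj] by (intro sum.cong) auto
  also have "\<dots> \<le> (\<Sum>(x, j)\<in>S \<times> (UNIV :: 'd set). g x)"
    using assms by (auto simp: edges_def split_beta intro!: sum_mono2)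
  also have "\<dots> = CARD('d) * (\<Sum>x\<in>S. g x)"
    by (simp add: sum.cartesian_product[symmetric] sum_distrib_left)
  finally show ?thesis .
qed

text \<open>The mean value inequality, obtained from weighted AM-GM with the weight
  \<open>1 / \<gamma>\<close>; no derivative at 0 has to be discussed.\<close>

lemma powr_diff_le:
  fixes a b \<gamma> :: real
  assumes "0 \<le> a" "0 \<le> b" "1 \<le> \<gamma>"
  shows "\<bar>a powr \<gamma> - b powr \<gamma>\<bar> \<le> \<gamma> * max a b powr (\<gamma> - 1) * \<bar>a - b\<bar>"
proof -
  have *: "b powr \<gamma> - a powr \<gamma> \<le> \<gamma> * b powr (\<gamma> - 1) * (b - a)" if "0 \<le> a" "a \<le> b" for a b :: real
  proof (cases "b = 0")
    case False
    then have b: "b > 0" using that by simp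
    have "a / b \<le> 1 - 1 / \<gamma> + (a / b) powr \<gamma> / \<gamma>"
      using weighted_am_gm[of "{()}" "\<lambda>_. 1 / \<gamma>" "\<lambda>_. (a / b) powr \<gamma>"] that b assms
      by (simp add: powr_powr)
    then have "\<gamma> * (a / b) \<le> \<gamma> * (1 - 1 / \<gamma> + (a / b) powr \<gamma> / \<gamma>)"
      using assms by (intro mult_left_mono) auto
    also have "\<dots> = \<gamma> - 1 + (a / b) powr \<gamma>"
      using assms by (simp add: distrib_left right_diff_distrib)
    finally have "\<gamma> * (a / b) \<le> \<gamma> - 1 + (a / b) powr \<gamma>" .
    then have "b powr \<gamma> * (1 - (a / b) powr \<gamma>) \<le> b powr \<gamma> * (\<gamma> * (1 - a / b))"
      by (intro mult_left_mono) (auto simp: algebra_simps)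
    moreover have "b powr \<gamma> * (1 - (a / b) powr \<gamma>) = b powr \<gamma> - a powr \<gamma>"
      using b that by (simp add: powr_divide right_diff_distrib)
    moreover have "b powr \<gamma> * (\<gamma> * (1 - a / b)) = \<gamma> * b powr (\<gamma> - 1) * (b - a)"
      using b by (simp add: powr_diff field_simps)
    ultimately show ?thesis by simp
  qed (use that in auto)
  have mono: "a powr \<gamma> \<le> b powr \<gamma>" if "0 \<le> a" "a \<le> b" for a b :: real
    using that assms by (intro powr_mono2) auto
  show ?thesis
    using *[of a b] *[of b a] mono[of a b] mono[of b a] assms by (cases "a \<le> b") auto
qed

text \<open>The L^1 Sobolev inequality is applied to \<open>v powr \<gamma>\<close>. Hoelder's
  inequality splits the gradient into the energy, the inverse weights and once more the norm of
  \<open>v\<close> that stands on the left; that norm is then divided out. The condition on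
  \<open>\<kappa>\<close> expresses that \<open>2 * \<kappa> / \<gamma>\<close> is an admissible
  exponent.\<close>

lemma sobolev_weighted:
  fixes l h :: "int ^ 'd::finite" and c :: "int ^ 'd \<Rightarrow> 'd \<Rightarrow> real"
  assumes lh: "l \<le> h" and K: "\<And>i. i \<notin> K \<Longrightarrow> l $ i = h $ i" "K \<noteq> {}"
    and L: "\<And>j. real_of_int (h $ j - l $ j + 1) \<le> L"
    and q: "1 < q" and \<kappa>: "0 < \<kappa>" "\<kappa> * (real (card K) - 2 + card K / q) \<le> card K"
    and v: "\<And>x. 0 \<le> v x" and c: "\<And>x j. (x, j) \<in> edges {l..h} \<Longrightarrow> 0 < c x j"
  defines "V \<equiv> real (card {l..h})"
  shows "mean {l..h} (\<lambda>x. v x powr (2 * \<kappa>)) powr (1 / \<kappa>)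
    \<le> 2 * mean {l..h} (\<lambda>x. (v x)\<^sup>2) + 4 * real CARD('d) * (1 + \<kappa> * (1 - 1 / q))\<^sup>2 * L\<^sup>2
        * ((\<Sum>(x, j)\<in>edges {l..h}. (1 / c x j) powr q) / V) powr (1 / q)
        * ((\<Sum>(x, j)\<in>edges {l..h}. c x j * (grad v x j)\<^sup>2) / V)"
proof -
  \<comment> \<open>Chosen such that \<open>\<gamma> - 1 = 2 * \<kappa> * r\<close>, where
    \<open>r\<close> is what the Hoelder exponents \<open>1 / 2\<close> and
    \<open>1 / (2 * q)\<close> leave to the third factor.\<close>
  define \<gamma> where "\<gamma> = 1 + \<kappa> * (1 - 1 / q)"
  define r where "r = (1 - 1 / q) / 2"
  define s where "s = 2 * \<kappa> / \<gamma>"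
  define B where "B = {l..h}"
  define W where "W = (\<Sum>(x, j)\<in>edges B. (1 / c x j) powr q)"
  define E where "E = (\<Sum>(x, j)\<in>edges B. c x j * (grad v x j)\<^sup>2)"
  define X where "X = mean B (\<lambda>x. v x powr (2 * \<kappa>))"
  define A where "A = mean B (\<lambda>x. (v x)\<^sup>2)"
  have fB: "finite B" "B \<noteq> {}" using lh by (auto simp: B_def)
  have V: "V > 0" using fB by (simp add: V_def B_def card_gt_0_iff)
  have q1: "0 < 1 - 1 / q" "1 / q > 0" using q by auto
  have \<gamma>: "1 < \<gamma>" unfolding \<gamma>_def using \<kappa> q1 by simp
  have r: "0 < r" "r < 1 / 2" using q1 by (auto simp: r_def)
  have \<gamma>r: "2 * \<kappa> * r = \<gamma> - 1" by (simp add: \<gamma>_def r_def)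
  have s0: "0 < s" using \<kappa> \<gamma> by (simp add: s_def)
  have \<gamma>s: "\<gamma> * s = 2 * \<kappa>" using \<gamma> by (simp add: s_def)
  have L0: "0 \<le> L" using L[of undefined] lh by (auto simp: less_eq_vec_def intro: order_trans[rotated])
  have k: "card K \<ge> 1" using K(2) by (simp add: Suc_le_eq card_gt_0_iff)
  have X0: "0 \<le> X" "0 \<le> A" "0 \<le> W" unfolding X_def A_def W_def by (auto intro!: mean_nonneg sum_nonneg)
  have E0: "0 \<le> E" unfolding E_def using c by (auto intro!: sum_nonneg simp: B_def less_imp_le)
  have s1: "s * real (card K - 1) \<le> real (card K)"
  proof -
    have "2 * \<kappa> * (card K - 1) \<le> card K * \<gamma>"
      using \<kappa>(2) k by (simp add: \<gamma>_def of_nat_diff algebra_simps)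
    then show ?thesis using \<gamma> k by (simp add: s_def field_simps)
  qed
  define S where "S = (\<Sum>(x, j)\<in>edges B. \<bar>v (x + axis j 1) powr \<gamma> - v x powr \<gamma>\<bar>)"
  define M where "M = mean B (\<lambda>x. v x powr \<gamma>) + L * (S / V)"
  have S0: "0 \<le> S" unfolding S_def by (auto intro!: sum_nonneg)
  have M0: "0 \<le> M" unfolding M_def using L0 S0 V by (auto intro!: mean_nonneg add_nonneg_nonneg)
  have "X \<le> M powr s"
    using sobolev_W11[OF lh K L s0 s1, of "\<lambda>x. v x powr \<gamma>"]
    by (simp add: X_def M_def S_def V_def B_def powr_powr \<gamma>s)
  then have "X powr (1 / s) \<le> (M powr s) powr (1 / s)" using X0 s0 by (intro powr_mono2) auto
  then have XM: "X powr (1 / s) \<le> M" using s0 M0 by (simp add: powr_powr)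
  have mg: "mean B (\<lambda>x. v x powr \<gamma>) \<le> A powr (1 / 2) * X powr r"
  proof -
    have "v x powr \<gamma> = (v x)\<^sup>2 powr (1 / 2) * (v x powr (2 * \<kappa>)) powr r" for x
    proof -
      have "(v x)\<^sup>2 powr (1 / 2) = v x" using v[of x] by (simp add: powr_half_sqrt)
      moreover have "(v x powr (2 * \<kappa>)) powr r = v x powr (\<gamma> - 1)" by (simp add: powr_powr \<gamma>r)
      ultimately show ?thesis using v[of x] by (cases "v x = 0") (auto simp: powr_mult_base)
    qed
    then show ?thesis
      using mean_prod_powr_le[OF fB, of "{0, 1 :: nat}" "\<lambda>i. if i = 0 then 1 / 2 else r"
          "\<lambda>i x. if i = 0 then (v x)\<^sup>2 else v x powr (2 * \<kappa>)"] r
      by (simp add: A_def X_def)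
  qed
  have Sle: "S \<le> \<gamma> * (E powr (1 / 2) * W powr (1 / (2 * q)) * (2 * real CARD('d) * (V * X)) powr r)"
  proof -
    define mx where "mx x j = max (v x) (v (x + axis j 1))" for x j
    have mx0: "0 \<le> mx x j" for x j using v[of x] by (auto simp: mx_def)
    have "S \<le> (\<Sum>(x, j)\<in>edges B. \<gamma> * ((c x j * (grad v x j)\<^sup>2) powr (1 / 2)
        * ((1 / c x j) powr q) powr (1 / (2 * q)) * (mx x j powr (2 * \<kappa>)) powr r))"
      unfolding S_def
    proof (intro sum_mono, clarify)
      fix x j assume e: "(x, j) \<in> edges B"
      then have c0: "c x j > 0" using c by (simp add: B_def)
      have "\<bar>v (x + axis j 1) powr \<gamma> - v x powr \<gamma>\<bar> \<le> \<gamma> * mx x j powr (\<gamma> - 1) * \<bar>v (x + axis j 1) - v x\<bar>"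
        using powr_diff_le[of "v (x + axis j 1)" "v x" \<gamma>] v \<gamma> by (simp add: mx_def max.commute)
      also have "mx x j powr (\<gamma> - 1) = (mx x j powr (2 * \<kappa>)) powr r" by (simp add: powr_powr \<gamma>r)
      also have "\<bar>v (x + axis j 1) - v x\<bar>
          = (c x j * (grad v x j)\<^sup>2) powr (1 / 2) * ((1 / c x j) powr q) powr (1 / (2 * q))"
        using c0 q by (simp add: powr_powr powr_half_sqrt real_sqrt_mult real_sqrt_divide)
      finally show "\<bar>v (x + axis j 1) powr \<gamma> - v x powr \<gamma>\<bar> \<le> \<gamma> * ((c x j * (grad v x j)\<^sup>2) powr (1 / 2)
        * ((1 / c x j) powr q) powr (1 / (2 * q)) * (mx x j powr (2 * \<kappa>)) powr r)"
        by (simp add: mult_ac)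
    qed
    also have "\<dots> = \<gamma> * (\<Sum>(x, j)\<in>edges B. (c x j * (grad v x j)\<^sup>2) powr (1 / 2)
        * ((1 / c x j) powr q) powr (1 / (2 * q)) * (mx x j powr (2 * \<kappa>)) powr r)"
      by (simp add: sum_distrib_left split_def)
    also have "\<dots> \<le> \<gamma> * ((\<Sum>(x, j)\<in>edges B. c x j * (grad v x j)\<^sup>2) powr (1 / 2)
        * (\<Sum>(x, j)\<in>edges B. (1 / c x j) powr q) powr (1 / (2 * q))
        * (\<Sum>(x, j)\<in>edges B. mx x j powr (2 * \<kappa>)) powr r)"
      unfolding split_def using q r \<gamma> c
      by (intro mult_left_mono sum_powr_mult3_le finite_edges fB)
         (auto simp: r_def B_def field_simps less_imp_le)
    also have "\<dots> \<le> \<gamma> * (E powr (1 / 2) * W powr (1 / (2 * q)) * (2 * real CARD('d) * (V * X)) powr r)"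
    proof -
      have "(\<Sum>(x, j)\<in>edges B. mx x j powr (2 * \<kappa>))
          \<le> (\<Sum>(x, j)\<in>edges B. v x powr (2 * \<kappa>) + v (x + axis j 1) powr (2 * \<kappa>))"
        by (intro sum_mono) (auto simp: mx_def max_def)
      also have "\<dots> \<le> CARD('d) * (\<Sum>x\<in>B. v x powr (2 * \<kappa>)) + CARD('d) * (\<Sum>x\<in>B. v x powr (2 * \<kappa>))"
        using sum_edges_fst_le[OF fB(1), of "\<lambda>x. v x powr (2 * \<kappa>)"]
          sum_edges_snd_le[OF fB(1), of "\<lambda>x. v x powr (2 * \<kappa>)"]
        by (simp add: sum.distrib split_def)
      also have "\<dots> = 2 * real CARD('d) * (V * X)"
        using sum_eq_card_mean[OF fB, of "\<lambda>x. v x powr (2 * \<kappa>)"] by (simp add: X_def V_def B_def)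
      finally show ?thesis
        unfolding E_def[symmetric] W_def[symmetric] using \<gamma> r
        by (intro mult_left_mono powr_mono2) (auto intro!: sum_nonneg)
    qed
    finally show ?thesis .
  qed
  define b where "b = L * \<gamma> * sqrt (2 * real CARD('d)) * ((E / V) powr (1 / 2) * (W / V) powr (1 / (2 * q)))"
  have b0: "0 \<le> b" using L0 \<gamma> by (simp add: b_def)
  have SV: "L * (S / V) \<le> b * X powr r"
  proof -
    have "E powr (1 / 2) * W powr (1 / (2 * q)) * (2 * real CARD('d) * (V * X)) powr r / V
        = (E / V) powr (1 / 2) * (W / V) powr (1 / (2 * q)) * (2 * real CARD('d)) powr r * X powr r"
    proof -
      have "V = V powr (1 / 2) * V powr (1 / (2 * q)) * V powr r"
        using V q by (simp add: powr_add[symmetric] r_def field_simps)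
      then have "E powr (1 / 2) * W powr (1 / (2 * q)) * (2 * real CARD('d) * (V * X)) powr r / V
        = E powr (1 / 2) * W powr (1 / (2 * q)) * ((2 * real CARD('d)) powr r * V powr r * X powr r)
            / (V powr (1 / 2) * V powr (1 / (2 * q)) * V powr r)"
        using V X0 by (simp add: powr_mult)
      also have "\<dots> = (E powr (1 / 2) / V powr (1 / 2)) * (W powr (1 / (2 * q)) / V powr (1 / (2 * q)))
          * (2 * real CARD('d)) powr r * X powr r"
        using V by simp
      finally show ?thesis using V X0 E0 by (simp add: powr_divide)
    qed
    then have "S / V \<le> \<gamma> * ((E / V) powr (1 / 2) * (W / V) powr (1 / (2 * q)) * (2 * real CARD('d)) powr r * X powr r)"
      using Sle V by (simp add: field_simps)
    also have "(2 * real CARD('d)) powr r \<le> (2 * real CARD('d)) powr (1 / 2)"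
    proof (rule powr_mono)
      have "1 \<le> real CARD('d)" by (simp add: Suc_leI)
      then show "1 \<le> 2 * real CARD('d)" by linarith
    qed (use r in simp)
    also have "(2 * real CARD('d)) powr (1 / 2) = sqrt (2 * real CARD('d))" by (rule powr_half_sqrt) simp
    finally have "S / V \<le> \<gamma> * ((E / V) powr (1 / 2) * (W / V) powr (1 / (2 * q)) * sqrt (2 * real CARD('d)) * X powr r)"
      using \<gamma> by (simp add: mult_left_mono mult_right_mono)
    then have "L * (S / V) \<le> L * \<dots>" using L0 by (rule mult_left_mono)
    then show ?thesis by (simp add: b_def mult_ac)
  qed
  \<comment> \<open>Because of \<open>1 / s = 1 / (2 * \<kappa>) + r\<close> the factor
    \<open>X powr r\<close> cancels.\<close>
  have main: "X powr (1 / (2 * \<kappa>)) \<le> sqrt A + b"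
  proof (cases "X = 0")
    case False
    then have X: "X > 0" using X0 by simp
    have "1 / s = 1 / (2 * \<kappa>) + r" using \<kappa> \<gamma> \<gamma>r by (simp add: s_def field_simps)
    then have "X powr (1 / (2 * \<kappa>)) * X powr r \<le> (sqrt A + b) * X powr r"
      using XM mg SV X0 by (simp add: M_def powr_add powr_half_sqrt algebra_simps)
    then show ?thesis using X by simp
  qed (use b0 X0 in auto)
  have "X powr (1 / \<kappa>) = (X powr (1 / (2 * \<kappa>)))\<^sup>2"
    by (simp add: power2_eq_square powr_add[symmetric])
  also have "\<dots> \<le> (sqrt A + b)\<^sup>2" using main by (intro power_mono) auto
  also have "\<dots> \<le> 2 * A + 2 * b\<^sup>2"
    using sum_squares_bound[of "sqrt A" b] X0 by (simp add: power2_sum)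
  also have "b\<^sup>2 = 2 * real CARD('d) * \<gamma>\<^sup>2 * L\<^sup>2 * (W / V) powr (1 / q) * (E / V)"
  proof -
    have "((W / V) powr (1 / (2 * q)))\<^sup>2 = (W / V) powr (1 / q)"
      by (simp add: power2_eq_square powr_add[symmetric])
    moreover have "((E / V) powr (1 / 2))\<^sup>2 = E / V" using E0 V by (simp add: powr_half_sqrt)
    ultimately show ?thesis by (simp add: b_def power_mult_distrib mult_ac)
  qed
  finally show ?thesis
    unfolding X_def A_def \<gamma>_def W_def E_def B_def by (simp add: mult_ac)
qed

section \<open>Energy estimates for the heat equation\<close>

definition lbox :: "int ^ 'd \<Rightarrow> nat \<Rightarrow> (int ^ 'd) set"
  where "lbox x0 R = {x0 - (\<chi> i. int R)..x0 + (\<chi> i. int R)}"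

lemma mem_lbox: "x \<in> lbox x0 R \<longleftrightarrow> (\<forall>i. \<bar>x $ i - x0 $ i\<bar> \<le> int R)"
  by (auto simp: lbox_def less_eq_vec_def abs_le_iff algebra_simps)

lemma finite_lbox [simp]: "finite (lbox (x0 :: int ^ 'd::finite) R)"
  by (simp add: lbox_def)

lemma lbox_ne [simp]: "lbox x0 R \<noteq> {}"
proof -
  have "x0 \<in> lbox x0 R" by (simp add: mem_lbox)
  then show ?thesis by blast
qed

lemma card_lbox: "card (lbox (x0 :: int ^ 'd::finite) R) = (2 * R + 1) ^ CARD('d)"
proof -
  have "nat (2 * int R + 1) = 2 * R + 1" by simp
  then show ?thesis by (simp add: lbox_def card_box)
qed

lemma lbox_mono: "R \<le> R' \<Longrightarrow> lbox x0 R \<subseteq> lbox x0 R'"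
  by (auto simp: mem_lbox) (meson of_nat_mono order_trans)

lemma lbox_add_axis: "x \<in> lbox x0 R \<Longrightarrow> x + axis j 1 \<in> lbox x0 (R + 1)"
  and lbox_diff_axis: "x \<in> lbox x0 R \<Longrightarrow> x - axis j 1 \<in> lbox x0 (R + 1)"
proof -
  assume x: "x \<in> lbox x0 R"
  have *: "\<bar>x $ i - x0 $ i\<bar> \<le> int R" "\<bar>axis j (1::int) $ i\<bar> \<le> 1" for i
    using x by (auto simp: mem_lbox axis_def)
  have "\<bar>x $ i + axis j 1 $ i - x0 $ i\<bar> \<le> int R + 1" "\<bar>x $ i - axis j 1 $ i - x0 $ i\<bar> \<le> int R + 1" for i
    using *[of i] by linarith+
  then show "x + axis j 1 \<in> lbox x0 (R + 1)" "x - axis j 1 \<in> lbox x0 (R + 1)"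
    by (auto simp: mem_lbox add.commute)
qed

lemma edges_mono: "S \<subseteq> T \<Longrightarrow> edges S \<subseteq> edges T"
  by (auto simp: edges_def)

definition lattice_op :: "(int ^ 'd \<Rightarrow> 'd::finite \<Rightarrow> real) \<Rightarrow> (int ^ 'd \<Rightarrow> real) \<Rightarrow> int ^ 'd \<Rightarrow> real"
  where "lattice_op c u x = (\<Sum>j\<in>UNIV. c x j * grad u x j
    + c (x - axis j 1) j * (u (x - axis j 1) - u x))"

text \<open>For \<open>n \<ge> 1\<close> the equation one layer inside the box involves only values
  in \<open>lbox x0 n\<close>. On the outermost layer continuity is kept, which makes all sums over
  the box integrable in time.\<close>

definition heat_sol :: "(int ^ 'd \<Rightarrow> 'd::finite \<Rightarrow> real) \<Rightarrow> int ^ 'd \<Rightarrow> nat \<Rightarrow> real \<Rightarrow> real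
    \<Rightarrow> (real \<Rightarrow> int ^ 'd \<Rightarrow> real) \<Rightarrow> bool"
  where "heat_sol c x0 n a b u \<longleftrightarrow>
    (\<forall>x\<in>lbox x0 n. continuous_on {a..b} (\<lambda>t. u t x)) \<and>
    (\<forall>x\<in>lbox x0 (n - 1). \<forall>t\<in>{a..b}.
      ((\<lambda>s. u s x) has_real_derivative lattice_op c (u t) x) (at t within {a..b}))"

lemma heat_sol_continuous:
  assumes "heat_sol c x0 n a b u" "x \<in> lbox x0 n" "a \<le> a'" "b' \<le> b"
  shows "continuous_on {a'..b'} (\<lambda>s. u s x)"
proof (rule continuous_on_subset)
  show "continuous_on {a..b} (\<lambda>s. u s x)" using assms by (simp add: heat_sol_def)
qed (use assms in auto)

lemma heat_sol_derivative:
  assumes "heat_sol c x0 n a b u" "x \<in> lbox x0 (n - 1)" "a \<le> a'" "b' \<le> b" "s \<in> {a'..b'}"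
  shows "((\<lambda>s. u s x) has_real_derivative lattice_op c (u s) x) (at s within {a'..b'})"
proof (rule has_field_derivative_subset)
  show "((\<lambda>s. u s x) has_real_derivative lattice_op c (u s) x) (at s within {a..b})"
    using assms by (simp add: heat_sol_def)
qed (use assms in auto)

text \<open>As \<open>g\<close> vanishes next to the boundary, edges leaving \<open>S\<close>
  contribute nothing, and backward differences become forward ones after a shift by one lattice
  vector.\<close>

lemma summation_by_parts:
  fixes S :: "(int ^ 'd::finite) set" and g :: "int ^ 'd \<Rightarrow> real"
  assumes S: "finite S"
    and g: "\<And>x j. g x \<noteq> 0 \<Longrightarrow> x \<in> S \<and> x + axis j 1 \<in> S \<and> x - axis j 1 \<in> S"
  shows "(\<Sum>x\<in>S. g x * lattice_op c u x)
    = - (\<Sum>(x, j)\<in>edges S. c x j * (grad g x j * grad u x j))"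
proof -
  have "(\<Sum>x\<in>S. g x * lattice_op c u x)
     = (\<Sum>(x, j)\<in>S \<times> UNIV. g x * c x j * grad u x j)
       - (\<Sum>(x, j)\<in>S \<times> UNIV. g x * c (x - axis j 1) j * (u x - u (x - axis j 1)))"
    by (simp add: lattice_op_def sum_distrib_left sum_subtractf[symmetric] sum.cartesian_product[symmetric] algebra_simps)
  also have "(\<Sum>(x, j)\<in>S \<times> UNIV. g x * c x j * grad u x j)
      = (\<Sum>(x, j)\<in>edges S. g x * c x j * grad u x j)"
    using S g by (intro sum.mono_neutral_right) (fastforce simp: edges_def)+
  also have "(\<Sum>(x, j)\<in>S \<times> UNIV. g x * c (x - axis j 1) j * (u x - u (x - axis j 1)))
      = (\<Sum>(x, j)\<in>{(x, j). x \<in> S \<and> x - axis j 1 \<in> S}. g x * c (x - axis j 1) j * (u x - u (x - axis j 1)))"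
    using S g by (intro sum.mono_neutral_right) fastforce+
  also have "\<dots> = (\<Sum>(x, j)\<in>edges S. g (x + axis j 1) * c x j * grad u x j)"
    by (rule sum.reindex_bij_witness[where i = "\<lambda>(x, j). (x + axis j 1, j)" and j = "\<lambda>(x, j). (x - axis j 1, j)"])
       (auto simp: edges_def)
  finally show ?thesis
    by (simp add: sum_subtractf[symmetric] sum_negf[symmetric] split_def algebra_simps)
qed

lemma lbox_interior:
  assumes "1 \<le> R" "x \<in> lbox x0 (R - 1)"
  shows "x \<in> lbox x0 R" "x + axis j 1 \<in> lbox x0 R" "x - axis j 1 \<in> lbox x0 R"
  using lbox_add_axis[OF assms(2), of j] lbox_diff_axis[OF assms(2), of j] lbox_mono[of "R - 1" R x0] assms
  by auto

text \<open>The squared positive part is differentiable also at its kink, where the Caratheodory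
  form of the derivative is used; so truncated solutions can be tested in the classical
  sense.\<close>

lemma has_derivative_max_square:
  fixes f :: "real \<Rightarrow> real"
  assumes "(f has_real_derivative f') (at t within I)"
  shows "((\<lambda>s. (max 0 (f s))\<^sup>2) has_real_derivative 2 * max 0 (f t) * f') (at t within I)"
proof -
  have h: "((\<lambda>y::real. (max 0 y)\<^sup>2) has_real_derivative 2 * max 0 y) (at y)" for y
  proof -
    consider "y > 0" | "y < 0" | "y = 0" by linarith
    then show ?thesis
    proof cases
      case 1
      have "((\<lambda>y::real. y\<^sup>2) has_real_derivative 2 * y) (at y)"
        by (auto intro!: derivative_eq_intros)
      then have "((\<lambda>y::real. (max 0 y)\<^sup>2) has_real_derivative 2 * y) (at y)"
        by (rule has_field_derivative_transform_within_open[of _ _ _ "{0<..}"]) (use 1 in auto)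
      then show ?thesis using 1 by simp
    next
      case 2
      have "((\<lambda>y::real. 0) has_real_derivative 0) (at y)" by auto
      then have "((\<lambda>y::real. (max 0 y)\<^sup>2) has_real_derivative 0) (at y)"
        by (rule has_field_derivative_transform_within_open[of _ _ _ "{..<0}"]) (use 2 in auto)
      then show ?thesis using 2 by simp
    next
      case 3
      have "\<forall>z. (max 0 z)\<^sup>2 - (max 0 0)\<^sup>2 = max 0 z * (z - (0::real))"
        by (auto simp: max_def power2_eq_square)
      moreover have "isCont (\<lambda>z. max 0 z) (0::real)" by (intro continuous_intros)
      ultimately show ?thesis unfolding 3 CARAT_DERIV by (intro exI[of _ "\<lambda>z. max 0 z"]) auto
    qed
  qed
  have "((\<lambda>y. (max 0 y)\<^sup>2) \<circ> f has_real_derivative 2 * max 0 (f t) * f') (at t within I)"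
    by (rule DERIV_chain[OF h assms])
  then show ?thesis by (simp add: o_def)
qed

text \<open>Continuity of \<open>F'\<close> is avoided: the fundamental theorem provides its
  integral, and only the majorant has to be integrable for other reasons.\<close>

lemma diff_le_integral:
  fixes F g :: "real \<Rightarrow> real"
  assumes "a \<le> b" "\<And>t. t \<in> {a..b} \<Longrightarrow> (F has_real_derivative F' t) (at t within {a..b})"
    and "\<And>t. t \<in> {a..b} \<Longrightarrow> F' t \<le> g t" "continuous_on {a..b} g"
  shows "F b - F a \<le> integral {a..b} g"
proof -
  have "(F' has_integral (F b - F a)) {a..b}"
    using assms by (intro fundamental_theorem_of_calculus)
      (auto simp: has_real_derivative_iff_has_vector_derivative)
  moreover have "(g has_integral integral {a..b} g) {a..b}"
    using assms by (intro integrable_integral integrable_continuous_real)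
  ultimately show ?thesis using assms(3) by (rule has_integral_le)
qed

text \<open>The discrete product rule is an identity if the mixed product \<open>wa * wb\<close>
  takes the place of a square. Passing from the difference of the truncations to the difference of
  the untruncated values can only increase the product, whatever sides of \<open>k\<close> the two
  values lie on.\<close>

lemma truncation_energy:
  fixes a b \<alpha> \<beta> k :: real
  defines "wa \<equiv> max 0 (a - k)" and "wb \<equiv> max 0 (b - k)"
  shows "(\<beta> * wb - \<alpha> * wa)\<^sup>2 - wa * wb * (\<beta> - \<alpha>)\<^sup>2 \<le> (\<beta>\<^sup>2 * wb - \<alpha>\<^sup>2 * wa) * (b - a)"
proof -
  have "(\<beta>\<^sup>2 * wb - \<alpha>\<^sup>2 * wa) * (wb - wa) = (\<beta> * wb - \<alpha> * wa)\<^sup>2 - wa * wb * (\<beta> - \<alpha>)\<^sup>2"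
    by (simp add: power2_eq_square algebra_simps)
  moreover have "(\<beta>\<^sup>2 * wb - \<alpha>\<^sup>2 * wa) * (wb - wa) \<le> (\<beta>\<^sup>2 * wb - \<alpha>\<^sup>2 * wa) * (b - a)"
  proof -
    consider "a \<le> k" "b \<le> k" | "a \<le> k" "k < b" | "k < a" "b \<le> k" | "k < a" "k < b" by linarith
    then show ?thesis
    proof cases
      case 2
      have "\<beta>\<^sup>2 * (b - k) * (b - k) \<le> \<beta>\<^sup>2 * (b - k) * (b - a)"
        using 2 by (intro mult_left_mono mult_nonneg_nonneg) auto
      then show ?thesis using 2 by (simp add: wa_def wb_def)
    next
      case 3
      have "\<alpha>\<^sup>2 * (a - k) * (a - k) \<le> \<alpha>\<^sup>2 * (a - k) * (a - b)"
        using 3 by (intro mult_left_mono mult_nonneg_nonneg) auto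
      then show ?thesis using 3 by (simp add: wa_def wb_def algebra_simps)
    qed (auto simp: wa_def wb_def)
  qed
  ultimately show ?thesis by simp
qed

abbreviation cutoff_term :: "(int ^ 'd \<Rightarrow> 'd::finite \<Rightarrow> real) \<Rightarrow> (int ^ 'd) set
    \<Rightarrow> (int ^ 'd \<Rightarrow> real) \<Rightarrow> (int ^ 'd \<Rightarrow> real) \<Rightarrow> real"
  where "cutoff_term c S \<eta> w \<equiv>
    \<Sum>(x, j)\<in>edges S. c x j * (w x * w (x + axis j 1) * (grad \<eta> x j)\<^sup>2)"

text \<open>What is differentiated in time is \<open>s - a\<close> times the squared L^2 norm of
  \<open>\<eta> * w\<close>. Hence no initial value appears, and the derivative of the weight in
  time yields the first summand under the integral.\<close>

lemma caccioppoli: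
  fixes c :: "int ^ 'd \<Rightarrow> 'd::finite \<Rightarrow> real" and k :: real
  assumes sol: "heat_sol c x0 n a b u" and R: "1 \<le> R" "R \<le> n" and t: "a \<le> t" "t \<le> b"
    and c: "\<And>x j. 0 < c x j" and \<eta>: "\<And>x. x \<notin> lbox x0 (R - 1) \<Longrightarrow> \<eta> x = 0"
  defines "w \<equiv> \<lambda>s x. max 0 (u s x - k)"
  shows "(t - a) * (\<Sum>x\<in>lbox x0 R. (\<eta> x)\<^sup>2 * (w t x)\<^sup>2)
    \<le> integral {a..t} (\<lambda>s. (\<Sum>x\<in>lbox x0 R. (\<eta> x)\<^sup>2 * (w s x)\<^sup>2)
      - 2 * (s - a) * (\<Sum>(x, j)\<in>edges (lbox x0 R). c x j * (\<eta> (x + axis j 1) * w s (x + axis j 1) - \<eta> x * w s x)\<^sup>2)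
      + 2 * (s - a) * cutoff_term c (lbox x0 R) \<eta> (w s))"
proof -
  let ?B = "lbox x0 R"
  let ?E = "\<lambda>s. \<Sum>(x, j)\<in>edges ?B. c x j * (\<eta> (x + axis j 1) * w s (x + axis j 1) - \<eta> x * w s x)\<^sup>2"
  let ?D = "\<lambda>s. cutoff_term c ?B \<eta> (w s)"
  let ?\<phi> = "\<lambda>s. \<Sum>x\<in>?B. (\<eta> x)\<^sup>2 * (w s x)\<^sup>2"
  have Bn: "?B \<subseteq> lbox x0 n" using R by (intro lbox_mono)
  have cont: "continuous_on {a..t} (\<lambda>s. w s x)" if "x \<in> ?B" for x
  proof -
    have "continuous_on {a..t} (\<lambda>s. u s x)"
      using that Bn t by (intro heat_sol_continuous[OF sol]) auto
    then show ?thesis unfolding w_def by (intro continuous_intros)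
  qed
  define \<phi>' where "\<phi>' s = (\<Sum>x\<in>?B. 2 * ((\<eta> x)\<^sup>2 * w s x) * lattice_op c (u s) x)" for s
  have der: "(?\<phi> has_real_derivative \<phi>' s) (at s within {a..t})" if s: "s \<in> {a..t}" for s
    unfolding \<phi>'_def
  proof (rule DERIV_sum)
    fix x assume x: "x \<in> ?B"
    show "((\<lambda>s. (\<eta> x)\<^sup>2 * (w s x)\<^sup>2) has_real_derivative 2 * ((\<eta> x)\<^sup>2 * w s x) * lattice_op c (u s) x) (at s within {a..t})"
    proof (cases "x \<in> lbox x0 (R - 1)")
      case True
      then have "x \<in> lbox x0 (n - 1)" using lbox_mono[of "R - 1" "n - 1" x0, OF diff_le_mono[OF R(2)]] by blast
      then have "((\<lambda>s. u s x) has_real_derivative lattice_op c (u s) x) (at s within {a..t})"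
        using s t by (intro heat_sol_derivative[OF sol]) auto
      then have "((\<lambda>s. u s x - k) has_real_derivative lattice_op c (u s) x) (at s within {a..t})"
        by (auto intro!: derivative_eq_intros)
      from has_derivative_max_square[OF this]
      have "((\<lambda>s. (w s x)\<^sup>2) has_real_derivative 2 * w s x * lattice_op c (u s) x) (at s within {a..t})"
        by (simp add: w_def)
      from DERIV_cmult[OF this, of "(\<eta> x)\<^sup>2"] show ?thesis by (simp add: mult_ac)
    next
      case False
      then have "\<eta> x = 0" by (rule \<eta>)
      then show ?thesis by simp
    qed
  qed
  have le: "\<phi>' s \<le> 2 * ?D s - 2 * ?E s" for s
  proof -
    let ?g = "\<lambda>x. (\<eta> x)\<^sup>2 * w s x"
    have "\<phi>' s = 2 * (\<Sum>x\<in>?B. ?g x * lattice_op c (u s) x)"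
      by (simp add: \<phi>'_def sum_distrib_left mult_ac)
    also have "\<dots> = - 2 * (\<Sum>(x, j)\<in>edges ?B. c x j * ((?g (x + axis j 1) - ?g x) * grad (u s) x j))"
    proof -
      have "x \<in> ?B \<and> x + axis j 1 \<in> ?B \<and> x - axis j 1 \<in> ?B" if "?g x \<noteq> 0" for x j
        using that \<eta>[of x] lbox_interior(1)[OF R(1), of x x0] lbox_interior(2,3)[OF R(1), of x x0 j] by auto
      then show ?thesis by (subst summation_by_parts) auto
    qed
    also have "\<dots> \<le> - 2 * (?E s - ?D s)"
    proof -
      have "?E s - ?D s = (\<Sum>(x, j)\<in>edges ?B. c x j * ((\<eta> (x + axis j 1) * w s (x + axis j 1) - \<eta> x * w s x)\<^sup>2
          - w s x * w s (x + axis j 1) * (grad \<eta> x j)\<^sup>2))"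
        by (simp add: sum_subtractf[symmetric] split_def right_diff_distrib)
      also have "\<dots> \<le> (\<Sum>(x, j)\<in>edges ?B. c x j * ((?g (x + axis j 1) - ?g x) * grad (u s) x j))"
        unfolding split_def w_def by (intro sum_mono mult_left_mono truncation_energy less_imp_le[OF c])
      finally show ?thesis by simp
    qed
    finally show ?thesis by simp
  qed
  let ?g = "\<lambda>s. ?\<phi> s - 2 * (s - a) * ?E s + 2 * (s - a) * ?D s"
  have "(t - a) * ?\<phi> t - (a - a) * ?\<phi> a \<le> integral {a..t} ?g"
  proof (rule diff_le_integral[OF t(1)])
    show "((\<lambda>s. (s - a) * ?\<phi> s) has_real_derivative 1 * ?\<phi> s + \<phi>' s * (s - a)) (at s within {a..t})"
      if "s \<in> {a..t}" for s
      by (rule DERIV_mult[OF _ der[OF that]]) (auto intro!: derivative_eq_intros)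
    show "1 * ?\<phi> s + \<phi>' s * (s - a) \<le> ?g s" if "s \<in> {a..t}" for s
      using mult_left_mono[OF le, of "s - a" s] that by (simp add: algebra_simps)
    show "continuous_on {a..t} ?g"
      unfolding split_def by (intro continuous_intros cont) (auto simp: edges_def)
  qed
  then show ?thesis by simp
qed

text \<open>In hyperbolic functions: \<open>2 * cosh x - 2\<close> is the square of
  \<open>2 * sinh (x / 2)\<close>, and \<open>2 * sinh y \<ge> 2 * y\<close> for
  \<open>y \<ge> 0\<close>.\<close>

lemma exp_add_exp_minus_ge: "2 + x\<^sup>2 \<le> exp x + exp (- x :: real)"
proof -
  have *: "2 * y \<le> exp y - exp (- y)" if "0 \<le> y" for y :: real
  proof -
    have "(\<lambda>y. exp y - exp (- y) - 2 * y) 0 \<le> (\<lambda>y. exp y - exp (- y) - 2 * y) y"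
    proof (rule DERIV_nonneg_imp_nondecreasing[OF that])
      fix z :: real
      have "((\<lambda>y. exp y - exp (- y) - 2 * y) has_real_derivative exp z + exp (- z) - 2) (at z)"
        by (auto intro!: derivative_eq_intros)
      moreover have "0 \<le> exp z + exp (- z) - 2"
        using exp_ge_add_one_self[of z] exp_ge_add_one_self[of "- z"] by linarith
      ultimately show "\<exists>l. ((\<lambda>y. exp y - exp (- y) - 2 * y) has_real_derivative l) (at z) \<and> 0 \<le> l" by blast
    qed
    then show ?thesis by simp
  qed
  have "x\<^sup>2 \<le> (exp (x / 2) - exp (- (x / 2)))\<^sup>2"
  proof (rule abs_le_square_iff[THEN iffD1])
    show "\<bar>x\<bar> \<le> \<bar>exp (x / 2) - exp (- (x / 2))\<bar>"
      using *[of "x / 2"] *[of "- (x / 2)"] by (cases "0 \<le> x") auto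
  qed
  also have "\<dots> = exp x + exp (- x) - 2"
  proof -
    have "(exp (x / 2))\<^sup>2 = exp x" "(exp (- (x / 2)))\<^sup>2 = exp (- x)" "exp (x / 2) * exp (- (x / 2)) = 1"
      by (simp_all add: power2_eq_square exp_add[symmetric])
    then show ?thesis by (simp add: power2_diff)
  qed
  finally show ?thesis by simp
qed

text \<open>The pointwise inequality behind testing with
  \<open>\<eta>\<^sup>2 / (u + \<delta>)\<close>. In logarithmic variables the mixed terms add up to
  a hyperbolic cosine of \<open>s - \<sigma>\<close>; removing the shift \<open>\<sigma>\<close>,
  which comes from the cutoff, is paid for by \<open>(\<beta> - \<alpha>)\<^sup>2\<close>.\<close>

lemma log_energy:
  fixes a b \<alpha> \<beta> :: real
  assumes "0 < a" "0 < b" "0 \<le> \<alpha>" "0 \<le> \<beta>"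
  shows "(\<beta>\<^sup>2 / b - \<alpha>\<^sup>2 / a) * (b - a) \<le> 2 * (\<beta> - \<alpha>)\<^sup>2 - \<alpha> * \<beta> * (ln b - ln a)\<^sup>2 / 2"
proof (cases "\<alpha> = 0 \<or> \<beta> = 0")
  case True
  then show ?thesis
  proof
    assume "\<alpha> = 0"
    have "\<beta>\<^sup>2 * (b - a) / b \<le> \<beta>\<^sup>2" using assms by (simp add: field_simps)
    also have "\<dots> \<le> 2 * \<beta>\<^sup>2" by simp
    finally show ?thesis using \<open>\<alpha> = 0\<close> by simp
  next
    assume "\<beta> = 0"
    have "- (\<alpha>\<^sup>2 * (b - a) / a) \<le> \<alpha>\<^sup>2" using assms by (simp add: field_simps)
    also have "\<dots> \<le> 2 * \<alpha>\<^sup>2" by simp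
    finally show ?thesis using \<open>\<beta> = 0\<close> by simp
  qed
next
  case False
  then have pos: "0 < \<alpha>" "0 < \<beta>" using assms by auto
  define s where "s = ln a - ln b"
  define \<sigma> where "\<sigma> = ln \<alpha> - ln \<beta>"
  have e: "exp s = a / b" "exp (- s) = b / a" "exp \<sigma> = \<alpha> / \<beta>" "exp (- \<sigma>) = \<beta> / \<alpha>"
    using assms pos by (simp_all add: s_def \<sigma>_def exp_diff)
  have 1: "\<alpha> * \<beta> * \<sigma>\<^sup>2 \<le> (\<beta> - \<alpha>)\<^sup>2"
  proof -
    have "\<alpha> * \<beta> * (2 + \<sigma>\<^sup>2) \<le> \<alpha> * \<beta> * (exp \<sigma> + exp (- \<sigma>))"
      using pos by (intro mult_left_mono exp_add_exp_minus_ge) auto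
    also have "\<dots> = \<alpha>\<^sup>2 + \<beta>\<^sup>2" unfolding e using pos by (simp add: field_simps power2_eq_square)
    finally show ?thesis by (simp add: power2_eq_square algebra_simps)
  qed
  have 2: "\<alpha> * \<beta> * (2 + (s - \<sigma>)\<^sup>2) \<le> \<beta>\<^sup>2 * (a / b) + \<alpha>\<^sup>2 * (b / a)"
  proof -
    have "\<alpha> * \<beta> * (2 + (s - \<sigma>)\<^sup>2) \<le> \<alpha> * \<beta> * (exp (s - \<sigma>) + exp (- (s - \<sigma>)))"
      using pos by (intro mult_left_mono exp_add_exp_minus_ge) auto
    also have "\<dots> = \<alpha> * \<beta> * (exp s * exp (- \<sigma>) + exp (- s) * exp \<sigma>)"
      by (simp add: exp_add[symmetric])
    also have "\<dots> = \<beta>\<^sup>2 * (a / b) + \<alpha>\<^sup>2 * (b / a)"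
      unfolding e using pos by (simp add: field_simps power2_eq_square)
    finally show ?thesis .
  qed
  have 3: "\<alpha> * \<beta> * (s\<^sup>2 / 2) \<le> \<alpha> * \<beta> * ((s - \<sigma>)\<^sup>2 + \<sigma>\<^sup>2)"
  proof -
    have "0 \<le> (s / 2 - \<sigma>)\<^sup>2 * 2" by simp
    then have "s\<^sup>2 / 2 \<le> (s - \<sigma>)\<^sup>2 + \<sigma>\<^sup>2" by (simp add: power2_eq_square algebra_simps)
    then show ?thesis using pos by (intro mult_left_mono) auto
  qed
  have "(\<beta>\<^sup>2 / b - \<alpha>\<^sup>2 / a) * (b - a) = \<alpha>\<^sup>2 + \<beta>\<^sup>2 - (\<beta>\<^sup>2 * (a / b) + \<alpha>\<^sup>2 * (b / a))"
    using assms by (simp add: field_simps)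
  also have "\<dots> \<le> \<alpha>\<^sup>2 + \<beta>\<^sup>2 - 2 * (\<alpha> * \<beta>) - \<alpha> * \<beta> * (s - \<sigma>)\<^sup>2"
    using 2 by (simp add: algebra_simps)
  also have "\<dots> = (\<beta> - \<alpha>)\<^sup>2 - \<alpha> * \<beta> * (s - \<sigma>)\<^sup>2" by (simp add: power2_eq_square algebra_simps)
  also have "\<dots> \<le> 2 * (\<beta> - \<alpha>)\<^sup>2 - \<alpha> * \<beta> * s\<^sup>2 / 2"
    using 1 3 by (simp add: algebra_simps)
  also have "s\<^sup>2 = (ln b - ln a)\<^sup>2" by (simp add: s_def power2_commute)
  finally show ?thesis .
qed

text \<open>The point of the logarithm is that the term produced by the cutoff does not contain
  \<open>u\<close> at all, so that it is controlled by the L^1 norm of the conductances.\<close>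

lemma log_estimate:
  fixes c :: "int ^ 'd \<Rightarrow> 'd::finite \<Rightarrow> real" and \<delta> :: real
  assumes sol: "heat_sol c x0 n a b u" and R: "1 \<le> R" "R \<le> n" and t: "a \<le> t" "t \<le> b"
    and c: "\<And>x j. 0 < c x j" and \<eta>: "\<And>x. x \<notin> lbox x0 (R - 1) \<Longrightarrow> \<eta> x = 0" "\<And>x. 0 \<le> \<eta> x"
    and u: "\<And>s x. s \<in> {a..b} \<Longrightarrow> x \<in> lbox x0 n \<Longrightarrow> 0 \<le> u s x" and \<delta>: "0 < \<delta>"
  defines "G \<equiv> \<lambda>s x. - ln (u s x + \<delta>)"
  shows "(\<Sum>x\<in>lbox x0 R. (\<eta> x)\<^sup>2 * G t x)
    + integral {a..t} (\<lambda>s. \<Sum>(x, j)\<in>edges (lbox x0 R). c x j * (\<eta> x * \<eta> (x + axis j 1) * (grad (G s) x j)\<^sup>2)) / 2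
    \<le> (\<Sum>x\<in>lbox x0 R. (\<eta> x)\<^sup>2 * G a x)
      + 2 * (t - a) * (\<Sum>(x, j)\<in>edges (lbox x0 R). c x j * (grad \<eta> x j)\<^sup>2)"
proof -
  let ?B = "lbox x0 R"
  let ?E = "\<lambda>s. \<Sum>(x, j)\<in>edges ?B. c x j * (\<eta> x * \<eta> (x + axis j 1) * (grad (G s) x j)\<^sup>2)"
  let ?D = "\<Sum>(x, j)\<in>edges ?B. c x j * (grad \<eta> x j)\<^sup>2"
  let ?\<phi> = "\<lambda>s. \<Sum>x\<in>?B. (\<eta> x)\<^sup>2 * G s x"
  have Bn: "?B \<subseteq> lbox x0 n" using R by (intro lbox_mono)
  have up: "0 < u s x + \<delta>" if "s \<in> {a..t}" "x \<in> ?B" for s x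
    using u[of s x] that Bn t \<delta> by force
  have cont: "continuous_on {a..t} (\<lambda>s. G s x)" if "x \<in> ?B" for x
  proof -
    have "continuous_on {a..t} (\<lambda>s. u s x)"
      using that Bn t by (intro heat_sol_continuous[OF sol]) auto
    then show ?thesis unfolding G_def using up[OF _ that] by (intro continuous_intros) force+
  qed
  define \<phi>' where "\<phi>' s = (\<Sum>x\<in>?B. - ((\<eta> x)\<^sup>2 / (u s x + \<delta>)) * lattice_op c (u s) x)" for s
  have der: "(?\<phi> has_real_derivative \<phi>' s) (at s within {a..t})" if s: "s \<in> {a..t}" for s
    unfolding \<phi>'_def
  proof (rule DERIV_sum)
    fix x assume x: "x \<in> ?B"
    show "((\<lambda>s. (\<eta> x)\<^sup>2 * G s x) has_real_derivative - ((\<eta> x)\<^sup>2 / (u s x + \<delta>)) * lattice_op c (u s) x) (at s within {a..t})"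
    proof (cases "x \<in> lbox x0 (R - 1)")
      case True
      then have "x \<in> lbox x0 (n - 1)" using lbox_mono[of "R - 1" "n - 1" x0, OF diff_le_mono[OF R(2)]] by blast
      then have "((\<lambda>s. u s x) has_real_derivative lattice_op c (u s) x) (at s within {a..t})"
        using s t by (intro heat_sol_derivative[OF sol]) auto
      then have "((\<lambda>s. G s x) has_real_derivative - (lattice_op c (u s) x / (u s x + \<delta>))) (at s within {a..t})"
      proof -
        have "((\<lambda>s. u s x + \<delta>) has_real_derivative lattice_op c (u s) x) (at s within {a..t})"
          using DERIV_add[OF \<open>((\<lambda>s. u s x) has_real_derivative _) _\<close> DERIV_const[of \<delta>]] by simp
        from DERIV_minus[OF DERIV_chain2[OF DERIV_ln[OF up[OF s x]] this]]
        show ?thesis by (simp add: G_def divide_inverse mult.commute)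
      qed
      from DERIV_cmult[OF this, of "(\<eta> x)\<^sup>2"] show ?thesis by (simp add: mult_ac)
    next
      case False
      then have "\<eta> x = 0" by (rule \<eta>)
      then show ?thesis by simp
    qed
  qed
  have le: "\<phi>' s \<le> 2 * ?D - ?E s / 2" if s: "s \<in> {a..t}" for s
  proof -
    let ?g = "\<lambda>x. (\<eta> x)\<^sup>2 / (u s x + \<delta>)"
    have "\<phi>' s = - (\<Sum>x\<in>?B. ?g x * lattice_op c (u s) x)"
      by (simp add: \<phi>'_def sum_negf)
    also have "\<dots> = (\<Sum>(x, j)\<in>edges ?B. c x j * ((?g (x + axis j 1) - ?g x) * grad (u s) x j))"
    proof -
      have "x \<in> ?B \<and> x + axis j 1 \<in> ?B \<and> x - axis j 1 \<in> ?B" if "?g x \<noteq> 0" for x j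
        using that \<eta>(1)[of x] lbox_interior(1)[OF R(1), of x x0] lbox_interior(2,3)[OF R(1), of x x0 j] by auto
      then show ?thesis by (subst summation_by_parts) auto
    qed
    also have "\<dots> \<le> (\<Sum>(x, j)\<in>edges ?B. c x j * (2 * (grad \<eta> x j)\<^sup>2
        - \<eta> x * \<eta> (x + axis j 1) * (grad (G s) x j)\<^sup>2 / 2))"
      unfolding split_def
    proof (intro sum_mono mult_left_mono less_imp_le[OF c])
      fix e assume "e \<in> edges ?B"
      then have e: "fst e \<in> ?B" "fst e + axis (snd e) 1 \<in> ?B" by (auto simp: edges_def)
      let ?x = "fst e" and ?y = "fst e + axis (snd e) 1"
      have "(?g ?y - ?g ?x) * (u s ?y - u s ?x) \<le> 2 * (\<eta> ?y - \<eta> ?x)\<^sup>2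
          - \<eta> ?x * \<eta> ?y * (ln (u s ?y + \<delta>) - ln (u s ?x + \<delta>))\<^sup>2 / 2"
        using log_energy[OF up[OF s e(1)] up[OF s e(2)] \<eta>(2) \<eta>(2)] by simp
      also have "(ln (u s ?y + \<delta>) - ln (u s ?x + \<delta>))\<^sup>2 = (G s ?y - G s ?x)\<^sup>2"
        by (simp add: G_def power2_commute)
      finally show "(?g ?y - ?g ?x) * (u s ?y - u s ?x) \<le> 2 * (\<eta> ?y - \<eta> ?x)\<^sup>2
          - \<eta> ?x * \<eta> ?y * (G s ?y - G s ?x)\<^sup>2 / 2" .
    qed
    also have "\<dots> = 2 * ?D - ?E s / 2"
      by (simp add: sum_subtractf[symmetric] split_def right_diff_distrib sum_distrib_left sum_divide_distrib mult_ac)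
    finally show ?thesis .
  qed
  have contE: "continuous_on {a..t} ?E"
    unfolding split_def by (intro continuous_intros cont) (auto simp: edges_def)
  have "?\<phi> t - ?\<phi> a \<le> integral {a..t} (\<lambda>s. 2 * ?D - ?E s / 2)"
  proof (rule diff_le_integral[OF t(1) der le])
    show "continuous_on {a..t} (\<lambda>s. 2 * ?D - ?E s / 2)"
      by (rule continuous_on_diff[OF continuous_on_const continuous_on_divide[OF contE continuous_on_const]]) simp
  qed
  also have "\<dots> = 2 * ?D * (t - a) - integral {a..t} ?E / 2"
  proof -
    have "((\<lambda>s. 2 * ?D - ?E s / 2) has_integral (2 * ?D * (t - a) - integral {a..t} ?E / 2)) {a..t}"
      using has_integral_const_real[of "2 * ?D" a t] t contE
      by (intro has_integral_diff has_integral_divide integrable_integral integrable_continuous_real) (auto simp: mult.commute)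
    then show ?thesis by (rule integral_unique)
  qed
  finally show ?thesis by (simp add: algebra_simps)
qed

section \<open>Cutoff functions adapted to the conductances\<close>

text \<open>Sums compared with \<open>n ^ d\<close> replace averages over bonds, the number of bonds
  being absorbed in \<open>\<Lambda>\<close>. Both exponents are finite here.\<close>

definition conductance_bound :: "(int ^ 'd \<Rightarrow> 'd::finite \<Rightarrow> real) \<Rightarrow> int ^ 'd \<Rightarrow> nat \<Rightarrow> real \<Rightarrow> real \<Rightarrow> real \<Rightarrow> bool"
  where "conductance_bound c x0 n p q \<Lambda> \<longleftrightarrow> (\<forall>x j. 0 < c x j) \<and>
    (\<Sum>(x, j)\<in>edges (lbox x0 n). c x j powr p) \<le> \<Lambda> * real n ^ CARD('d) \<and>
    (\<Sum>(x, j)\<in>edges (lbox x0 n). (1 / c x j) powr q) \<le> \<Lambda> * real n ^ CARD('d)"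

text \<open>The profile descends only at good positions, by equal amounts. Each flank has
  \<open>R - R'\<close> positions and at most half of them are bad, so the slope is at most twice
  that of the linear profile.\<close>

lemma cutoff_1d:
  fixes Bad :: "int set" and R R' :: nat
  assumes R: "R' < R" and Bad: "real (card (Bad \<inter> {- int R..<int R})) \<le> (real R - real R') / 2"
  obtains \<psi> :: "int \<Rightarrow> real" where
    "\<And>s. 0 \<le> \<psi> s" "\<And>s. \<psi> s \<le> 1" "\<And>s. \<bar>s\<bar> \<le> int R' \<Longrightarrow> \<psi> s = 1" "\<And>s. int R \<le> \<bar>s\<bar> \<Longrightarrow> \<psi> s = 0"
    "\<And>s. \<bar>\<psi> (s + 1) - \<psi> s\<bar> \<le> 2 / (real R - real R')" "\<And>s. s \<in> Bad \<Longrightarrow> \<psi> (s + 1) = \<psi> s"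
proof -
  define P where "P = {int R'..<int R} - Bad"
  define M where "M = {- int R..<- int R'} - Bad"
  have fin: "finite P" "finite M" by (auto simp: P_def M_def)
  have cge: "(real R - real R') / 2 \<le> card (I - Bad)" if "I \<subseteq> {- int R..<int R}" "card I = R - R'" for I
  proof -
    have fI: "finite I" using that(1) finite_subset by blast
    have "card (I \<inter> Bad) \<le> card (Bad \<inter> {- int R..<int R})"
      using that(1) by (intro card_mono) auto
    moreover have "card I = card (I \<inter> Bad) + card (I - Bad)"
      using fI by (rule card_Int_Diff)
    ultimately show ?thesis using Bad that(2) R by (simp add: of_nat_diff)
  qed
  have cP: "(real R - real R') / 2 \<le> card P" unfolding P_def using R by (intro cge) auto
  have cM: "(real R - real R') / 2 \<le> card M" unfolding M_def using R by (intro cge) auto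
  have pos: "0 < (real R - real R') / 2" using R by simp
  have cPM: "0 < real (card P)" "0 < real (card M)" using cP cM pos by linarith+
  \<comment> \<open>From 1 are subtracted the fraction of good steps of the right flank already
    passed at \<open>s\<close> and the fraction of good steps of the left flank still ahead of
    \<open>s\<close>. The step at \<open>t\<close> is the one from \<open>t\<close> to
    \<open>t + 1\<close>.\<close>
  define \<psi> where "\<psi> s = 1 - real (card {t \<in> P. t < s}) / card P - real (card {t \<in> M. s \<le> t}) / card M" for s
  have b: "real (card {t \<in> P. t < s}) / card P \<le> 1" "real (card {t \<in> M. s \<le> t}) / card M \<le> 1" for s
    using cPM fin by (auto intro!: card_mono)
  have e1: "{t \<in> P. t < s} = {}" if "s \<le> int R'" for s using that by (auto simp: P_def)
  have e2: "{t \<in> M. s \<le> t} = {}" if "- int R' \<le> s" for s using that by (auto simp: M_def)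
  have e3: "{t \<in> P. t < s} = P" if "int R \<le> s" for s using that by (auto simp: P_def)
  have e4: "{t \<in> M. s \<le> t} = M" if "s \<le> - int R" for s using that by (auto simp: M_def)
  have diff: "\<psi> (s + 1) - \<psi> s = (if s \<in> M then 1 / card M else 0) - (if s \<in> P then 1 / card P else 0)" for s
  proof -
    have "t < s + 1 \<longleftrightarrow> t < s \<or> t = s" for t by auto
    then have "{t \<in> P. t < s + 1} = (if s \<in> P then insert s {t \<in> P. t < s} else {t \<in> P. t < s})" by auto
    then have 1: "real (card {t \<in> P. t < s + 1}) = card {t \<in> P. t < s} + (if s \<in> P then 1 else 0)"
      using fin by auto
    have "s \<le> t \<longleftrightarrow> s + 1 \<le> t \<or> t = s" for t by auto
    then have "{t \<in> M. s \<le> t} = (if s \<in> M then insert s {t \<in> M. s + 1 \<le> t} else {t \<in> M. s + 1 \<le> t})" by auto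
    then have 2: "real (card {t \<in> M. s \<le> t}) = card {t \<in> M. s + 1 \<le> t} + (if s \<in> M then 1 else 0)"
      using fin by auto
    show ?thesis unfolding \<psi>_def 1 2 by (simp add: add_divide_distrib)
  qed
  have le: "1 / card P \<le> 2 / (real R - real R')" "1 / card M \<le> 2 / (real R - real R')"
    using le_imp_inverse_le[OF cP pos] le_imp_inverse_le[OF cM pos] by (simp_all add: field_simps)
  have disj: "\<not> (s \<in> P \<and> s \<in> M)" for s by (auto simp: P_def M_def)
  show ?thesis
  proof
    have "0 \<le> \<psi> s \<and> \<psi> s \<le> 1" for s
    proof (cases "s \<le> int R'")
      case True
      show ?thesis using b(2)[of s] unfolding \<psi>_def e1[OF True] by simp
    next
      case False
      then have "- int R' \<le> s" by simp
      then show ?thesis using b(1)[of s] unfolding \<psi>_def by (simp add: e2)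
    qed
    then show "0 \<le> \<psi> s" "\<psi> s \<le> 1" for s by auto
    show "\<psi> s = 1" if "\<bar>s\<bar> \<le> int R'" for s
    proof -
      have "s \<le> int R'" "- int R' \<le> s" using that by auto
      then show ?thesis unfolding \<psi>_def by (simp only: e1 e2) simp
    qed
    show "\<psi> s = 0" if "int R \<le> \<bar>s\<bar>" for s
    proof (cases "0 \<le> s")
      case True
      then have "int R \<le> s" "- int R' \<le> s" using that by auto
      then show ?thesis unfolding \<psi>_def using cPM by (simp only: e3 e2) simp
    next
      case False
      then have "s \<le> - int R" "s \<le> int R'" using that by auto
      then show ?thesis unfolding \<psi>_def using cPM by (simp only: e4 e1) simp
    qed
    show "\<bar>\<psi> (s + 1) - \<psi> s\<bar> \<le> 2 / (real R - real R')" for s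
      unfolding diff using disj[of s] le pos by (auto simp: R less_imp_le)
    show "\<psi> (s + 1) = \<psi> s" if "s \<in> Bad" for s
      using diff[of s] that by (simp add: P_def M_def)
  qed
qed

lemma product_cutoff:
  fixes \<psi> :: "'d::finite \<Rightarrow> int \<Rightarrow> real" and x0 :: "int ^ 'd"
  assumes \<psi>: "\<And>i s. 0 \<le> \<psi> i s" "\<And>i s. \<psi> i s \<le> 1"
    and \<eta>_def: "\<And>x. \<eta> x = (\<Prod>i\<in>UNIV. \<psi> i (x $ i - x0 $ i))"
  shows "0 \<le> \<eta> x" "\<eta> x \<le> 1"
    "\<bar>\<eta> (x + axis j 1) - \<eta> x\<bar> \<le> \<bar>\<psi> j (x $ j - x0 $ j + 1) - \<psi> j (x $ j - x0 $ j)\<bar>"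
proof -
  show "0 \<le> \<eta> x" "\<eta> x \<le> 1" unfolding \<eta>_def using \<psi> by (auto intro!: prod_nonneg prod_le_1)
  let ?P = "\<Prod>i\<in>UNIV - {j}. \<psi> i (x $ i - x0 $ i)"
  have P: "0 \<le> ?P" "?P \<le> 1" using \<psi> by (auto intro!: prod_nonneg prod_le_1)
  have 1: "\<eta> x = \<psi> j (x $ j - x0 $ j) * ?P" unfolding \<eta>_def by (simp add: prod.remove)
  have "(\<Prod>i\<in>UNIV - {j}. \<psi> i ((x + axis j 1) $ i - x0 $ i)) = ?P"
    by (intro prod.cong) (auto simp: axis_def)
  then have 2: "\<eta> (x + axis j 1) = \<psi> j (x $ j - x0 $ j + 1) * ?P"
    unfolding \<eta>_def by (simp add: prod.remove[of UNIV j] algebra_simps)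
  have "\<bar>\<eta> (x + axis j 1) - \<eta> x\<bar> = \<bar>\<psi> j (x $ j - x0 $ j + 1) - \<psi> j (x $ j - x0 $ j)\<bar> * ?P"
    using P unfolding 1 2 by (simp add: left_diff_distrib[symmetric] abs_mult)
  also have "\<dots> \<le> \<bar>\<psi> j (x $ j - x0 $ j + 1) - \<psi> j (x $ j - x0 $ j)\<bar>"
    using P by (intro mult_left_le) auto
  finally show "\<bar>\<eta> (x + axis j 1) - \<eta> x\<bar> \<le> \<bar>\<psi> j (x $ j - x0 $ j + 1) - \<psi> j (x $ j - x0 $ j)\<bar>" .
qed

text \<open>Markov's inequality for the counting measure; it limits the number of bad
  hyperplanes.\<close>

lemma card_exceeding_le:
  fixes f :: "'a \<Rightarrow> real"
  assumes "finite S" "\<And>s. s \<in> S \<Longrightarrow> 0 \<le> f s" "(\<Sum>s\<in>S. f s) \<le> T" "0 < K"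
  shows "real (card {s \<in> S. K < f s}) \<le> T / K"
proof -
  have "K * card {s \<in> S. K < f s} = (\<Sum>s\<in>{s \<in> S. K < f s}. K)" by simp
  also have "\<dots> \<le> (\<Sum>s\<in>{s \<in> S. K < f s}. f s)" by (intro sum_mono) auto
  also have "\<dots> \<le> (\<Sum>s\<in>S. f s)" using assms by (intro sum_mono2) auto
  finally show ?thesis using assms by (simp add: field_simps)
qed

text \<open>Against a weight bounded in L^p, the function \<open>w^2\<close> has to be controlled in
  the dual exponent \<open>p / (p - 1)\<close>. Its norm there is interpolated between L^1 and the
  exponent \<open>\<kappa>\<close>, which the weighted Sobolev inequality supplies.
  \<open>\<tau>\<close> is the share of the Sobolev side, and \<open>\<tau> < 1\<close> means that
  the dual exponent lies strictly below \<open>\<kappa>\<close>.\<close>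

lemma weighted_layer_estimate:
  fixes l h :: "int ^ 'd::finite" and c :: "int ^ 'd \<Rightarrow> 'd \<Rightarrow> real"
  assumes lh: "l \<le> h" and K: "\<And>i. i \<notin> K \<Longrightarrow> l $ i = h $ i" "K \<noteq> {}"
    and L: "\<And>j. real_of_int (h $ j - l $ j + 1) \<le> L"
    and p: "1 < p" and q: "1 < q" and \<kappa>: "1 < \<kappa>" "\<kappa> * (real (card K) - 2 + card K / q) \<le> card K"
    and \<tau>: "\<tau> = \<kappa> / (p * (\<kappa> - 1))" "\<tau> < 1"
    and w: "\<And>x. 0 \<le> w x" and c: "\<And>x j. 0 < c x j"
    and g: "\<And>x. x \<in> {l..h} \<Longrightarrow> 0 \<le> g x" "(\<Sum>x\<in>{l..h}. g x powr p) \<le> K1"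
    and K2: "(\<Sum>(x, j)\<in>edges {l..h}. (1 / c x j) powr q) \<le> K2"
  defines "V \<equiv> real (card {l..h})"
  shows "(\<Sum>x\<in>{l..h}. g x * (w x)\<^sup>2)
    \<le> (K1 / V) powr (1 / p) * (2 * (\<Sum>x\<in>{l..h}. (w x)\<^sup>2)
        + 4 * real CARD('d) * (1 + \<kappa> * (1 - 1 / q))\<^sup>2 * L\<^sup>2 * (K2 / V) powr (1 / q)
          * (\<Sum>(x, j)\<in>edges {l..h}. c x j * (grad w x j)\<^sup>2)) powr \<tau>
        * (\<Sum>x\<in>{l..h}. (w x)\<^sup>2) powr (1 - \<tau>)"
proof -
  define B where "B = {l..h}"
  define a where "a = 1 / (p * (\<kappa> - 1))"
  define f where "f x = (w x)\<^sup>2" for x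
  define X where "X = mean B (\<lambda>x. w x powr (2 * \<kappa>))"
  define E where "E = (\<Sum>(x, j)\<in>edges B. c x j * (grad w x j)\<^sup>2)"
  define C where "C = 4 * real CARD('d) * (1 + \<kappa> * (1 - 1 / q))\<^sup>2 * L\<^sup>2"
  define W where "W = (\<Sum>(x, j)\<in>edges B. (1 / c x j) powr q)"
  have fB: "finite B" "B \<noteq> {}" using lh by (auto simp: B_def)
  have V: "V > 0" using fB by (simp add: V_def B_def card_gt_0_iff)
  have a0: "0 < a" "\<tau> = \<kappa> * a" "a - \<tau> = - (1 / p)" "0 < \<tau>"
  proof -
    show a: "0 < a" and t: "\<tau> = \<kappa> * a" using p \<kappa> by (simp_all add: a_def \<tau>)
    show "0 < \<tau>" using a \<kappa> by (simp add: t)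
    have "a * (\<kappa> - 1) = 1 / p" using p \<kappa> by (simp add: a_def)
    then show "a - \<tau> = - (1 / p)" by (simp add: t algebra_simps)
  qed
  have fx: "f x powr \<kappa> = w x powr (2 * \<kappa>)" for x
    using w[of x] by (cases "w x = 0") (simp_all add: f_def powr_powr flip: powr_numeral)
  have E0: "0 \<le> E" unfolding E_def using c by (auto intro!: sum_nonneg simp: less_imp_le)
  have C0: "0 \<le> C" by (simp add: C_def)
  have f0: "0 \<le> f x" for x by (simp add: f_def)
  have X0: "0 \<le> X" unfolding X_def by (intro mean_nonneg) simp
  have W0: "0 \<le> W" unfolding W_def by (auto intro!: sum_nonneg)
  have K10: "0 \<le> K1" using g(2) by (rule order_trans[rotated]) (intro sum_nonneg, simp)
  define Y where "Y = 2 * mean B f + C * (K2 / V) powr (1 / q) * (E / V)"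
  have Y0: "0 \<le> Y" unfolding Y_def using C0 E0 V f0 by (auto intro!: add_nonneg_nonneg mean_nonneg)
  have "X powr (1 / \<kappa>) \<le> 2 * mean B f + C * (W / V) powr (1 / q) * (E / V)"
  proof -
    have "mean B f = mean B (\<lambda>x. (w x)\<^sup>2)" by (simp add: mean_def f_def)
    then show ?thesis
      using sobolev_weighted[OF lh K L q _ \<kappa>(2), of w c] w c \<kappa>(1)
      by (simp add: X_def C_def W_def E_def B_def V_def)
  qed
  also have "\<dots> \<le> Y"
    unfolding Y_def using K2 W0 V C0 E0 q
    by (intro add_left_mono mult_right_mono mult_left_mono powr_mono2) (auto simp: W_def B_def divide_right_mono)
  finally have "(X powr (1 / \<kappa>)) powr \<tau> \<le> Y powr \<tau>" using a0 by (intro powr_mono2) auto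
  then have Xa: "X powr a \<le> Y powr \<tau>" using \<kappa>(1) X0 a0 by (simp add: powr_powr)
  have "(\<Sum>x\<in>B. g x * f x) = (\<Sum>x\<in>B. (g x powr p) powr (1 / p) * (f x powr \<kappa>) powr a * f x powr (1 - \<tau>))"
  proof (intro sum.cong refl)
    fix x assume x: "x \<in> B"
    have "(g x powr p) powr (1 / p) = g x" using g(1) x p by (simp add: powr_powr B_def)
    moreover have "(f x powr \<kappa>) powr a * f x powr (1 - \<tau>) = f x"
      using f0[of x] by (cases "f x = 0") (simp_all add: powr_powr a0(2)[symmetric] powr_add[symmetric])
    ultimately show "g x * f x = (g x powr p) powr (1 / p) * (f x powr \<kappa>) powr a * f x powr (1 - \<tau>)"
      by (simp add: mult.assoc)
  qed
  also have "\<dots> \<le> (\<Sum>x\<in>B. g x powr p) powr (1 / p) * (\<Sum>x\<in>B. f x powr \<kappa>) powr a * (\<Sum>x\<in>B. f x) powr (1 - \<tau>)"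
    using p a0 \<tau> f0 fB by (intro sum_powr_mult3_le) auto
  also have "\<dots> \<le> K1 powr (1 / p) * (V powr a * Y powr \<tau>) * (\<Sum>x\<in>B. f x) powr (1 - \<tau>)"
  proof (intro mult_right_mono mult_mono powr_mono2)
    have "(\<Sum>x\<in>B. f x powr \<kappa>) = V * X"
      using sum_eq_card_mean[OF fB, of "\<lambda>x. f x powr \<kappa>"] by (simp add: X_def fx V_def B_def)
    then show "(\<Sum>x\<in>B. f x powr \<kappa>) powr a \<le> V powr a * Y powr \<tau>"
      using Xa V X0 by (simp add: powr_mult mult_left_mono)
  qed (use p g in \<open>auto simp: B_def intro!: sum_nonneg\<close>)
  \<comment> \<open>The powers of the volume balance because of
    \<open>a - \<tau> = - (1 / p)\<close>.\<close>
  also have "K1 powr (1 / p) * (V powr a * Y powr \<tau>) = (K1 / V) powr (1 / p) * (V * Y) powr \<tau>"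
  proof -
    have "a = \<tau> - 1 / p" using a0 by simp
    then have "V powr a = V powr \<tau> / V powr (1 / p)" by (simp only: powr_diff)
    moreover have "(K1 / V) powr (1 / p) = K1 powr (1 / p) / V powr (1 / p)"
      by (simp add: powr_divide)
    moreover have "(V * Y) powr \<tau> = V powr \<tau> * Y powr \<tau>" by (simp add: powr_mult)
    ultimately show ?thesis by simp
  qed
  also have "V * Y = 2 * (\<Sum>x\<in>B. f x) + C * (K2 / V) powr (1 / q) * E"
  proof -
    have "(\<Sum>x\<in>B. f x) = V * mean B f" using sum_eq_card_mean[OF fB, of f] by (simp add: V_def B_def)
    then show ?thesis unfolding Y_def using V by (simp add: distrib_left)
  qed
  finally show ?thesis
    unfolding B_def f_def C_def E_def .
qed

section \<open>Decomposition of a box into hyperplane layers\<close>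

definition layer :: "int ^ 'd \<Rightarrow> nat \<Rightarrow> 'd \<Rightarrow> int \<Rightarrow> (int ^ 'd) set"
  where "layer x0 R i s = {x \<in> lbox x0 R. x $ i - x0 $ i = s}"

text \<open>A layer is a box degenerate in direction \<open>i\<close>, to which the Sobolev
  inequality applies with the \<open>d - 1\<close> directions \<open>UNIV - {i}\<close>.\<close>

lemma layer_eq_box:
  assumes "\<bar>s\<bar> \<le> int R"
  shows "layer x0 R i s = {upd (x0 - (\<chi> i. int R)) i (x0 $ i + s)..upd (x0 + (\<chi> i. int R)) i (x0 $ i + s)}"
proof (intro set_eqI)
  fix x
  have "x \<in> {upd (x0 - (\<chi> i. int R)) i (x0 $ i + s)..upd (x0 + (\<chi> i. int R)) i (x0 $ i + s)}
     \<longleftrightarrow> x $ i - x0 $ i = s \<and> (\<forall>k. k \<noteq> i \<longrightarrow> \<bar>x $ k - x0 $ k\<bar> \<le> int R)"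
    unfolding mem_box by (auto simp: abs_le_iff algebra_simps)
  also have "\<dots> \<longleftrightarrow> x \<in> layer x0 R i s"
    using assms by (auto simp: layer_def mem_lbox)
  finally show "x \<in> layer x0 R i s \<longleftrightarrow> x \<in> {upd (x0 - (\<chi> i. int R)) i (x0 $ i + s)..upd (x0 + (\<chi> i. int R)) i (x0 $ i + s)}"
    by simp
qed

lemma finite_layer [simp]: "finite (layer (x0 :: int ^ 'd::finite) R i s)"
  by (simp add: layer_def)

lemma card_layer:
  assumes "\<bar>s\<bar> \<le> int R"
  shows "card (layer (x0 :: int ^ 'd::finite) R i s) = (2 * R + 1) ^ (CARD('d) - 1)"
proof -
  have "nat (2 * int R + 1) = 2 * R + 1" by simp
  then have "(\<Prod>k\<in>UNIV - {i}. nat (upd (x0 + (\<chi> i. int R)) i (x0 $ i + s) $ k - upd (x0 - (\<chi> i. int R)) i (x0 $ i + s) $ k + 1))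
     = (\<Prod>k\<in>UNIV - {i}. 2 * R + 1)"
    by (intro prod.cong) auto
  then show ?thesis
    unfolding layer_eq_box[OF assms] card_box by (simp add: prod.remove[of UNIV i] card_Diff_singleton)
qed

lemma sum_layers:
  "(\<Sum>s\<in>{- int R..int R}. \<Sum>x\<in>layer (x0 :: int ^ 'd::finite) R i s. g x) = (\<Sum>x\<in>lbox x0 R. g x :: real)"
proof -
  have "(\<lambda>x. x $ i - x0 $ i) ` lbox x0 R \<subseteq> {- int R..int R}"
    by (auto simp: mem_lbox abs_le_iff) (metis minus_le_iff minus_diff_eq)
  from sum.group[OF _ _ this, of g] show ?thesis unfolding layer_def by simp
qed

text \<open>Only an inequality, since edges of direction \<open>i\<close> run between two layers and
  belong to none.\<close>

lemma sum_edges_layers: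
  fixes x0 :: "int ^ 'd::finite" and g :: "(int ^ 'd) \<times> 'd \<Rightarrow> real"
  assumes g: "\<And>e. 0 \<le> g e"
  shows "(\<Sum>s\<in>{- int R..int R}. \<Sum>e\<in>edges (layer x0 R i s). g e) \<le> (\<Sum>e\<in>edges (lbox x0 R). g e)"
proof -
  have im: "(\<lambda>e. fst e $ i - x0 $ i) ` edges (lbox x0 R) \<subseteq> {- int R..int R}"
    by (auto simp: edges_def mem_lbox abs_le_iff) (metis minus_le_iff minus_diff_eq)
  have "(\<Sum>s\<in>{- int R..int R}. \<Sum>e\<in>edges (layer x0 R i s). g e)
     \<le> (\<Sum>s\<in>{- int R..int R}. \<Sum>e\<in>{e \<in> edges (lbox x0 R). fst e $ i - x0 $ i = s}. g e)"
  proof (intro sum_mono sum_mono2)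
    show "finite {e \<in> edges (lbox x0 R). fst e $ i - x0 $ i = s}" for s
      by (rule finite_subset[OF _ finite_edges[OF finite_lbox[of x0 R]]]) auto
  qed (auto simp: edges_def layer_def g)
  also have "\<dots> = (\<Sum>e\<in>edges (lbox x0 R). g e)"
    by (rule sum.group[OF _ _ im]) (simp_all add: finite_edges)
  finally show ?thesis .
qed

text \<open>Here an edge of direction \<open>j\<close> is assigned to the layer, orthogonal to
  \<open>j\<close>, of its lower end point; hence the top layer is left out.\<close>

lemma sum_edges_eq_layers:
  fixes x0 :: "int ^ 'd::finite" and F :: "int ^ 'd \<Rightarrow> 'd \<Rightarrow> real"
  shows "(\<Sum>(x, j)\<in>edges (lbox x0 R). F x j)
    = (\<Sum>j\<in>UNIV. \<Sum>s\<in>{- int R..<int R}. \<Sum>x\<in>layer x0 R j s. F x j)"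
proof -
  have "(\<Sum>(x, j)\<in>edges (lbox x0 R). F x j)
      = (\<Sum>j\<in>UNIV. \<Sum>x\<in>lbox x0 R. if x $ j < x0 $ j + int R then F x j else 0)"
    unfolding lbox_def sum_edges_box by (subst sum.swap) simp
  also have "\<dots> = (\<Sum>j\<in>UNIV. \<Sum>x\<in>{x \<in> lbox x0 R. x $ j < x0 $ j + int R}. F x j)"
    by (simp add: sum.inter_filter)
  also have "\<dots> = (\<Sum>j\<in>UNIV. \<Sum>s\<in>{- int R..<int R}. \<Sum>x\<in>layer x0 R j s. F x j)"
  proof (intro sum.cong refl)
    fix j :: 'd
    let ?S = "{x \<in> lbox x0 R. x $ j < x0 $ j + int R}"
    have im: "(\<lambda>x. x $ j - x0 $ j) ` ?S \<subseteq> {- int R..<int R}"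
      by (auto simp: mem_lbox abs_le_iff) (metis minus_le_iff minus_diff_eq)
    have "(\<Sum>x\<in>?S. F x j) = (\<Sum>s\<in>{- int R..<int R}. \<Sum>x\<in>{x \<in> ?S. x $ j - x0 $ j = s}. F x j)"
      by (rule sum.group[OF _ _ im, symmetric]) simp_all
    also have "\<dots> = (\<Sum>s\<in>{- int R..<int R}. \<Sum>x\<in>layer x0 R j s. F x j)"
      by (intro sum.cong) (auto simp: layer_def)
    finally show "(\<Sum>x\<in>?S. F x j) = (\<Sum>s\<in>{- int R..<int R}. \<Sum>x\<in>layer x0 R j s. F x j)" .
  qed
  finally show ?thesis .
qed

lemma layer_shift:
  assumes "s \<in> {- int R..<int R}"
  shows "(\<Sum>x\<in>layer (x0 :: int ^ 'd::finite) R j s. g (x + axis j 1)) = (\<Sum>x\<in>layer x0 R j (s + 1). g x :: real)"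
proof (rule sum.reindex_bij_witness[where i = "\<lambda>x. x - axis j 1" and j = "\<lambda>x. x + axis j 1"])
  show "x + axis j 1 \<in> layer x0 R j (s + 1)" if "x \<in> layer x0 R j s" for x
    using that assms by (auto simp: layer_def mem_lbox axis_def)
  show "x - axis j 1 \<in> layer x0 R j s" if "x \<in> layer x0 R j (s + 1)" for x
    using that assms by (auto simp: layer_def mem_lbox axis_def)
qed auto

lemma sum_shift_le:
  fixes Z :: "int \<Rightarrow> real"
  assumes "\<And>s. 0 \<le> Z s"
  shows "(\<Sum>s\<in>{- int R..<int R}. Z (s + 1)) \<le> (\<Sum>s\<in>{- int R..int R}. Z s)"
proof -
  have "(\<Sum>s\<in>{- int R..<int R}. Z (s + 1)) = (\<Sum>s\<in>{- int R + 1..int R}. Z s)"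
    by (rule sum.reindex_bij_witness[where i = "\<lambda>s. s - 1" and j = "\<lambda>s. s + 1"]) auto
  also have "\<dots> \<le> (\<Sum>s\<in>{- int R..int R}. Z s)"
    using assms by (intro sum_mono2) auto
  finally show ?thesis .
qed

text \<open>With \<open>H = 6 * \<Lambda> * 4 ^ (d - 1)\<close>, which bounds the averaged moments
  on a good layer up to \<open>1 / \<rho>\<close>, this is \<open>H * (2 + 9 * C0 * H)\<close>. Here
  \<open>C0\<close> is the constant of the weighted Sobolev inequality, and 9 is the square of the
  side length \<open>3 * n\<close> in units of \<open>n\<close>.\<close>

definition layer_const :: "nat \<Rightarrow> real \<Rightarrow> real \<Rightarrow> real \<Rightarrow> real"
  where "layer_const d q \<kappa> \<Lambda> =
    6 * \<Lambda> * 4 ^ (d - 1) * (2 + 36 * real d * (1 + \<kappa> * (1 - 1 / q))\<^sup>2 * (6 * \<Lambda> * 4 ^ (d - 1)))"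

lemma layer_const_ge_1: "1 \<le> \<Lambda> \<Longrightarrow> 1 \<le> layer_const d q \<kappa> \<Lambda>"
proof -
  assume \<Lambda>: "1 \<le> \<Lambda>"
  have "1 * 1 \<le> (6 * \<Lambda>) * (4::real) ^ (d - 1)" using \<Lambda> by (intro mult_mono) auto
  moreover have "1 \<le> 2 + 36 * real d * (1 + \<kappa> * (1 - 1 / q))\<^sup>2 * (6 * \<Lambda> * 4 ^ (d - 1))"
    using \<Lambda> by (simp add: add_increasing2)
  ultimately show ?thesis
    unfolding layer_const_def using mult_mono[of 1 "6 * \<Lambda> * 4 ^ (d - 1)" 1] by force
qed

text \<open>On a good layer the averaged moments are at most \<open>H / \<rho>\<close>, a number
  above 1, so the exponents \<open>1 / p\<close>, \<open>1 / q\<close> and \<open>\<tau>\<close> of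
  such bounds may be raised to 1; this is the origin of \<open>1 / \<rho>\<^sup>2\<close>. The
  result is linear in \<open>f\<close> and \<open>E\<close>, so that layers can be added.\<close>

lemma good_layer_estimate:
  fixes x0 :: "int ^ 'd::finite" and c :: "int ^ 'd \<Rightarrow> 'd \<Rightarrow> real"
  assumes d: "2 \<le> CARD('d)" and n: "R \<le> n" "n \<le> 8 * R" "1 \<le> n" and \<rho>: "0 < \<rho>" "\<rho> \<le> 1" and \<Lambda>: "1 \<le> \<Lambda>"
    and p: "1 < p" and q: "1 < q"
    and \<kappa>: "1 < \<kappa>" "\<kappa> * (real CARD('d) - 3 + (real CARD('d) - 1) / q) \<le> real CARD('d) - 1"
    and \<tau>: "\<tau> = \<kappa> / (p * (\<kappa> - 1))" "\<tau> < 1"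
    and w: "\<And>x. 0 \<le> w x" and c: "\<And>x j. 0 < c x j" and s: "\<bar>s\<bar> \<le> int R"
    and K: "K \<le> 6 * \<Lambda> * real n ^ (CARD('d) - 1) / \<rho>"
    and g: "\<And>x. x \<in> layer x0 R i s \<Longrightarrow> 0 \<le> g x" "(\<Sum>x\<in>layer x0 R i s. g x powr p) \<le> K"
    and K2: "(\<Sum>(x, j)\<in>edges (layer x0 R i s). (1 / c x j) powr q) \<le> K"
    and AB: "0 < A" "0 < B"
  defines "f \<equiv> \<Sum>x\<in>layer x0 R i s. (w x)\<^sup>2"
    and "E \<equiv> \<Sum>(x, j)\<in>edges (layer x0 R i s). c x j * (grad w x j)\<^sup>2"
  shows "(\<Sum>x\<in>layer x0 R i s. g x * (w x)\<^sup>2)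
    \<le> layer_const CARD('d) q \<kappa> \<Lambda> / \<rho>\<^sup>2 * (A powr \<tau> * B powr (1 - \<tau>)) * ((f + (real n)\<^sup>2 * E) / A + f / B)"
proof -
  define l where "l = upd (x0 - (\<chi> i. int R)) i (x0 $ i + s)"
  define h where "h = upd (x0 + (\<chi> i. int R)) i (x0 $ i + s)"
  have lay: "layer x0 R i s = {l..h}" unfolding l_def h_def by (rule layer_eq_box[OF s])
  define V where "V = real (card {l..h})"
  define H where "H = 6 * \<Lambda> * 4 ^ (CARD('d) - 1)"
  define C0 where "C0 = 4 * real CARD('d) * (1 + \<kappa> * (1 - 1 / q))\<^sup>2"
  define C2 where "C2 = 2 + 9 * C0 * H"
  have V: "V = real (2 * R + 1) ^ (CARD('d) - 1)"
    using card_layer[OF s, of x0 i] by (simp add: V_def lay del: of_nat_Suc)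
  have V0: "V > 0" unfolding V by simp
  have "1 * 1 \<le> (6 * \<Lambda>) * (4::real) ^ (CARD('d) - 1)" using \<Lambda> by (intro mult_mono) auto
  then have H1: "1 \<le> H" by (simp add: H_def)
  have C00: "0 \<le> C0" by (simp add: C0_def)
  have C21: "2 \<le> C2" using C00 H1 by (simp add: C2_def)
  have KV: "K / V \<le> H / \<rho>"
  proof -
    \<comment> \<open>The assumption \<open>n \<le> 8 * R\<close> gives
      \<open>n / 4 \<le> 2 * R + 1\<close>.\<close>
    have "(real n / 4) ^ (CARD('d) - 1) \<le> V"
      unfolding V using n by (intro power_mono) auto
    then have nV: "real n ^ (CARD('d) - 1) \<le> 4 ^ (CARD('d) - 1) * V"
      by (simp add: power_divide field_simps)
    have "K \<le> 6 * \<Lambda> / \<rho> * real n ^ (CARD('d) - 1)" using K by simp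
    also have "\<dots> \<le> 6 * \<Lambda> / \<rho> * (4 ^ (CARD('d) - 1) * V)"
      using nV \<Lambda> \<rho> by (intro mult_left_mono) auto
    also have "\<dots> = H / \<rho> * V" by (simp add: H_def)
    finally show ?thesis using V0 by (simp add: field_simps)
  qed
  have H\<rho>: "1 \<le> H / \<rho>" using H1 \<rho> by (simp add: field_simps)
  have K0: "0 \<le> K" using g(2) by (rule order_trans[rotated]) (intro sum_nonneg, simp)
  have KVp: "(K / V) powr (1 / r) \<le> H / \<rho>" if "1 < r" for r
  proof -
    have "(K / V) powr (1 / r) \<le> (H / \<rho>) powr (1 / r)"
      using KV K0 V0 that by (intro powr_mono2) auto
    also have "\<dots> \<le> (H / \<rho>) powr 1" using H\<rho> that by (intro powr_mono) auto
    finally show ?thesis using H\<rho> by simp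
  qed
  have f0: "0 \<le> f" unfolding f_def by (intro sum_nonneg) simp
  have E0: "0 \<le> E" unfolding E_def using c by (auto intro!: sum_nonneg simp: less_imp_le)
  have k: "real (card (UNIV - {i})) = real CARD('d) - 1" using d by (simp add: card_Diff_singleton of_nat_diff)
  have \<tau>0: "0 < \<tau>" using p \<kappa> by (simp add: \<tau>)
  have ne: "UNIV - {i} \<noteq> {}"
  proof
    assume "UNIV - {i} = {}"
    then have "real (card (UNIV - {i})) = 0" by (simp only: card.empty)
    then have "real CARD('d) - 1 = 0" using k by simp
    then show False using d by simp
  qed
  have "(\<Sum>x\<in>{l..h}. g x * (w x)\<^sup>2) \<le> (K / V) powr (1 / p) * (2 * (\<Sum>x\<in>{l..h}. (w x)\<^sup>2)
        + 4 * real CARD('d) * (1 + \<kappa> * (1 - 1 / q))\<^sup>2 * (3 * real n)\<^sup>2 * (K / V) powr (1 / q)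
          * (\<Sum>(x, j)\<in>edges {l..h}. c x j * (grad w x j)\<^sup>2)) powr \<tau>
        * (\<Sum>x\<in>{l..h}. (w x)\<^sup>2) powr (1 - \<tau>)"
    unfolding V_def
  proof (rule weighted_layer_estimate[where K = "UNIV - {i}"])
    show "l \<le> h" by (auto simp: less_eq_vec_def l_def h_def)
    show "l $ j = h $ j" if "j \<notin> UNIV - {i}" for j using that by (simp add: l_def h_def)
    show "real_of_int (h $ j - l $ j + 1) \<le> 3 * real n" for j
      using n by (auto simp: l_def h_def)
    show "\<kappa> * (real (card (UNIV - {i})) - 2 + real (card (UNIV - {i})) / q) \<le> real (card (UNIV - {i}))"
      unfolding k using \<kappa>(2) by (simp add: algebra_simps)
  qed (use assms ne in \<open>auto simp: lay\<close>)
  also have "\<dots> = (K / V) powr (1 / p) * (2 * f + C0 * (3 * real n)\<^sup>2 * (K / V) powr (1 / q) * E) powr \<tau> * f powr (1 - \<tau>)"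
    by (simp add: f_def E_def lay C0_def)
  also have "\<dots> \<le> H / \<rho> * (C2 / \<rho> * (f + (real n)\<^sup>2 * E) powr \<tau>) * f powr (1 - \<tau>)"
  proof (intro mult_right_mono mult_mono KVp p)
    have "2 * f + C0 * (3 * real n)\<^sup>2 * (K / V) powr (1 / q) * E \<le> 2 * f + C0 * (3 * real n)\<^sup>2 * (H / \<rho>) * E"
      using KVp[OF q] C00 E0 by (intro add_left_mono mult_right_mono mult_left_mono) auto
    also have "\<dots> = 2 * f + (9 * C0 * H / \<rho>) * ((real n)\<^sup>2 * E)" by (simp add: power_mult_distrib)
    also have "\<dots> \<le> C2 / \<rho> * f + C2 / \<rho> * ((real n)\<^sup>2 * E)"
    proof (intro add_mono mult_right_mono f0 mult_nonneg_nonneg E0)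
      have "0 \<le> 9 * C0 * H" using C00 H1 by simp
      then show "2 \<le> C2 / \<rho>" using \<rho> C21 by (simp add: field_simps)
      show "9 * C0 * H / \<rho> \<le> C2 / \<rho>" using \<rho> by (simp add: C2_def divide_right_mono)
    qed simp
    finally have "2 * f + C0 * (3 * real n)\<^sup>2 * (K / V) powr (1 / q) * E \<le> C2 / \<rho> * (f + (real n)\<^sup>2 * E)"
      by (simp add: distrib_left)
    then have "(2 * f + C0 * (3 * real n)\<^sup>2 * (K / V) powr (1 / q) * E) powr \<tau> \<le> (C2 / \<rho> * (f + (real n)\<^sup>2 * E)) powr \<tau>"
      using f0 C00 E0 \<tau>0 by (intro powr_mono2) auto
    also have "\<dots> = (C2 / \<rho>) powr \<tau> * (f + (real n)\<^sup>2 * E) powr \<tau>"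
      by (simp only: powr_mult)
    also have "\<dots> \<le> (C2 / \<rho>) powr 1 * (f + (real n)\<^sup>2 * E) powr \<tau>"
      using C21 \<rho> \<tau> by (intro mult_right_mono powr_mono) auto
    finally show "(2 * f + C0 * (3 * real n)\<^sup>2 * (K / V) powr (1 / q) * E) powr \<tau> \<le> C2 / \<rho> * (f + (real n)\<^sup>2 * E) powr \<tau>"
      using C21 \<rho> by simp
  qed (use H\<rho> in auto)
  also have "\<dots> = H * C2 / \<rho>\<^sup>2 * ((f + (real n)\<^sup>2 * E) powr \<tau> * f powr (1 - \<tau>))"
    by (simp add: power2_eq_square)
  also have "\<dots> \<le> H * C2 / \<rho>\<^sup>2 * (A powr \<tau> * B powr (1 - \<tau>) * (\<tau> * ((f + (real n)\<^sup>2 * E) / A) + (1 - \<tau>) * (f / B)))"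
    using H1 C21 f0 E0 AB \<tau>0 \<tau>(2) by (intro mult_left_mono powr_mult_le_linear) auto
  also have "\<dots> \<le> H * C2 / \<rho>\<^sup>2 * (A powr \<tau> * B powr (1 - \<tau>) * ((f + (real n)\<^sup>2 * E) / A + f / B))"
  proof (intro mult_left_mono add_mono)
    show "\<tau> * ((f + (real n)\<^sup>2 * E) / A) \<le> (f + (real n)\<^sup>2 * E) / A"
      using f0 E0 AB \<tau>0 \<tau>(2) by (intro mult_left_le_one_le) auto
    show "(1 - \<tau>) * (f / B) \<le> f / B"
      using f0 AB \<tau>0 \<tau>(2) by (intro mult_left_le_one_le) auto
  qed (use H1 C21 in auto)
  also have "H * C2 = layer_const CARD('d) q \<kappa> \<Lambda>"
    by (simp add: H_def C2_def C0_def layer_const_def)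
  finally show ?thesis by (simp add: lay mult.assoc)
qed

text \<open>\<open>\<eta>\<close> is obtained before \<open>w\<close>, \<open>A\<close> and
  \<open>B\<close>: it depends on the conductances only and serves all functions, in particular a
  solution at all times. Of \<open>\<rho> ^ 4\<close>, one factor \<open>\<rho>\<^sup>2\<close>
  comes from the squared slope of \<open>\<eta>\<close> and the other one from the layers.\<close>

lemma exists_good_cutoff:
  fixes x0 :: "int ^ 'd::finite" and c :: "int ^ 'd \<Rightarrow> 'd \<Rightarrow> real"
  assumes cb: "conductance_bound c x0 n p q \<Lambda>"
    and d: "2 \<le> CARD('d)" and n: "R' < R" "R \<le> n" "n \<le> 8 * R" "1 \<le> n"
    and \<rho>: "0 < \<rho>" "\<rho> \<le> 1" "\<rho> * real n \<le> real R - real R'" and \<Lambda>: "1 \<le> \<Lambda>"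
    and p: "1 < p" and q: "1 < q"
    and \<kappa>: "1 < \<kappa>" "\<kappa> * (real CARD('d) - 3 + (real CARD('d) - 1) / q) \<le> real CARD('d) - 1"
    and \<tau>: "\<tau> = \<kappa> / (p * (\<kappa> - 1))" "\<tau> < 1"
  obtains \<eta> where "\<And>x. 0 \<le> \<eta> x" "\<And>x. \<eta> x \<le> 1" "\<And>x. x \<in> lbox x0 R' \<Longrightarrow> \<eta> x = 1"
    "\<And>x. x \<notin> lbox x0 (R - 1) \<Longrightarrow> \<eta> x = 0"
    "\<And>w A B. \<lbrakk>\<And>x. 0 \<le> w x; 0 < A; 0 < B\<rbrakk> \<Longrightarrow>
      cutoff_term c (lbox x0 R) \<eta> w
      \<le> 4 * real CARD('d) * layer_const CARD('d) q \<kappa> \<Lambda> / \<rho> ^ 4 / (real n)\<^sup>2 * (A powr \<tau> * B powr (1 - \<tau>))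
        * (((\<Sum>x\<in>lbox x0 R. (w x)\<^sup>2)
            + (real n)\<^sup>2 * (\<Sum>(x, j)\<in>edges (lbox x0 R). c x j * (grad w x j)\<^sup>2)) / A
          + (\<Sum>x\<in>lbox x0 R. (w x)\<^sup>2) / B)"
proof -
  let ?d = "CARD('d)"
  define T where "T = \<Lambda> * real n ^ ?d"
  \<comment> \<open>Each of the three kinds of bad hyperplanes then has at most
    \<open>T / K = (R - R') / 6\<close> members, altogether no more than \<open>cutoff_1d\<close>
    tolerates.\<close>
  define K where "K = 6 * T / (real R - real R')"
  define \<alpha> where "\<alpha> j s = (\<Sum>x\<in>layer x0 R j s. c x j powr p)" for j s
  define \<beta> where "\<beta> j s = (\<Sum>(x, i)\<in>edges (layer x0 R j s). (1 / c x i) powr q)" for j s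
  \<comment> \<open>An edge across position \<open>s\<close> has its end points on the layers
    \<open>s\<close> and \<open>s + 1\<close>, and the Sobolev inequality is used on both; hence two
    conditions on \<open>\<beta>\<close>. The weights of the crossing edges themselves are counted
    once, in \<open>\<alpha> j s\<close>.\<close>
  define Bad where "Bad j = {s. K < \<alpha> j s} \<union> {s. K < \<beta> j s} \<union> {s. K < \<beta> j (s + 1)}" for j
  have c: "0 < c x j" for x j using cb by (simp add: conductance_bound_def)
  have T0: "0 < T" using \<Lambda> n by (simp add: T_def)
  have RR: "0 < real R - real R'" using n by simp
  have K0: "0 < K" using T0 RR by (simp add: K_def)
  have TK: "T / K = (real R - real R') / 6" using T0 RR by (simp add: K_def)
  have Kle: "K \<le> 6 * \<Lambda> * real n ^ (?d - 1) / \<rho>"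
  proof -
    have "real n ^ ?d = real n * real n ^ (?d - 1)"
      using d by (metis One_nat_def Suc_leD Suc_pred less_eq_Suc_le numeral_2_eq_2 power_Suc)
    then have "6 * T = (6 * \<Lambda> * real n ^ (?d - 1) / \<rho>) * (\<rho> * real n)" using \<rho> by (simp add: T_def)
    also have "\<dots> \<le> (6 * \<Lambda> * real n ^ (?d - 1) / \<rho>) * (real R - real R')"
      using \<rho> \<Lambda> by (intro mult_left_mono) auto
    finally show ?thesis using RR by (simp add: K_def field_simps)
  qed
  have nn: "0 \<le> \<alpha> j s" "0 \<le> \<beta> j s" for j s by (auto simp: \<alpha>_def \<beta>_def intro!: sum_nonneg)
  have sub: "edges (lbox x0 R) \<subseteq> edges (lbox x0 n)" using n by (intro edges_mono lbox_mono) simp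
  have s\<alpha>: "(\<Sum>s\<in>{- int R..<int R}. \<alpha> j s) \<le> T" for j
  proof -
    have "(\<Sum>s\<in>{- int R..<int R}. \<alpha> j s) \<le> (\<Sum>j\<in>UNIV. \<Sum>s\<in>{- int R..<int R}. \<alpha> j s)"
      using nn by (intro member_le_sum sum_nonneg) auto
    also have "\<dots> = (\<Sum>(x, j)\<in>edges (lbox x0 R). c x j powr p)"
      unfolding \<alpha>_def by (rule sum_edges_eq_layers[symmetric])
    also have "\<dots> \<le> (\<Sum>(x, j)\<in>edges (lbox x0 n). c x j powr p)"
      using sub by (intro sum_mono2 finite_edges) auto
    also have "\<dots> \<le> T" using cb by (simp add: conductance_bound_def T_def)
    finally show ?thesis .
  qed
  have s\<beta>: "(\<Sum>s\<in>{- int R..int R}. \<beta> j s) \<le> T" for j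
  proof -
    have "(\<Sum>s\<in>{- int R..int R}. \<beta> j s) \<le> (\<Sum>(x, j)\<in>edges (lbox x0 R). (1 / c x j) powr q)"
      unfolding \<beta>_def by (intro sum_edges_layers) auto
    also have "\<dots> \<le> (\<Sum>(x, j)\<in>edges (lbox x0 n). (1 / c x j) powr q)"
      using sub by (intro sum_mono2 finite_edges) auto
    also have "\<dots> \<le> T" using cb by (simp add: conductance_bound_def T_def)
    finally show ?thesis .
  qed
  have card: "real (card (Bad j \<inter> {- int R..<int R})) \<le> (real R - real R') / 2" for j
  proof -
    let ?I = "{- int R..<int R}"
    have "Bad j \<inter> ?I = {s \<in> ?I. K < \<alpha> j s} \<union> {s \<in> ?I. K < \<beta> j s} \<union> {s \<in> ?I. K < \<beta> j (s + 1)}"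
      by (auto simp: Bad_def)
    then have "card (Bad j \<inter> ?I) \<le> card {s \<in> ?I. K < \<alpha> j s} + card {s \<in> ?I. K < \<beta> j s} + card {s \<in> ?I. K < \<beta> j (s + 1)}"
      by (metis (no_types, lifting) add_right_mono card_Un_le order_trans)
    moreover have "real (card {s \<in> ?I. K < \<alpha> j s}) \<le> T / K"
      by (rule card_exceeding_le) (use nn s\<alpha> K0 in auto)
    moreover have "real (card {s \<in> ?I. K < \<beta> j s}) \<le> T / K"
    proof (rule card_exceeding_le)
      have "(\<Sum>s\<in>?I. \<beta> j s) \<le> (\<Sum>s\<in>{- int R..int R}. \<beta> j s)" using nn by (intro sum_mono2) auto
      then show "(\<Sum>s\<in>?I. \<beta> j s) \<le> T" using s\<beta>[of j] by (rule order_trans)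
    qed (use nn K0 in auto)
    moreover have "real (card {s \<in> ?I. K < \<beta> j (s + 1)}) \<le> T / K"
    proof (rule card_exceeding_le)
      show "(\<Sum>s\<in>?I. \<beta> j (s + 1)) \<le> T"
        by (rule order_trans[OF sum_shift_le s\<beta>]) (rule nn)
    qed (use nn K0 in auto)
    ultimately show ?thesis unfolding TK by linarith
  qed
  have "\<forall>j. \<exists>\<psi> :: int \<Rightarrow> real. (\<forall>s. 0 \<le> \<psi> s) \<and> (\<forall>s. \<psi> s \<le> 1) \<and> (\<forall>s. \<bar>s\<bar> \<le> int R' \<longrightarrow> \<psi> s = 1)
     \<and> (\<forall>s. int R \<le> \<bar>s\<bar> \<longrightarrow> \<psi> s = 0) \<and> (\<forall>s. \<bar>\<psi> (s + 1) - \<psi> s\<bar> \<le> 2 / (real R - real R'))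
     \<and> (\<forall>s\<in>Bad j. \<psi> (s + 1) = \<psi> s)"
  proof
    fix j
    obtain \<psi> :: "int \<Rightarrow> real" where
      "\<And>s. 0 \<le> \<psi> s" "\<And>s. \<psi> s \<le> 1" "\<And>s. \<bar>s\<bar> \<le> int R' \<Longrightarrow> \<psi> s = 1" "\<And>s. int R \<le> \<bar>s\<bar> \<Longrightarrow> \<psi> s = 0"
      "\<And>s. \<bar>\<psi> (s + 1) - \<psi> s\<bar> \<le> 2 / (real R - real R')" "\<And>s. s \<in> Bad j \<Longrightarrow> \<psi> (s + 1) = \<psi> s"
      using cutoff_1d[OF n(1) card[of j]] by metis
    then show "\<exists>\<psi> :: int \<Rightarrow> real. (\<forall>s. 0 \<le> \<psi> s) \<and> (\<forall>s. \<psi> s \<le> 1) \<and> (\<forall>s. \<bar>s\<bar> \<le> int R' \<longrightarrow> \<psi> s = 1)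
     \<and> (\<forall>s. int R \<le> \<bar>s\<bar> \<longrightarrow> \<psi> s = 0) \<and> (\<forall>s. \<bar>\<psi> (s + 1) - \<psi> s\<bar> \<le> 2 / (real R - real R'))
     \<and> (\<forall>s\<in>Bad j. \<psi> (s + 1) = \<psi> s)" by blast
  qed
  then obtain \<psi> :: "'d \<Rightarrow> int \<Rightarrow> real" where
    \<psi>: "\<And>j s. 0 \<le> \<psi> j s" "\<And>j s. \<psi> j s \<le> 1" "\<And>j s. \<bar>s\<bar> \<le> int R' \<Longrightarrow> \<psi> j s = 1"
      "\<And>j s. int R \<le> \<bar>s\<bar> \<Longrightarrow> \<psi> j s = 0"
      "\<And>j s. \<bar>\<psi> j (s + 1) - \<psi> j s\<bar> \<le> 2 / (real R - real R')" "\<And>j s. s \<in> Bad j \<Longrightarrow> \<psi> j (s + 1) = \<psi> j s"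
    unfolding choice_iff by blast
  define \<eta> where "\<eta> x = (\<Prod>i\<in>UNIV. \<psi> i (x $ i - x0 $ i))" for x
  note \<eta> = product_cutoff[of \<psi> \<eta> x0, OF \<psi>(1,2) \<eta>_def]
  show ?thesis
  proof
    show "0 \<le> \<eta> x" for x by (rule \<eta>)
    show "\<eta> x \<le> 1" for x by (rule \<eta>)
    show "\<eta> x = 1" if "x \<in> lbox x0 R'" for x
      using that \<psi>(3) by (simp add: \<eta>_def mem_lbox)
    show "\<eta> x = 0" if nx: "x \<notin> lbox x0 (R - 1)" for x
    proof -
      obtain i where "int (R - 1) < \<bar>x $ i - x0 $ i\<bar>" using nx by (auto simp: mem_lbox not_le)
      then have "int R \<le> \<bar>x $ i - x0 $ i\<bar>" using n by simp
      then have "\<psi> i (x $ i - x0 $ i) = 0" by (rule \<psi>(4))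
      then show ?thesis by (auto simp: \<eta>_def)
    qed
    fix w :: "int ^ 'd \<Rightarrow> real" and A B :: real
    assume w: "\<And>x. 0 \<le> w x" and AB: "0 < A" "0 < B"
    define f where "f j s = (\<Sum>x\<in>layer x0 R j s. (w x)\<^sup>2)" for j s
    define E where "E j s = (\<Sum>(x, i)\<in>edges (layer x0 R j s). c x i * (grad w x i)\<^sup>2)" for j s
    define C where "C = layer_const ?d q \<kappa> \<Lambda> / \<rho>\<^sup>2 * (A powr \<tau> * B powr (1 - \<tau>))"
    define Z where "Z j s = C * ((f j s + (real n)\<^sup>2 * E j s) / A + f j s / B)" for j s
    define f' where "f' = (\<Sum>x\<in>lbox x0 R. (w x)\<^sup>2)"
    define E' where "E' = (\<Sum>(x, j)\<in>edges (lbox x0 R). c x j * (grad w x j)\<^sup>2)"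
    have lc: "1 \<le> layer_const ?d q \<kappa> \<Lambda>" using \<Lambda> by (rule layer_const_ge_1)
    have C0: "0 \<le> C" using lc by (auto simp: C_def)
    have Z0: "0 \<le> Z j s" for j s
      unfolding Z_def f_def E_def using C0 AB c
      by (intro mult_nonneg_nonneg add_nonneg_nonneg divide_nonneg_pos) (auto intro!: sum_nonneg simp: less_imp_le)
    have lay: "(\<Sum>x\<in>layer x0 R j s. g x * (w x)\<^sup>2) \<le> Z j s"
      if "\<bar>s\<bar> \<le> int R" "\<And>x. 0 \<le> g x" "(\<Sum>x\<in>layer x0 R j s. g x powr p) \<le> K" "\<beta> j s \<le> K" for j s g
      unfolding Z_def f_def E_def C_def
      by (rule good_layer_estimate[OF d n(2,3,4) \<rho>(1,2) \<Lambda> p q \<kappa> \<tau> w c that(1) Kle that(2,3) _ AB])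
        (use that(4) in \<open>simp add: \<beta>_def\<close>)
    have layer_le: "(\<Sum>x\<in>layer x0 R j s. c x j * (w x * w (x + axis j 1) * (grad \<eta> x j)\<^sup>2))
        \<le> (2 / (\<rho> * real n))\<^sup>2 / 2 * (Z j s + Z j (s + 1))" if s: "s \<in> {- int R..<int R}" for j s
    proof (cases "s \<in> Bad j")
      case True
      have "grad \<eta> x j = 0" if "x \<in> layer x0 R j s" for x
        using \<eta>(3)[of x j] \<psi>(6)[OF True] that by (simp add: layer_def)
      then have "(\<Sum>x\<in>layer x0 R j s. c x j * (w x * w (x + axis j 1) * (grad \<eta> x j)\<^sup>2)) = 0"
        by (intro sum.neutral) auto
      then show ?thesis using Z0 by simp
    next
      case False
      then have good: "\<alpha> j s \<le> K" "\<beta> j s \<le> K" "\<beta> j (s + 1) \<le> K" by (auto simp: Bad_def not_less)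
      have "(\<Sum>x\<in>layer x0 R j s. c x j * (w x * w (x + axis j 1) * (grad \<eta> x j)\<^sup>2))
         \<le> (\<Sum>x\<in>layer x0 R j s. (2 / (\<rho> * real n))\<^sup>2 / 2 * (c x j * (w x)\<^sup>2 + c x j * (w (x + axis j 1))\<^sup>2))"
      proof (intro sum_mono)
        fix x
        have "\<bar>\<eta> (x + axis j 1) - \<eta> x\<bar> \<le> 2 / (real R - real R')"
          using \<eta>(3)[of x j] \<psi>(5) by (meson order_trans)
        also have "\<dots> \<le> 2 / (\<rho> * real n)" using \<rho> n by (intro divide_left_mono) auto
        finally have "(grad \<eta> x j)\<^sup>2 \<le> (2 / (\<rho> * real n))\<^sup>2"
          by (metis abs_ge_zero power2_abs power_mono)
        moreover have "w x * w (x + axis j 1) \<le> ((w x)\<^sup>2 + (w (x + axis j 1))\<^sup>2) / 2"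
          using sum_squares_bound[of "w x" "w (x + axis j 1)"] by simp
        ultimately have "w x * w (x + axis j 1) * (grad \<eta> x j)\<^sup>2
            \<le> ((w x)\<^sup>2 + (w (x + axis j 1))\<^sup>2) / 2 * (2 / (\<rho> * real n))\<^sup>2"
          using w by (intro mult_mono) auto
        from mult_left_mono[OF this less_imp_le[OF c[of x j]]]
        show "c x j * (w x * w (x + axis j 1) * (grad \<eta> x j)\<^sup>2)
          \<le> (2 / (\<rho> * real n))\<^sup>2 / 2 * (c x j * (w x)\<^sup>2 + c x j * (w (x + axis j 1))\<^sup>2)"
          by (simp add: algebra_simps add_divide_distrib)
      qed
      also have "\<dots> = (2 / (\<rho> * real n))\<^sup>2 / 2 * ((\<Sum>x\<in>layer x0 R j s. c x j * (w x)\<^sup>2)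
          + (\<Sum>x\<in>layer x0 R j s. c x j * (w (x + axis j 1))\<^sup>2))"
        by (simp only: sum_distrib_left[symmetric] sum.distrib)
      \<comment> \<open>The upper end points are moved to the layer \<open>s + 1\<close>, where the
        shifted weight has the same moment as the original one on the layer
        \<open>s\<close>.\<close>
      also have "(\<Sum>x\<in>layer x0 R j s. c x j * (w (x + axis j 1))\<^sup>2) = (\<Sum>x\<in>layer x0 R j (s + 1). c (x - axis j 1) j * (w x)\<^sup>2)"
        using layer_shift[OF s, where j = j and g = "\<lambda>x. c (x - axis j 1) j * (w x)\<^sup>2"] by simp
      also have "(2 / (\<rho> * real n))\<^sup>2 / 2 * ((\<Sum>x\<in>layer x0 R j s. c x j * (w x)\<^sup>2)
          + (\<Sum>x\<in>layer x0 R j (s + 1). c (x - axis j 1) j * (w x)\<^sup>2))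
        \<le> (2 / (\<rho> * real n))\<^sup>2 / 2 * (Z j s + Z j (s + 1))"
      proof (intro mult_left_mono add_mono lay)
        show "(\<Sum>x\<in>layer x0 R j s. c x j powr p) \<le> K" using good(1) by (simp add: \<alpha>_def)
        show "(\<Sum>x\<in>layer x0 R j (s + 1). c (x - axis j 1) j powr p) \<le> K"
          using layer_shift[OF s, where j = j and g = "\<lambda>x. c (x - axis j 1) j powr p"] good(1) by (simp add: \<alpha>_def)
      qed (use s good c in \<open>auto simp: less_imp_le\<close>)
      finally show ?thesis .
    qed
    have sumZ: "(\<Sum>s\<in>{- int R..int R}. Z j s) \<le> C * ((f' + (real n)\<^sup>2 * E') / A + f' / B)" for j
    proof -
      have sf: "(\<Sum>s\<in>{- int R..int R}. f j s) = f'" unfolding f_def f'_def by (rule sum_layers)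
      have sE: "(\<Sum>s\<in>{- int R..int R}. E j s) \<le> E'"
        unfolding E_def E'_def using c by (intro sum_edges_layers) (auto simp: less_imp_le)
      have "(\<Sum>s\<in>{- int R..int R}. Z j s)
          = C * (((\<Sum>s\<in>{- int R..int R}. f j s) + (real n)\<^sup>2 * (\<Sum>s\<in>{- int R..int R}. E j s)) / A
            + (\<Sum>s\<in>{- int R..int R}. f j s) / B)"
        unfolding Z_def by (simp only: sum_distrib_left[symmetric] sum.distrib sum_divide_distrib[symmetric])
      also have "\<dots> \<le> C * ((f' + (real n)\<^sup>2 * E') / A + f' / B)"
        unfolding sf using sE C0 AB by (intro mult_left_mono add_mono divide_right_mono order_refl) auto
      finally show ?thesis .
    qed
    have "cutoff_term c (lbox x0 R) \<eta> w
       \<le> (\<Sum>j\<in>(UNIV::'d set). \<Sum>s\<in>{- int R..<int R}. (2 / (\<rho> * real n))\<^sup>2 / 2 * (Z j s + Z j (s + 1)))"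
      unfolding sum_edges_eq_layers by (intro sum_mono layer_le)
    also have "\<dots> \<le> (\<Sum>j\<in>(UNIV::'d set). (2 / (\<rho> * real n))\<^sup>2 / 2 * (2 * (C * ((f' + (real n)\<^sup>2 * E') / A + f' / B))))"
    proof (intro sum_mono)
      fix j :: 'd
      have "(\<Sum>s\<in>{- int R..<int R}. Z j s) \<le> (\<Sum>s\<in>{- int R..int R}. Z j s)"
        using Z0 by (intro sum_mono2) auto
      moreover have "(\<Sum>s\<in>{- int R..<int R}. Z j (s + 1)) \<le> (\<Sum>s\<in>{- int R..int R}. Z j s)"
        using Z0 by (intro sum_shift_le)
      ultimately have "(\<Sum>s\<in>{- int R..<int R}. Z j s + Z j (s + 1)) \<le> 2 * (C * ((f' + (real n)\<^sup>2 * E') / A + f' / B))"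
        using sumZ[of j] by (simp add: sum.distrib)
      then show "(\<Sum>s\<in>{- int R..<int R}. (2 / (\<rho> * real n))\<^sup>2 / 2 * (Z j s + Z j (s + 1)))
          \<le> (2 / (\<rho> * real n))\<^sup>2 / 2 * (2 * (C * ((f' + (real n)\<^sup>2 * E') / A + f' / B)))"
        unfolding sum_distrib_left[symmetric] by (intro mult_left_mono) auto
    qed
    also have "\<dots> = 4 * real ?d * layer_const ?d q \<kappa> \<Lambda> / \<rho> ^ 4 / (real n)\<^sup>2 * (A powr \<tau> * B powr (1 - \<tau>))
        * ((f' + (real n)\<^sup>2 * E') / A + f' / B)"
    proof -
      have alg: "D * (((2 / (\<rho> * m))\<^sup>2 / 2) * (2 * ((k / \<rho>\<^sup>2 * P) * Q))) = 4 * D * k / \<rho> ^ 4 / m\<^sup>2 * P * Q" for D k P Q m :: real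
        by (simp add: power_divide power_mult_distrib power4_eq_xxxx power2_eq_square mult_ac)
      show ?thesis unfolding C_def by (simp only: sum_constant alg)
    qed
    finally show "cutoff_term c (lbox x0 R) \<eta> w
      \<le> 4 * real CARD('d) * layer_const CARD('d) q \<kappa> \<Lambda> / \<rho> ^ 4 / (real n)\<^sup>2 * (A powr \<tau> * B powr (1 - \<tau>))
        * (((\<Sum>x\<in>lbox x0 R. (w x)\<^sup>2)
            + (real n)\<^sup>2 * (\<Sum>(x, j)\<in>edges (lbox x0 R). c x j * (grad w x j)\<^sup>2)) / A
          + (\<Sum>x\<in>lbox x0 R. (w x)\<^sup>2) / B)"
      by (simp add: f'_def E'_def)
  qed
qed

section \<open>De Giorgi iteration\<close>

definition grad_energy :: "(int ^ 'd \<Rightarrow> 'd::finite \<Rightarrow> real) \<Rightarrow> (int ^ 'd) set \<Rightarrow> (int ^ 'd \<Rightarrow> real) \<Rightarrow> real"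
  where "grad_energy c S v = (\<Sum>(x, j)\<in>edges S. c x j * (grad v x j)\<^sup>2)"

text \<open>The square of the parabolic energy norm, scaled such that, for conductances of order 1,
  a function of size 1 that varies on the length \<open>n\<close> has \<open>F\<close> of order 1
  over a time \<open>n^2\<close>.\<close>

definition energy_bound :: "(int ^ 'd \<Rightarrow> 'd::finite \<Rightarrow> real) \<Rightarrow> int ^ 'd \<Rightarrow> nat \<Rightarrow> nat \<Rightarrow> real \<Rightarrow> real
    \<Rightarrow> (real \<Rightarrow> int ^ 'd \<Rightarrow> real) \<Rightarrow> real \<Rightarrow> bool"
  where "energy_bound c x0 n R a b v F \<longleftrightarrow>
    (\<forall>t\<in>{a..b}. (\<Sum>x\<in>lbox x0 R. (v t x)\<^sup>2) \<le> F * real n ^ CARD('d)) \<and>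
    integral {a..b} (\<lambda>s. grad_energy c (lbox x0 R) (v s)) \<le> F * real n ^ CARD('d)"

lemma grad_energy_nonneg: "(\<And>x j. 0 < c x j) \<Longrightarrow> 0 \<le> grad_energy c S v"
  unfolding grad_energy_def by (auto intro!: sum_nonneg simp: less_imp_le)

lemma continuous_on_grad_energy:
  assumes "\<And>x. x \<in> S \<Longrightarrow> continuous_on I (\<lambda>s. v s x)"
  shows "continuous_on I (\<lambda>s. grad_energy c S (v s))"
  unfolding grad_energy_def split_def
  by (intro continuous_intros assms) (auto simp: edges_def)

lemma integral_subinterval_le:
  fixes g :: "real \<Rightarrow> real"
  assumes "continuous_on {a..b} g" "\<And>s. s \<in> {a..b} \<Longrightarrow> 0 \<le> g s" "a \<le> a'" "b' \<le> b"
  shows "integral {a'..b'} g \<le> integral {a..b} g"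
proof (rule integral_subset_le)
  show "{a'..b'} \<subseteq> {a..b}" using assms by auto
  then show "g integrable_on {a'..b'}"
    using assms by (intro integrable_continuous_real) (auto intro: continuous_on_subset)
  show "g integrable_on {a..b}" using assms by (intro integrable_continuous_real)
qed (use assms in auto)

lemma integral_mono_continuous:
  fixes f g :: "real \<Rightarrow> real"
  assumes "continuous_on {a..b} f" "continuous_on {a..b} g" "\<And>s. s \<in> {a..b} \<Longrightarrow> f s \<le> g s"
  shows "integral {a..b} f \<le> integral {a..b} g"
  using assms by (intro integral_le integrable_continuous_real) auto

text \<open>
  The weight \<open>s - a\<close> replaces a cutoff in time: it vanishes initially and is at least \<open>a' - a\<close> on \<open>{a'..b}\<close>.
\<close>

lemma energy_step_aux:
  fixes x0 :: "int ^ 'd::finite" and c :: "int ^ 'd \<Rightarrow> 'd \<Rightarrow> real" and k :: real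
  assumes sol: "heat_sol c x0 n a0 b u" and R: "1 \<le> R" "R \<le> n" "R' \<le> R" and t: "a0 \<le> a" "a < a'" "a' \<le> b"
    and c: "\<And>x j. 0 < c x j"
    and \<eta>: "\<And>x. 0 \<le> \<eta> x" "\<And>x. \<eta> x \<le> 1" "\<And>x. x \<in> lbox x0 R' \<Longrightarrow> \<eta> x = 1"
      "\<And>x. x \<notin> lbox x0 (R - 1) \<Longrightarrow> \<eta> x = 0"
  defines "w \<equiv> \<lambda>s x. max 0 (u s x - k)"
  assumes G: "continuous_on {a..b} G" "\<And>s. s \<in> {a..b} \<Longrightarrow>
      cutoff_term c (lbox x0 R) \<eta> (w s) \<le> G s"
    and J: "integral {a..b} (\<lambda>s. (\<Sum>x\<in>lbox x0 R. (w s x)\<^sup>2) + 2 * (b - a) * G s) \<le> J"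
      "J \<le> F * (a' - a) * real n ^ CARD('d)"
  shows "energy_bound c x0 n R' a' b w F"
proof -
  let ?B = "lbox x0 R"
  define N2 where "N2 s = (\<Sum>x\<in>?B. (w s x)\<^sup>2)" for s
  define \<phi> where "\<phi> s = (\<Sum>x\<in>?B. (\<eta> x)\<^sup>2 * (w s x)\<^sup>2)" for s
  define E where "E s = grad_energy c ?B (\<lambda>x. \<eta> x * w s x)" for s
  define D where "D s = cutoff_term c ?B \<eta> (w s)" for s
  have w0: "0 \<le> w s x" for s x by (simp add: w_def)
  have cont: "continuous_on {a..b} (\<lambda>s. w s x)" if "x \<in> ?B" for x
    unfolding w_def using that lbox_mono[OF R(2), of x0] t
    by (intro continuous_intros heat_sol_continuous[OF sol]) auto
  have cN: "continuous_on {a..b} N2" unfolding N2_def by (intro continuous_intros cont)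
  have c\<phi>: "continuous_on {a..b} \<phi>" unfolding \<phi>_def by (intro continuous_intros cont)
  have cE: "continuous_on {a..b} E" unfolding E_def by (intro continuous_on_grad_energy continuous_intros cont)
  have cD: "continuous_on {a..b} D" unfolding D_def split_def by (intro continuous_intros cont) (auto simp: edges_def)
  have E0: "0 \<le> E s" for s unfolding E_def by (rule grad_energy_nonneg[OF c])
  have N0: "0 \<le> N2 s" for s unfolding N2_def by (intro sum_nonneg) auto
  have D0: "0 \<le> D s" for s unfolding D_def using c w0 by (auto intro!: sum_nonneg mult_nonneg_nonneg simp: less_imp_le)
  have G0: "0 \<le> G s" if "s \<in> {a..b}" for s using D0[of s] G(2)[OF that] by (simp add: D_def)
  have \<phi>N: "\<phi> s \<le> N2 s" for s unfolding \<phi>_def N2_def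
  proof (intro sum_mono mult_left_le_one_le)
    show "(\<eta> x)\<^sup>2 \<le> 1" for x using \<eta>(1,2)[of x] by (simp add: power_le_one)
  qed auto
  define g where "g s = N2 s + 2 * (b - a) * G s" for s
  have cg: "continuous_on {a..b} g" unfolding g_def by (intro continuous_intros cN G(1))
  have g0: "0 \<le> g s" if "s \<in> {a..b}" for s
    unfolding g_def using N0[of s] G0[OF that] t by simp
  have J1: "integral {a..b} g \<le> J" using J(1) unfolding g_def[abs_def] N2_def .
  have cac: "(s - a) * \<phi> s \<le> integral {a..s} (\<lambda>r. \<phi> r - 2 * (r - a) * E r + 2 * (r - a) * D r)"
    if "s \<in> {a..b}" for s
  proof -
    have sol': "heat_sol c x0 n a b u"
      unfolding heat_sol_def using heat_sol_continuous[OF sol, of _ a b] heat_sol_derivative[OF sol, of _ a b] t by auto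
    show ?thesis
      using caccioppoli[OF sol' R(1,2) _ _ c \<eta>(4), where k = k and t = s] that
      by (simp add: \<phi>_def E_def D_def w_def grad_energy_def)
  qed
  have dle: "\<phi> r - 2 * (r - a) * E r + 2 * (r - a) * D r \<le> g r - 2 * (r - a) * E r" if "r \<in> {a..b}" for r
  proof -
    have "2 * (r - a) * D r \<le> 2 * (b - a) * G r"
      using that D0 G(2)[OF that] by (intro mult_mono) (auto simp: D_def)
    then show ?thesis using \<phi>N[of r] unfolding g_def by linarith
  qed
  have 1: "(s - a) * \<phi> s \<le> J" if s: "s \<in> {a..b}" for s
  proof -
    have sub: "{a..s} \<subseteq> {a..b}" using s by auto
    have "(s - a) * \<phi> s \<le> integral {a..s} (\<lambda>r. \<phi> r - 2 * (r - a) * E r + 2 * (r - a) * D r)"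
      by (rule cac[OF s])
    also have "\<dots> \<le> integral {a..s} g"
    proof (rule integral_mono_continuous)
      show "\<phi> r - 2 * (r - a) * E r + 2 * (r - a) * D r \<le> g r" if "r \<in> {a..s}" for r
      proof -
        have "0 \<le> 2 * (r - a) * E r" using that E0[of r] by simp
        moreover have "r \<in> {a..b}" using that s by auto
        ultimately show ?thesis using dle[of r] by linarith
      qed
    qed (intro continuous_intros continuous_on_subset[OF c\<phi> sub] continuous_on_subset[OF cE sub]
        continuous_on_subset[OF cD sub] continuous_on_subset[OF cg sub])+
    also have "\<dots> \<le> integral {a..b} g"
      using s by (intro integral_subinterval_le cg g0) auto
    finally show ?thesis using J1 by simp
  qed
  \<comment> \<open>At the final time the left-hand side of the Caccioppoli inequality is bounded
    below by 0, which leaves the weighted energy to be moved across.\<close>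
  have 2: "integral {a..b} (\<lambda>r. 2 * (r - a) * E r) \<le> J"
  proof -
    have "0 \<le> (b - a) * \<phi> b" using t by (auto simp: \<phi>_def intro!: sum_nonneg mult_nonneg_nonneg)
    also have "\<dots> \<le> integral {a..b} (\<lambda>r. \<phi> r - 2 * (r - a) * E r + 2 * (r - a) * D r)"
      using t by (intro cac) auto
    also have "\<dots> \<le> integral {a..b} (\<lambda>r. g r - 2 * (r - a) * E r)"
      by (intro integral_mono_continuous dle continuous_intros cE c\<phi> cD cg)
    also have "\<dots> = integral {a..b} g - integral {a..b} (\<lambda>r. 2 * (r - a) * E r)"
      by (intro integral_diff integrable_continuous_real continuous_intros cE cg)
    finally show ?thesis using J1 by simp
  qed
  have subB: "lbox x0 R' \<subseteq> ?B" using R by (intro lbox_mono)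
  show ?thesis
    unfolding energy_bound_def
  proof (intro conjI ballI)
    fix s assume s: "s \<in> {a'..b}"
    have "(\<Sum>x\<in>lbox x0 R'. (w s x)\<^sup>2) = (\<Sum>x\<in>lbox x0 R'. (\<eta> x)\<^sup>2 * (w s x)\<^sup>2)"
      by (intro sum.cong) (auto simp: \<eta>(3))
    also have "\<dots> \<le> \<phi> s" unfolding \<phi>_def using subB by (intro sum_mono2) auto
    finally have le: "(\<Sum>x\<in>lbox x0 R'. (w s x)\<^sup>2) \<le> \<phi> s" .
    have "(a' - a) * (\<Sum>x\<in>lbox x0 R'. (w s x)\<^sup>2) \<le> (s - a) * \<phi> s"
      using le s t by (intro mult_mono) (auto intro!: sum_nonneg)
    also have "\<dots> \<le> J" using s t by (intro 1) auto
    finally have "(a' - a) * (\<Sum>x\<in>lbox x0 R'. (w s x)\<^sup>2) \<le> (a' - a) * (F * real n ^ CARD('d))"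
      using J(2) by (simp add: mult_ac)
    then show "(\<Sum>x\<in>lbox x0 R'. (w s x)\<^sup>2) \<le> F * real n ^ CARD('d)" using t by simp
  next
    have Ele: "grad_energy c (lbox x0 R') (w s) \<le> E s" for s
    proof -
      have "grad_energy c (lbox x0 R') (w s) = grad_energy c (lbox x0 R') (\<lambda>x. \<eta> x * w s x)"
        unfolding grad_energy_def by (intro sum.cong refl) (auto simp: edges_def \<eta>(3))
      also have "\<dots> \<le> E s"
        unfolding E_def grad_energy_def using edges_mono[OF subB] c
        by (intro sum_mono2 finite_edges) (auto simp: less_imp_le)
      finally show ?thesis .
    qed
    have cw: "continuous_on {a'..b} (\<lambda>s. grad_energy c (lbox x0 R') (w s))"
      using subB t by (intro continuous_on_grad_energy continuous_on_subset[OF cont]) auto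
    have sub: "{a'..b} \<subseteq> {a..b}" using t by auto
    have "2 * (a' - a) * integral {a'..b} (\<lambda>s. grad_energy c (lbox x0 R') (w s))
        = integral {a'..b} (\<lambda>s. 2 * (a' - a) * grad_energy c (lbox x0 R') (w s))" by simp
    also have "\<dots> \<le> integral {a'..b} (\<lambda>r. 2 * (r - a) * E r)"
    proof (rule integral_mono_continuous)
      show "2 * (a' - a) * grad_energy c (lbox x0 R') (w s) \<le> 2 * (s - a) * E s" if "s \<in> {a'..b}" for s
        using that t Ele[of s] grad_energy_nonneg[OF c] by (intro mult_mono) auto
    qed (intro continuous_intros cw continuous_on_subset[OF cE sub])+
    also have "\<dots> \<le> integral {a..b} (\<lambda>r. 2 * (r - a) * E r)"
      using t E0 by (intro integral_subinterval_le continuous_intros cE) auto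
    also have "\<dots> \<le> J" by (rule 2)
    also have "J \<le> (a' - a) * (F * real n ^ CARD('d))" using J(2) by (simp add: mult_ac)
    finally have *: "(a' - a) * (2 * integral {a'..b} (\<lambda>s. grad_energy c (lbox x0 R') (w s)))
        \<le> (a' - a) * (F * real n ^ CARD('d))" by (simp only: mult.assoc mult.left_commute[of 2 "a' - a"])
    then have "2 * integral {a'..b} (\<lambda>s. grad_energy c (lbox x0 R') (w s)) \<le> F * real n ^ CARD('d)"
      using t by simp
    moreover have "0 \<le> integral {a'..b} (\<lambda>s. grad_energy c (lbox x0 R') (w s))"
      by (intro integral_nonneg integrable_continuous_real cw grad_energy_nonneg c)
    ultimately show "integral {a'..b} (\<lambda>s. grad_energy c (lbox x0 R') (w s)) \<le> F * real n ^ CARD('d)" by linarith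
  qed
qed

text \<open>Young's inequality in the cutoff estimate is normalised at \<open>A\<close> and
  \<open>B\<close>, bounds for the time integrals known in advance. Each of the three integrals that
  occur is then at most 1 relative to its bound, whence \<open>24 = 4 * 2 * 3\<close>. The fifth
  power of \<open>\<rho>\<close> consists of the fourth power from the cutoff and the bound
  \<open>\<rho> * n^2\<close> from below for the gap in time.\<close>

lemma energy_step:
  fixes x0 :: "int ^ 'd::finite" and c :: "int ^ 'd \<Rightarrow> 'd \<Rightarrow> real" and k :: real
  assumes cb: "conductance_bound c x0 n p q \<Lambda>"
    and d: "2 \<le> CARD('d)" and n: "R' < R" "R \<le> n" "n \<le> 8 * R" "1 \<le> n"
    and \<rho>: "0 < \<rho>" "\<rho> \<le> 1" "\<rho> * real n \<le> real R - real R'" and \<Lambda>: "1 \<le> \<Lambda>"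
    and p: "1 < p" and q: "1 < q"
    and \<kappa>: "1 < \<kappa>" "\<kappa> * (real CARD('d) - 3 + (real CARD('d) - 1) / q) \<le> real CARD('d) - 1"
    and \<tau>: "\<tau> = \<kappa> / (p * (\<kappa> - 1))" "\<tau> < 1"
    and sol: "heat_sol c x0 n a0 b u" and t: "a0 \<le> a" "a' \<le> b" "\<rho> * (real n)\<^sup>2 \<le> a' - a" "b - a \<le> (real n)\<^sup>2"
  defines "w \<equiv> \<lambda>s x. max 0 (u s x - k)"
  assumes F: "energy_bound c x0 n R a b w F" "0 < F"
    and Y: "integral {a..b} (\<lambda>s. \<Sum>x\<in>lbox x0 R. (w s x)\<^sup>2) \<le> Y * real n ^ (CARD('d) + 2)" "0 < Y"
  shows "energy_bound c x0 n R' a' b w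
    (24 * real CARD('d) * layer_const CARD('d) q \<kappa> \<Lambda> / \<rho> ^ 5 * (F powr \<tau> * Y powr (1 - \<tau>) + Y))"
proof -
  let ?B = "lbox x0 R" and ?d = "CARD('d)"
  define lc where "lc = layer_const ?d q \<kappa> \<Lambda>"
  have lc: "1 \<le> lc" unfolding lc_def by (rule layer_const_ge_1[OF \<Lambda>])
  have c: "0 < c x j" for x j using cb by (simp add: conductance_bound_def)
  obtain \<eta> where \<eta>: "\<And>x. 0 \<le> \<eta> x" "\<And>x. \<eta> x \<le> 1" "\<And>x. x \<in> lbox x0 R' \<Longrightarrow> \<eta> x = 1"
    "\<And>x. x \<notin> lbox x0 (R - 1) \<Longrightarrow> \<eta> x = 0"
    and \<eta>D: "\<And>w A B. \<lbrakk>\<And>x. 0 \<le> w x; 0 < A; 0 < B\<rbrakk> \<Longrightarrow>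
      cutoff_term c ?B \<eta> w
      \<le> 4 * real ?d * lc / \<rho> ^ 4 / (real n)\<^sup>2 * (A powr \<tau> * B powr (1 - \<tau>))
        * (((\<Sum>x\<in>?B. (w x)\<^sup>2) + (real n)\<^sup>2 * grad_energy c ?B w) / A + (\<Sum>x\<in>?B. (w x)\<^sup>2) / B)"
    unfolding grad_energy_def lc_def
    by (rule exists_good_cutoff[OF cb d n \<rho> \<Lambda> p q \<kappa> \<tau>]) blast
  have n0: "0 < real n" using n by simp
  have \<tau>0: "0 < \<tau>" using p \<kappa> by (simp add: \<tau>)
  define A where "A = F * real n ^ (?d + 2)"
  define B where "B = Y * real n ^ (?d + 2)"
  have AB: "0 < A" "0 < B" using F(2) Y(2) n0 by (simp_all add: A_def B_def)
  define C where "C = 4 * real ?d * lc / \<rho> ^ 4 / (real n)\<^sup>2 * (A powr \<tau> * B powr (1 - \<tau>))"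
  have C0: "0 \<le> C" using lc \<rho> by (simp add: C_def)
  define N2 where "N2 s = (\<Sum>x\<in>?B. (w s x)\<^sup>2)" for s
  define E where "E s = grad_energy c ?B (w s)" for s
  define G where "G s = C * ((N2 s + (real n)\<^sup>2 * E s) / A + N2 s / B)" for s
  have tt: "a < a'"
  proof -
    have "0 < \<rho> * (real n)\<^sup>2" using \<rho> n0 by simp
    then show ?thesis using t by linarith
  qed
  have cont: "continuous_on {a..b} (\<lambda>s. w s x)" if "x \<in> ?B" for x
    unfolding w_def using that lbox_mono[OF n(2), of x0] t
    by (intro continuous_intros heat_sol_continuous[OF sol]) auto
  have cN: "continuous_on {a..b} N2" unfolding N2_def by (intro continuous_intros cont)
  have cE: "continuous_on {a..b} E" unfolding E_def by (intro continuous_on_grad_energy cont)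
  have cG: "continuous_on {a..b} G" unfolding G_def using AB by (intro continuous_intros cN cE) auto
  have intN: "integral {a..b} N2 \<le> A" "integral {a..b} N2 \<le> B"
  proof -
    show "integral {a..b} N2 \<le> B" using Y(1) unfolding N2_def[abs_def] B_def .
    have "integral {a..b} N2 \<le> integral {a..b} (\<lambda>s. F * real n ^ ?d)"
      using F(1) by (intro integral_mono_continuous cN continuous_intros) (simp add: energy_bound_def N2_def)
    also have "\<dots> = (b - a) * (F * real n ^ ?d)" using tt t by simp
    also have "\<dots> \<le> (real n)\<^sup>2 * (F * real n ^ ?d)" using t F(2) by (intro mult_right_mono) auto
    finally show "integral {a..b} N2 \<le> A" by (simp add: A_def power_add power2_eq_square mult_ac)
  qed
  have intE: "(real n)\<^sup>2 * integral {a..b} E \<le> A"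
    using F(1) n0 by (simp add: energy_bound_def E_def[abs_def] A_def power_add power2_eq_square mult_ac)
  have intG: "integral {a..b} (\<lambda>s. N2 s + 2 * (b - a) * G s) \<le> B + 2 * (real n)\<^sup>2 * (C * 3)"
  proof -
    have iN: "(N2 has_integral integral {a..b} N2) {a..b}" and iE: "(E has_integral integral {a..b} E) {a..b}"
      using cN cE by (auto intro: integrable_integral integrable_continuous_real)
    have "((\<lambda>s. N2 s + 2 * (b - a) * G s) has_integral (integral {a..b} N2 + 2 * (b - a) *
        (C * ((integral {a..b} N2 + (real n)\<^sup>2 * integral {a..b} E) / A + integral {a..b} N2 / B)))) {a..b}"
      unfolding G_def by (intro has_integral_add has_integral_mult_right has_integral_divide iN iE)
    then have "integral {a..b} (\<lambda>s. N2 s + 2 * (b - a) * G s) = integral {a..b} N2 + 2 * (b - a) *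
        (C * ((integral {a..b} N2 + (real n)\<^sup>2 * integral {a..b} E) / A + integral {a..b} N2 / B))"
      by (rule integral_unique)
    also have "\<dots> \<le> B + 2 * (real n)\<^sup>2 * (C * 3)"
    proof (intro add_mono intN(2) mult_mono mult_left_mono)
      have "(integral {a..b} N2 + (real n)\<^sup>2 * integral {a..b} E) / A \<le> 2"
        using intN(1) intE AB by (simp add: field_simps)
      moreover have "integral {a..b} N2 / B \<le> 1" using intN(2) AB by simp
      ultimately show "(integral {a..b} N2 + (real n)\<^sup>2 * integral {a..b} E) / A + integral {a..b} N2 / B \<le> 3"
        by linarith
      have "0 \<le> integral {a..b} N2" "0 \<le> integral {a..b} E"
      proof -
        have "0 \<le> N2 s" "0 \<le> E s" for s
          by (auto simp: N2_def E_def intro!: sum_nonneg grad_energy_nonneg c)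
        then show "0 \<le> integral {a..b} N2" "0 \<le> integral {a..b} E"
          by (auto intro!: integral_nonneg integrable_continuous_real cN cE)
      qed
      then show *: "0 \<le> (integral {a..b} N2 + (real n)\<^sup>2 * integral {a..b} E) / A + integral {a..b} N2 / B"
        using AB by simp
      show "0 \<le> C * ((integral {a..b} N2 + (real n)\<^sup>2 * integral {a..b} E) / A + integral {a..b} N2 / B)"
        using * C0 by (intro mult_nonneg_nonneg)
    qed (use C0 t tt in auto)
    finally show ?thesis .
  qed
  show ?thesis
    unfolding w_def
  proof (rule energy_step_aux[where \<eta> = \<eta> and G = G, OF sol _ n(2) _ t(1) tt t(2) c \<eta>])
    show "(\<Sum>(x, j)\<in>edges (lbox x0 R). c x j * (max 0 (u s x - k) * max 0 (u s (x + axis j 1) - k) * (grad \<eta> x j)\<^sup>2)) \<le> G s"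
      if "s \<in> {a..b}" for s
      using \<eta>D[of "w s", OF _ AB] by (simp add: w_def G_def N2_def E_def C_def)
    show "integral {a..b} (\<lambda>s. (\<Sum>x\<in>lbox x0 R. (max 0 (u s x - k))\<^sup>2) + 2 * (b - a) * G s) \<le> B + 2 * (real n)\<^sup>2 * (C * 3)"
      using intG by (simp add: N2_def w_def)
    have ABp: "A powr \<tau> * B powr (1 - \<tau>) = F powr \<tau> * Y powr (1 - \<tau>) * real n ^ (?d + 2)"
    proof -
      have "A powr \<tau> * B powr (1 - \<tau>) = F powr \<tau> * Y powr (1 - \<tau>) * ((real n ^ (?d + 2)) powr \<tau> * (real n ^ (?d + 2)) powr (1 - \<tau>))"
        unfolding A_def B_def by (simp only: powr_mult mult_ac)
      then show ?thesis using n0 by (simp add: powr_add[symmetric])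
    qed
    define D where "D = 24 * real ?d * lc"
    have D1: "1 \<le> D" using d lc mult_mono[of 1 "real ?d" 1 lc] by (simp add: D_def)
    have \<rho>5: "\<rho> ^ 5 = \<rho> * \<rho> ^ 4" by (simp add: eval_nat_numeral)
    have "B + 2 * (real n)\<^sup>2 * (C * 3) = (Y + D / \<rho> ^ 4 * (F powr \<tau> * Y powr (1 - \<tau>))) * real n ^ (?d + 2)"
    proof -
      have alg: "Y * N + 2 * m\<^sup>2 * (4 * k * l / r / m\<^sup>2 * (P * N) * 3) = (Y + 24 * k * l / r * P) * N"
        if "m \<noteq> 0" for N m k l r P :: real using that by (simp add: algebra_simps)
      show ?thesis unfolding C_def ABp D_def unfolding B_def by (rule alg) (use n0 in simp)
    qed
    also have "\<dots> \<le> (D / \<rho> ^ 4 * Y + D / \<rho> ^ 4 * (F powr \<tau> * Y powr (1 - \<tau>))) * real n ^ (?d + 2)"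
    proof (intro mult_right_mono add_right_mono)
      have "\<rho> ^ 4 \<le> D" using \<rho> D1 power_le_one[of \<rho> 4] by linarith
      then have "1 \<le> D / \<rho> ^ 4" using \<rho> by simp
      from mult_right_mono[OF this less_imp_le[OF Y(2)]]
      show "Y \<le> D / \<rho> ^ 4 * Y" by simp
    qed auto
    also have "\<dots> = D / \<rho> ^ 5 * (F powr \<tau> * Y powr (1 - \<tau>) + Y) * (\<rho> * (real n)\<^sup>2) * real n ^ ?d"
      using \<rho> unfolding \<rho>5 by (simp add: field_simps power_add power2_eq_square)
    also have "\<dots> \<le> D / \<rho> ^ 5 * (F powr \<tau> * Y powr (1 - \<tau>) + Y) * (a' - a) * real n ^ ?d"
      using t D1 \<rho> Y by (intro mult_right_mono mult_left_mono) auto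
    finally show "B + 2 * (real n)\<^sup>2 * (C * 3) \<le> 24 * real ?d * layer_const ?d q \<kappa> \<Lambda> / \<rho> ^ 5 *
        (F powr \<tau> * Y powr (1 - \<tau>) + Y) * (a' - a) * real n ^ ?d"
      by (simp add: D_def lc_def)
  qed (use n cG in auto)
qed

lemma energy_bound_mono:
  assumes "energy_bound c x0 n R a b v F" "F \<le> F'"
  shows "energy_bound c x0 n R a b v F'"
proof -
  have "F * real n ^ CARD('a) \<le> F' * real n ^ CARD('a)" using assms by (intro mult_right_mono) auto
  then show ?thesis using assms(1) unfolding energy_bound_def by (meson order_trans)
qed

text \<open>Raising the level lowers the truncation pointwise and contracts its differences.\<close>

lemma energy_bound_truncate:
  fixes x0 :: "int ^ 'd::finite" and u :: "real \<Rightarrow> int ^ 'd \<Rightarrow> real"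
  assumes "energy_bound c x0 n R a b (\<lambda>s x. max 0 (u s x - k)) F" "k \<le> k'" "\<And>x j. 0 < c x j"
    and cont: "\<And>x. x \<in> lbox x0 R \<Longrightarrow> continuous_on {a..b} (\<lambda>s. u s x)"
  shows "energy_bound c x0 n R a b (\<lambda>s x. max 0 (u s x - k')) F"
proof -
  have le: "max 0 (y - k') \<le> max 0 (y - k)" for y using assms(2) by auto
  have sq: "(max 0 (y - k'))\<^sup>2 \<le> (max 0 (y - k))\<^sup>2" for y using le by (intro power_mono) auto
  have dsq: "(max 0 (y - k') - max 0 (z - k'))\<^sup>2 \<le> (max 0 (y - k) - max 0 (z - k))\<^sup>2" for y z
    by (rule abs_le_square_iff[THEN iffD1]) (use assms(2) in \<open>auto simp: max_def\<close>)
  have 1: "(\<Sum>x\<in>lbox x0 R. (max 0 (u t x - k'))\<^sup>2) \<le> (\<Sum>x\<in>lbox x0 R. (max 0 (u t x - k))\<^sup>2)" for t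
    by (intro sum_mono sq)
  have 2: "integral {a..b} (\<lambda>s. grad_energy c (lbox x0 R) (\<lambda>x. max 0 (u s x - k')))
      \<le> integral {a..b} (\<lambda>s. grad_energy c (lbox x0 R) (\<lambda>x. max 0 (u s x - k)))"
  proof (intro integral_mono_continuous continuous_on_grad_energy continuous_intros cont)
    show "grad_energy c (lbox x0 R) (\<lambda>x. max 0 (u s x - k')) \<le> grad_energy c (lbox x0 R) (\<lambda>x. max 0 (u s x - k))" for s
      unfolding grad_energy_def split_def by (intro sum_mono mult_left_mono dsq less_imp_le[OF assms(3)])
  qed
  show ?thesis
    using assms(1) 1 2 unfolding energy_bound_def by (meson order_trans)
qed

text \<open>The analogue of \<open>layer_const\<close> for a whole box, where
  \<open>\<Lambda> * 4 ^ d\<close> bounds the averaged moment of the inverse weights.\<close>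

definition gain_const :: "nat \<Rightarrow> real \<Rightarrow> real \<Rightarrow> real \<Rightarrow> real"
  where "gain_const d q \<sigma> \<Lambda> = 4 ^ d * (2 + 36 * real d * (1 + \<sigma> * (1 - 1 / q))\<^sup>2 * (\<Lambda> * 4 ^ d))"

lemma gain_const_ge_1: "1 \<le> \<Lambda> \<Longrightarrow> 1 \<le> gain_const d q \<sigma> \<Lambda>"
proof -
  assume "1 \<le> \<Lambda>"
  then have "1 \<le> 2 + 36 * real d * (1 + \<sigma> * (1 - 1 / q))\<^sup>2 * (\<Lambda> * 4 ^ d)" by (simp add: add_increasing2)
  moreover have "(1 :: real) \<le> 4 ^ d" by simp
  ultimately show ?thesis unfolding gain_const_def using mult_mono[of 1 "4 ^ d :: real" 1] by force
qed

text \<open>Where the higher truncation \<open>w\<close> is positive, the lower one \<open>v\<close>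
  exceeds the gap \<open>g\<close>, so that \<open>w^2\<close> is at most \<open>v^2\<close> times
  \<open>(v / g) powr (2 * (1 - 1 / \<sigma>))\<close>. This higher power of \<open>v\<close> splits
  by Hoelder's inequality into a Sobolev factor, which is integrated in time, and a power of the L^2
  norm, which is bounded uniformly in time. The outcome is superlinear in \<open>F\<close>.\<close>

lemma level_gain:
  fixes x0 :: "int ^ 'd::finite" and c :: "int ^ 'd \<Rightarrow> 'd \<Rightarrow> real" and k g :: real
  assumes cb: "conductance_bound c x0 n p q \<Lambda>"
    and n: "R \<le> n" "n \<le> 8 * R" "1 \<le> n" and \<Lambda>: "1 \<le> \<Lambda>" and q: "1 < q"
    and \<sigma>: "1 < \<sigma>" "\<sigma> * (real CARD('d) - 2 + real CARD('d) / q) \<le> real CARD('d)"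
    and sol: "heat_sol c x0 n a0 b u" and t: "a0 \<le> a" "a \<le> b" "b - a \<le> (real n)\<^sup>2"
    and F: "energy_bound c x0 n R a b (\<lambda>s x. max 0 (u s x - k)) F" "0 < F" and g: "0 < g"
  shows "integral {a..b} (\<lambda>s. \<Sum>x\<in>lbox x0 R. (max 0 (u s x - (k + g)))\<^sup>2)
    \<le> (gain_const CARD('d) q \<sigma> \<Lambda> * g powr (- 2 * (1 - 1 / \<sigma>)) * F powr (2 - 1 / \<sigma>)) * real n ^ (CARD('d) + 2)"
proof -
  let ?B = "lbox x0 R" and ?d = "CARD('d)"
  define v where "v s x = max 0 (u s x - k)" for s x
  define w where "w s x = max 0 (u s x - (k + g))" for s x
  define \<beta> where "\<beta> = 1 - 1 / \<sigma>"
  define C0 where "C0 = 4 * real ?d * (1 + \<sigma> * (1 - 1 / q))\<^sup>2"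
  define H where "H = \<Lambda> * 4 ^ ?d"
  define V where "V = real (card ?B)"
  define W where "W = (\<Sum>(x, j)\<in>edges ?B. (1 / c x j) powr q)"
  define N2 where "N2 s = (\<Sum>x\<in>?B. (v s x)\<^sup>2)" for s
  define E where "E s = grad_energy c ?B (v s)" for s
  define Cg where "Cg = g powr (- 2 * \<beta>) * (4 ^ ?d * F powr \<beta>)"
  have c: "0 < c x j" for x j using cb by (simp add: conductance_bound_def)
  have \<beta>: "0 < \<beta>" "\<beta> < 1" "1 / \<sigma> + \<beta> = 1" using \<sigma> by (auto simp: \<beta>_def)
  have n0: "0 < real n" using n by simp
  have V: "V = real (2 * R + 1) ^ ?d" by (simp add: V_def card_lbox)
  have V0: "0 < V" by (simp add: V)
  have nV: "real n ^ ?d \<le> 4 ^ ?d * V"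
  proof -
    have "(real n / 4) ^ ?d \<le> V" unfolding V using n by (intro power_mono) auto
    then show ?thesis by (simp add: power_divide field_simps)
  qed
  have "1 * 1 \<le> \<Lambda> * (4::real) ^ ?d" using \<Lambda> by (intro mult_mono) auto
  then have H1: "1 \<le> H" by (simp add: H_def)
  have C00: "0 \<le> C0" by (simp add: C0_def)
  have W0: "0 \<le> W" unfolding W_def by (auto intro!: sum_nonneg)
  have WV: "(W / V) powr (1 / q) \<le> H"
  proof -
    have "W \<le> (\<Sum>(x, j)\<in>edges (lbox x0 n). (1 / c x j) powr q)"
      unfolding W_def using edges_mono[OF lbox_mono[OF n(1), of x0]] by (intro sum_mono2 finite_edges) auto
    also have "\<dots> \<le> \<Lambda> * real n ^ ?d" using cb by (simp add: conductance_bound_def)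
    also have "\<dots> \<le> \<Lambda> * (4 ^ ?d * V)" using nV \<Lambda> by (intro mult_left_mono) auto
    finally have "W / V \<le> H" using V0 by (simp add: H_def field_simps)
    then have "(W / V) powr (1 / q) \<le> H powr (1 / q)" using W0 V0 q by (intro powr_mono2) auto
    also have "\<dots> \<le> H powr 1" using H1 q by (intro powr_mono) auto
    finally show ?thesis using H1 by simp
  qed
  have v0: "0 \<le> v s x" for s x by (simp add: v_def)
  have E0: "0 \<le> E s" for s unfolding E_def by (rule grad_energy_nonneg[OF c])
  have N0: "0 \<le> N2 s" for s unfolding N2_def by (intro sum_nonneg) auto
  have Cg0: "0 \<le> Cg" by (simp add: Cg_def)
  have cont: "continuous_on {a..b} (\<lambda>s. u s x)" if "x \<in> ?B" for x
    using that lbox_mono[OF n(1), of x0] t by (intro heat_sol_continuous[OF sol]) auto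
  have cw: "continuous_on {a..b} (\<lambda>s. \<Sum>x\<in>?B. (w s x)\<^sup>2)" unfolding w_def by (intro continuous_intros cont)
  have cN: "continuous_on {a..b} N2" unfolding N2_def v_def by (intro continuous_intros cont)
  have cE: "continuous_on {a..b} E" unfolding E_def v_def by (intro continuous_on_grad_energy continuous_intros cont)
  have point: "(\<Sum>x\<in>?B. (w s x)\<^sup>2) \<le> Cg * (2 * N2 s + 9 * C0 * H * (real n)\<^sup>2 * E s)"
    if s: "s \<in> {a..b}" for s
  proof -
    have w_le: "(w s x)\<^sup>2 \<le> g powr (- 2 * \<beta>) * ((v s x powr (2 * \<sigma>)) powr (1 / \<sigma>) * ((v s x)\<^sup>2) powr \<beta>)" for x
    proof (cases "g \<le> v s x")
      case True
      then have v: "0 < v s x" using g by simp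
      have "w s x \<le> v s x" using g by (auto simp: v_def w_def)
      then have "(w s x)\<^sup>2 \<le> (v s x)\<^sup>2" by (intro power_mono) (auto simp: w_def)
      also have "\<dots> \<le> (v s x / g) powr (2 * \<beta>) * (v s x)\<^sup>2"
      proof -
        have "1 \<le> (v s x / g) powr (2 * \<beta>)" using True g \<beta> by (intro ge_one_powr_ge_zero) auto
        from mult_right_mono[OF this, of "(v s x)\<^sup>2"] show ?thesis by simp
      qed
      also have "\<dots> = g powr (- 2 * \<beta>) * (v s x powr 2 * v s x powr (2 * \<beta>))"
        using v g by (simp add: powr_divide powr_minus field_simps)
      also have "v s x powr 2 * v s x powr (2 * \<beta>) = (v s x powr (2 * \<sigma>)) powr (1 / \<sigma>) * ((v s x)\<^sup>2) powr \<beta>"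
        using v \<sigma>(1) by (simp add: powr_powr flip: powr_numeral)
      finally show ?thesis .
    next
      case False
      then have "w s x = 0" using g by (auto simp: v_def w_def)
      then show ?thesis by simp
    qed
    have "(\<Sum>x\<in>?B. (w s x)\<^sup>2) \<le> (\<Sum>x\<in>?B. g powr (- 2 * \<beta>) * ((v s x powr (2 * \<sigma>)) powr (1 / \<sigma>) * ((v s x)\<^sup>2) powr \<beta>))"
      by (intro sum_mono w_le)
    also have "\<dots> = g powr (- 2 * \<beta>) * (\<Sum>x\<in>?B. (v s x powr (2 * \<sigma>)) powr (1 / \<sigma>) * ((v s x)\<^sup>2) powr \<beta>)"
      by (rule sum_distrib_left[symmetric])
    also have "\<dots> \<le> g powr (- 2 * \<beta>) * ((\<Sum>x\<in>?B. v s x powr (2 * \<sigma>)) powr (1 / \<sigma>) * N2 s powr \<beta>)"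
      unfolding N2_def using \<beta> \<sigma> by (intro mult_left_mono sum_powr_mult_le) auto
    also have "(\<Sum>x\<in>?B. v s x powr (2 * \<sigma>)) powr (1 / \<sigma>) \<le> V powr (- \<beta>) * (2 * N2 s + 9 * C0 * H * (real n)\<^sup>2 * E s)"
    proof -
      let ?l = "x0 - (\<chi> i. int R)" and ?h = "x0 + (\<chi> i. int R)"
      have mN: "mean ?B (\<lambda>x. (v s x)\<^sup>2) = N2 s / V" by (simp add: mean_def N2_def V_def)
      have mV: "(\<Sum>x\<in>?B. v s x powr (2 * \<sigma>)) = V * mean ?B (\<lambda>x. v s x powr (2 * \<sigma>))"
        unfolding V_def by (rule sum_eq_card_mean) auto
      have "mean {?l..?h} (\<lambda>x. v s x powr (2 * \<sigma>)) powr (1 / \<sigma>)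
        \<le> 2 * mean {?l..?h} (\<lambda>x. (v s x)\<^sup>2) + 4 * real CARD('d) * (1 + \<sigma> * (1 - 1 / q))\<^sup>2 * (3 * real n)\<^sup>2
          * ((\<Sum>(x, j)\<in>edges {?l..?h}. (1 / c x j) powr q) / real (card {?l..?h})) powr (1 / q)
          * ((\<Sum>(x, j)\<in>edges {?l..?h}. c x j * (grad (v s) x j)\<^sup>2) / real (card {?l..?h}))"
      proof (rule sobolev_weighted[where K = UNIV])
        show "?l \<le> ?h" by (simp add: less_eq_vec_def)
        show "real_of_int (?h $ j - ?l $ j + 1) \<le> 3 * real n" for j using n by simp
      qed (use q \<sigma> v0 c in auto)
      then have "mean ?B (\<lambda>x. v s x powr (2 * \<sigma>)) powr (1 / \<sigma>)
          \<le> 2 * (N2 s / V) + C0 * (3 * real n)\<^sup>2 * (W / V) powr (1 / q) * (E s / V)"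
        by (simp add: lbox_def[symmetric] mN C0_def W_def E_def grad_energy_def V_def)
      also have "\<dots> \<le> 2 * (N2 s / V) + C0 * (3 * real n)\<^sup>2 * H * (E s / V)"
        using WV C00 E0[of s] V0 by (intro add_left_mono mult_right_mono mult_left_mono) auto
      also have "\<dots> = (2 * N2 s + 9 * C0 * H * (real n)\<^sup>2 * E s) / V"
        by (simp add: power_mult_distrib add_divide_distrib mult_ac)
      finally have "V powr (1 / \<sigma>) * mean ?B (\<lambda>x. v s x powr (2 * \<sigma>)) powr (1 / \<sigma>)
          \<le> V powr (1 / \<sigma>) * ((2 * N2 s + 9 * C0 * H * (real n)\<^sup>2 * E s) / V)"
        by (intro mult_left_mono) auto
      also have "\<dots> = V powr (1 / \<sigma> - 1) * (2 * N2 s + 9 * C0 * H * (real n)\<^sup>2 * E s)"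
        using V0 by (simp add: powr_diff)
      also have "1 / \<sigma> - 1 = - \<beta>" by (simp add: \<beta>_def)
      finally show ?thesis unfolding mV powr_mult .
    qed
    also have "g powr (- 2 * \<beta>) * (V powr (- \<beta>) * (2 * N2 s + 9 * C0 * H * (real n)\<^sup>2 * E s) * N2 s powr \<beta>)
        = g powr (- 2 * \<beta>) * (V powr (- \<beta>) * N2 s powr \<beta>) * (2 * N2 s + 9 * C0 * H * (real n)\<^sup>2 * E s)"
      by (simp add: mult_ac)
    also have "\<dots> \<le> Cg * (2 * N2 s + 9 * C0 * H * (real n)\<^sup>2 * E s)"
      unfolding Cg_def
    proof (intro mult_right_mono mult_left_mono)
      have "N2 s \<le> F * real n ^ ?d" using F(1) s by (auto simp: energy_bound_def N2_def v_def)
      also have "\<dots> \<le> F * (4 ^ ?d * V)" using nV F(2) by (intro mult_left_mono) auto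
      finally have "N2 s / V \<le> F * 4 ^ ?d" using V0 by (simp add: field_simps)
      then have "(N2 s / V) powr \<beta> \<le> (F * 4 ^ ?d) powr \<beta>" using N0[of s] V0 \<beta> by (intro powr_mono2) auto
      also have "\<dots> = F powr \<beta> * (4 ^ ?d) powr \<beta>" by (rule powr_mult)
      also have "\<dots> \<le> F powr \<beta> * (4 ^ ?d) powr 1" using \<beta> by (intro mult_left_mono powr_mono) auto
      finally show "V powr (- \<beta>) * N2 s powr \<beta> \<le> 4 ^ ?d * F powr \<beta>"
        by (simp add: powr_divide powr_minus_divide mult.commute)
    qed (use N0[of s] E0[of s] C00 H1 in auto)
    finally show ?thesis by (simp add: mult_left_mono mult_right_mono)
  qed
  have iN: "integral {a..b} N2 \<le> F * real n ^ (?d + 2)"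
  proof -
    have "integral {a..b} N2 \<le> integral {a..b} (\<lambda>s. F * real n ^ ?d)"
      using F(1) by (intro integral_mono_continuous cN continuous_intros) (simp add: energy_bound_def N2_def v_def)
    also have "\<dots> = (b - a) * (F * real n ^ ?d)" using t by simp
    also have "\<dots> \<le> (real n)\<^sup>2 * (F * real n ^ ?d)" using t F(2) by (intro mult_right_mono) auto
    finally show ?thesis by (simp add: power_add power2_eq_square mult_ac)
  qed
  have iE: "integral {a..b} E \<le> F * real n ^ ?d"
    using F(1) unfolding energy_bound_def E_def[abs_def] v_def by simp
  have "integral {a..b} (\<lambda>s. \<Sum>x\<in>?B. (w s x)\<^sup>2)
      \<le> integral {a..b} (\<lambda>s. Cg * (2 * N2 s + 9 * C0 * H * (real n)\<^sup>2 * E s))"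
    by (intro integral_mono_continuous cw continuous_intros cN cE point)
  also have "\<dots> = Cg * (2 * integral {a..b} N2 + 9 * C0 * H * (real n)\<^sup>2 * integral {a..b} E)"
  proof -
    have iN: "(N2 has_integral integral {a..b} N2) {a..b}" and iE: "(E has_integral integral {a..b} E) {a..b}"
      using cN cE by (auto intro: integrable_integral integrable_continuous_real)
    show ?thesis by (intro integral_unique has_integral_mult_right has_integral_add iN iE)
  qed
  also have "\<dots> \<le> Cg * (2 * (F * real n ^ (?d + 2)) + 9 * C0 * H * (real n)\<^sup>2 * (F * real n ^ ?d))"
    using iN iE Cg0 C00 H1 by (intro mult_left_mono add_mono) auto
  also have "\<dots> = (4 ^ ?d * (2 + 9 * C0 * H)) * g powr (- 2 * \<beta>) * (F powr \<beta> * F) * real n ^ (?d + 2)"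
    by (simp add: Cg_def algebra_simps power_add power2_eq_square)
  also have "F powr \<beta> * F = F powr (2 - 1 / \<sigma>)"
  proof -
    have "2 - 1 / \<sigma> = \<beta> + 1" by (simp add: \<beta>_def)
    then show ?thesis using F(2) by (simp only: powr_add) simp
  qed
  also have "4 ^ ?d * (2 + 9 * C0 * H) = gain_const ?d q \<sigma> \<Lambda>"
    by (simp add: gain_const_def C0_def H_def)
  finally show ?thesis by (simp add: w_def \<beta>_def)
qed

text \<open>The case without bad positions, for estimates in which the L^1 norm of the conductances
  suffices.\<close>

lemma exists_cutoff:
  fixes x0 :: "int ^ 'd::finite"
  assumes "R' < R"
  obtains \<eta> where "\<And>x. 0 \<le> \<eta> x" "\<And>x. \<eta> x \<le> 1" "\<And>x. x \<in> lbox x0 R' \<Longrightarrow> \<eta> x = 1"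
    "\<And>x. x \<notin> lbox x0 (R - 1) \<Longrightarrow> \<eta> x = 0" "\<And>x j. (grad \<eta> x j)\<^sup>2 \<le> (2 / (real R - real R'))\<^sup>2"
proof -
  obtain \<psi> :: "int \<Rightarrow> real" where \<psi>: "\<And>s. 0 \<le> \<psi> s" "\<And>s. \<psi> s \<le> 1" "\<And>s. \<bar>s\<bar> \<le> int R' \<Longrightarrow> \<psi> s = 1"
      "\<And>s. int R \<le> \<bar>s\<bar> \<Longrightarrow> \<psi> s = 0" "\<And>s. \<bar>\<psi> (s + 1) - \<psi> s\<bar> \<le> 2 / (real R - real R')"
    using cutoff_1d[OF assms, of "{}"] assms by auto
  define \<eta> where "\<eta> x = (\<Prod>i\<in>UNIV. \<psi> (x $ i - x0 $ i))" for x
  note \<eta> = product_cutoff[of "\<lambda>i. \<psi>" \<eta> x0, OF \<psi>(1,2) \<eta>_def]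
  show ?thesis
  proof
    show "0 \<le> \<eta> x" for x by (rule \<eta>)
    show "\<eta> x \<le> 1" for x by (rule \<eta>)
    show "\<eta> x = 1" if "x \<in> lbox x0 R'" for x
      using that \<psi>(3) by (simp add: \<eta>_def mem_lbox)
    show "\<eta> x = 0" if nx: "x \<notin> lbox x0 (R - 1)" for x
    proof -
      obtain i where "int (R - 1) < \<bar>x $ i - x0 $ i\<bar>" using nx by (auto simp: mem_lbox not_le)
      then have "int R \<le> \<bar>x $ i - x0 $ i\<bar>" using assms by simp
      then have "\<psi> (x $ i - x0 $ i) = 0" by (rule \<psi>(4))
      then show ?thesis by (auto simp: \<eta>_def)
    qed
    show "(grad \<eta> x j)\<^sup>2 \<le> (2 / (real R - real R'))\<^sup>2" for x j
    proof (rule abs_le_square_iff[THEN iffD1])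
      show "\<bar>\<eta> (x + axis j 1) - \<eta> x\<bar> \<le> \<bar>2 / (real R - real R')\<bar>"
        using \<eta>(3)[of x j] \<psi>(5)[of "x $ j - x0 $ j"] by linarith
    qed
  qed
qed

text \<open>From \<open>y \<le> 1 + y powr r\<close> for \<open>r \<ge> 1\<close>, summed over
  edges; the 1 counts the edges of the box.\<close>

lemma sum_edge_weights_le:
  fixes x0 :: "int ^ 'd::finite"
  assumes "conductance_bound c x0 n p q \<Lambda>" "1 \<le> n" "1 \<le> p" "1 \<le> q" "R \<le> n"
  shows "(\<Sum>(x, j)\<in>edges (lbox x0 R). c x j) \<le> (real CARD('d) * 3 ^ CARD('d) + \<Lambda>) * real n ^ CARD('d)"
    "(\<Sum>(x, j)\<in>edges (lbox x0 R). 1 / c x j) \<le> (real CARD('d) * 3 ^ CARD('d) + \<Lambda>) * real n ^ CARD('d)"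
proof -
  let ?d = "CARD('d)"
  have c: "0 < c x j" for x j using assms by (simp add: conductance_bound_def)
  have le: "y \<le> 1 + y powr r" if "0 < y" "1 \<le> r" for y r :: real
  proof (cases "y \<le> 1")
    case False
    then have "y powr 1 \<le> y powr r" using that by (intro powr_mono) auto
    then show ?thesis using that by simp
  qed (use powr_ge_zero[of y r] in linarith)
  have one: "(\<Sum>(x, j)\<in>edges (lbox x0 n). 1 :: real) \<le> real ?d * 3 ^ ?d * real n ^ ?d"
  proof -
    have "(\<Sum>(x, j)\<in>edges (lbox x0 n). 1 :: real) \<le> real ?d * (\<Sum>x\<in>lbox x0 n. 1)"
      by (rule sum_edges_fst_le) auto
    also have "\<dots> = real ?d * real (2 * n + 1) ^ ?d" by (simp add: card_lbox)
    also have "\<dots> \<le> real ?d * (3 * real n) ^ ?d" using assms(2) by (intro mult_left_mono power_mono) auto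
    finally show ?thesis by (simp add: power_mult_distrib)
  qed
  have *: "(\<Sum>(x, j)\<in>edges (lbox x0 R). f x j) \<le> (real ?d * 3 ^ ?d + \<Lambda>) * real n ^ ?d"
    if "\<And>x j. 0 < f x j" "1 \<le> r" "(\<Sum>(x, j)\<in>edges (lbox x0 n). f x j powr r) \<le> \<Lambda> * real n ^ ?d" for f r
  proof -
    have "(\<Sum>(x, j)\<in>edges (lbox x0 R). f x j) \<le> (\<Sum>(x, j)\<in>edges (lbox x0 n). f x j)"
      using edges_mono[OF lbox_mono[OF assms(5), of x0]] that(1)
      by (intro sum_mono2 finite_edges) (auto simp: less_imp_le)
    also have "\<dots> \<le> (\<Sum>(x, j)\<in>edges (lbox x0 n). 1 + f x j powr r)"
      unfolding split_def by (intro sum_mono le that)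
    also have "\<dots> = (\<Sum>(x, j)\<in>edges (lbox x0 n). 1 :: real) + (\<Sum>(x, j)\<in>edges (lbox x0 n). f x j powr r)"
      unfolding split_def by (rule sum.distrib)
    finally show ?thesis using one that(3) by (simp add: algebra_simps)
  qed
  show "(\<Sum>(x, j)\<in>edges (lbox x0 R). c x j) \<le> (real CARD('d) * 3 ^ CARD('d) + \<Lambda>) * real n ^ CARD('d)"
    using assms c by (intro *[where r = p]) (auto simp: conductance_bound_def)
  show "(\<Sum>(x, j)\<in>edges (lbox x0 R). 1 / c x j) \<le> (real CARD('d) * 3 ^ CARD('d) + \<Lambda>) * real n ^ CARD('d)"
    using assms c by (intro *[where r = q]) (auto simp: conductance_bound_def)
qed

text \<open>Starts the recursion. The truncation is at most 1, so the cutoff term is bounded by the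
  L^1 norm of the conductances and no Sobolev inequality enters.\<close>

lemma initial_energy_bound:
  fixes x0 :: "int ^ 'd::finite" and c :: "int ^ 'd \<Rightarrow> 'd \<Rightarrow> real" and k :: real
  assumes cb: "conductance_bound c x0 n p q \<Lambda>" and n: "1 \<le> n" "2 * R \<le> n" and pq: "1 \<le> p" "1 \<le> q" and \<Lambda>: "0 \<le> \<Lambda>"
    and sol: "heat_sol c x0 n a b u" and t: "a < a'" "a' \<le> b" "b - a \<le> 2 * (a' - a)" "b - a \<le> (real n)\<^sup>2"
    and u: "\<And>s x. s \<in> {a..b} \<Longrightarrow> x \<in> lbox x0 n \<Longrightarrow> u s x \<le> k + 1"
  shows "energy_bound c x0 n R a' b (\<lambda>s x. max 0 (u s x - k))
    (2 * (3 ^ CARD('d) + 32 * (real CARD('d) * 3 ^ CARD('d) + \<Lambda>)))"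
proof -
  let ?d = "CARD('d)" and ?B = "lbox x0 n"
  define M where "M = (real ?d * 3 ^ ?d + \<Lambda>) * real n ^ ?d"
  have c: "0 < c x j" for x j using cb by (simp add: conductance_bound_def)
  have n0: "0 < real n" using n by simp
  have M: "(\<Sum>(x, j)\<in>edges ?B. c x j) \<le> M"
    unfolding M_def by (rule sum_edge_weights_le[OF cb n(1) pq]) simp
  have M0: "0 \<le> M" using \<Lambda> by (simp add: M_def)
  have "R < n" using n by simp
  then obtain \<eta> where \<eta>: "\<And>x. 0 \<le> \<eta> x" "\<And>x. \<eta> x \<le> 1" "\<And>x. x \<in> lbox x0 R \<Longrightarrow> \<eta> x = 1"
    "\<And>x. x \<notin> lbox x0 (n - 1) \<Longrightarrow> \<eta> x = 0" and \<eta>D: "\<And>x j. (grad \<eta> x j)\<^sup>2 \<le> (2 / (real n - real R))\<^sup>2"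
    using exists_cutoff[of R n x0] by metis
  have "2 / (real n - real R) \<le> 4 / real n" using n n0 by (simp add: field_simps)
  then have "(2 / (real n - real R))\<^sup>2 \<le> (4 / real n)\<^sup>2" using \<open>R < n\<close> by (intro power_mono) auto
  also have "(4 / real n)\<^sup>2 = 16 / (real n)\<^sup>2" by (simp add: power_divide)
  finally have \<eta>D': "(grad \<eta> x j)\<^sup>2 \<le> 16 / (real n)\<^sup>2" for x j
    using \<eta>D[of x j] by linarith
  define w where "w s x = max 0 (u s x - k)" for s x
  have w: "0 \<le> w s x" "w s x \<le> 1" if "s \<in> {a..b}" "x \<in> ?B" for s x using u[OF that] by (auto simp: w_def)
  have cont: "continuous_on {a..b} (\<lambda>s. w s x)" if "x \<in> ?B" for x
    unfolding w_def using that by (intro continuous_intros heat_sol_continuous[OF sol]) auto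
  define G where "G = 16 / (real n)\<^sup>2 * M"
  show ?thesis
  proof (rule energy_step_aux[where R = n and a = a and G = "\<lambda>_. G" and \<eta> = \<eta>, OF sol n(1) order_refl _ order_refl t(1,2) c \<eta>])
    show "(\<Sum>(x, j)\<in>edges ?B. c x j * (max 0 (u s x - k) * max 0 (u s (x + axis j 1) - k) * (grad \<eta> x j)\<^sup>2)) \<le> G"
      if s: "s \<in> {a..b}" for s
    proof -
      have "cutoff_term c ?B \<eta> (w s)
          \<le> (\<Sum>(x, j)\<in>edges ?B. 16 / (real n)\<^sup>2 * c x j)"
      proof (intro sum_mono, clarify)
        fix x j assume "(x, j) \<in> edges ?B"
        then have "x \<in> ?B" "x + axis j 1 \<in> ?B" by (auto simp: edges_def)
        then have "w s x * w s (x + axis j 1) * (grad \<eta> x j)\<^sup>2 \<le> 1 * 1 * (16 / (real n)\<^sup>2)"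
          using w s \<eta>D' by (intro mult_mono) auto
        from mult_left_mono[OF this less_imp_le[OF c]]
        show "c x j * (w s x * w s (x + axis j 1) * (grad \<eta> x j)\<^sup>2) \<le> 16 / (real n)\<^sup>2 * c x j"
          by (simp add: mult.commute)
      qed
      also have "\<dots> = 16 / (real n)\<^sup>2 * (\<Sum>(x, j)\<in>edges ?B. c x j)"
        by (simp add: sum_distrib_left split_def)
      also have "\<dots> \<le> G" unfolding G_def using M by (intro mult_left_mono) auto
      finally show ?thesis by (simp add: w_def)
    qed
    have "integral {a..b} (\<lambda>s. (\<Sum>x\<in>?B. (w s x)\<^sup>2) + 2 * (b - a) * G)
        \<le> integral {a..b} (\<lambda>s. 3 ^ ?d * real n ^ ?d + 2 * (b - a) * G)"
    proof (intro integral_mono_continuous continuous_intros cont add_right_mono)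
      fix s assume s: "s \<in> {a..b}"
      have "(\<Sum>x\<in>?B. (w s x)\<^sup>2) \<le> (\<Sum>x\<in>?B. 1)"
        using w[OF s] by (intro sum_mono power_le_one) auto
      also have "\<dots> = real (2 * n + 1) ^ ?d" by (simp add: card_lbox)
      also have "\<dots> \<le> (3 * real n) ^ ?d" using n by (intro power_mono) auto
      finally show "(\<Sum>x\<in>?B. (w s x)\<^sup>2) \<le> 3 ^ ?d * real n ^ ?d" by (simp add: power_mult_distrib)
    qed
    then show "integral {a..b} (\<lambda>s. (\<Sum>x\<in>?B. (max 0 (u s x - k))\<^sup>2) + 2 * (b - a) * G)
       \<le> (b - a) * (3 ^ ?d * real n ^ ?d + 2 * (b - a) * G)"
      using t by (simp add: w_def)
    have "(b - a) * G \<le> (real n)\<^sup>2 * G" using t M0 by (intro mult_right_mono) (auto simp: G_def)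
    also have "\<dots> = 16 * M" using n0 by (simp add: G_def)
    finally have G: "2 * (b - a) * G \<le> 32 * M" by linarith
    have "(b - a) * (3 ^ ?d * real n ^ ?d + 2 * (b - a) * G) \<le> (2 * (a' - a)) * (3 ^ ?d * real n ^ ?d + 32 * M)"
      using t M0 by (intro mult_mono add_left_mono G) (auto simp: G_def)
    then show "(b - a) * (3 ^ ?d * real n ^ ?d + 2 * (b - a) * G)
        \<le> 2 * (3 ^ ?d + 32 * (real ?d * 3 ^ ?d + \<Lambda>)) * (a' - a) * real n ^ ?d"
      by (simp add: M_def algebra_simps)
  qed (use n in auto)
qed

section \<open>The recursion over levels and radii\<close>

text \<open>
  At step \<open>j\<close> the level increases by \<open>(1 / 2) ^ (j + 2)\<close> and the radius decreases by at least
  \<open>(1 / 2) ^ (j + 5) * n\<close>; the base \<open>128 = 4 * 32\<close> collects the square of the first factor and the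
  fifth power of the second one.
\<close>

lemma de_giorgi_numeric:
  fixes F Cs Cb \<sigma> \<tau> :: real and j :: nat
  assumes F: "0 < F" "F \<le> 1" and C: "1 \<le> Cs" "1 \<le> Cb" and \<sigma>: "1 < \<sigma>" and \<tau>: "0 < \<tau>" "\<tau> < 1"
  defines "Y \<equiv> Cb * ((1 / 2) ^ (j + 2)) powr (- 2 * (1 - 1 / \<sigma>)) * F powr (2 - 1 / \<sigma>)"
  shows "Cs / ((1 / 2) ^ (j + 5)) ^ 5 * (F powr \<tau> * Y powr (1 - \<tau>) + Y)
    \<le> (2 ^ 30 * Cs * Cb) * 128 ^ j * F powr (1 + (1 - 1 / \<sigma>) * (1 - \<tau>))"
proof -
  define \<beta> where "\<beta> = 1 - 1 / \<sigma>"
  define Z where "Z = 16 * Cb * 4 ^ j"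
  have \<beta>: "0 < \<beta>" "\<beta> < 1" using \<sigma> by (auto simp: \<beta>_def)
  have Z1: "1 \<le> Z" using C mult_mono[of 1 "16 * Cb" 1 "4 ^ j"] by (simp add: Z_def)
  have gle: "((1 / 2) ^ (j + 2)) powr (- 2 * \<beta>) \<le> 16 * 4 ^ j"
  proof -
    have "((1 / 2 :: real) ^ (j + 2)) powr (- 2 * \<beta>) = (2 ^ (j + 2)) powr (2 * \<beta>)"
      by (simp add: power_one_over powr_minus powr_divide)
    also have "\<dots> \<le> (2 ^ (j + 2)) powr 2"
      using \<beta> one_le_power[of "2::real" "j + 2"] by (intro powr_mono) auto
    also have "\<dots> = ((2::real) ^ (j + 2)) ^ 2" by simp
    also have "\<dots> = 16 * (2 ^ j * 2 ^ j)" by (simp add: power_add power2_eq_square)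
    also have "(2 :: real) ^ j * 2 ^ j = 4 ^ j" by (simp flip: power_mult_distrib)
    finally show ?thesis .
  qed
  have Y0: "0 \<le> Y" using C by (simp add: Y_def)
  have YZ: "Y \<le> Z * F powr (1 + \<beta>)"
  proof -
    have "Y = Cb * ((1 / 2) ^ (j + 2)) powr (- 2 * \<beta>) * F powr (1 + \<beta>)"
      by (simp add: Y_def \<beta>_def)
    also have "\<dots> \<le> Cb * (16 * 4 ^ j) * F powr (1 + \<beta>)"
      using C gle by (intro mult_right_mono mult_left_mono) auto
    finally show ?thesis by (simp add: Z_def mult_ac)
  qed
  let ?e = "1 + \<beta> * (1 - \<tau>)"
  have 1: "F powr \<tau> * Y powr (1 - \<tau>) \<le> Z * F powr ?e"
  proof -
    have "Y powr (1 - \<tau>) \<le> (Z * F powr (1 + \<beta>)) powr (1 - \<tau>)"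
      using YZ Y0 \<tau> by (intro powr_mono2) auto
    also have "\<dots> = Z powr (1 - \<tau>) * F powr ((1 + \<beta>) * (1 - \<tau>))"
      by (simp only: powr_mult powr_powr)
    also have "\<dots> \<le> Z powr 1 * F powr ((1 + \<beta>) * (1 - \<tau>))"
      using Z1 \<tau> by (intro mult_right_mono powr_mono) auto
    finally have "F powr \<tau> * Y powr (1 - \<tau>) \<le> F powr \<tau> * (Z powr 1 * F powr ((1 + \<beta>) * (1 - \<tau>)))"
      by (intro mult_left_mono) auto
    also have "\<dots> = Z * (F powr \<tau> * F powr ((1 + \<beta>) * (1 - \<tau>)))" using Z1 by simp
    also have "F powr \<tau> * F powr ((1 + \<beta>) * (1 - \<tau>)) = F powr ?e"
      unfolding powr_add[symmetric] by (simp add: algebra_simps)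
    finally show ?thesis .
  qed
  have 2: "Y \<le> Z * F powr ?e"
  proof -
    have "\<beta> * (1 - \<tau>) \<le> \<beta>" using \<beta> \<tau> by (intro mult_right_le_one_le) auto
    then have "F powr (1 + \<beta>) \<le> F powr ?e" using F by (intro powr_mono') auto
    then have "Z * F powr (1 + \<beta>) \<le> Z * F powr ?e" using Z1 by (intro mult_left_mono) auto
    then show ?thesis using YZ by linarith
  qed
  have "Cs / ((1 / 2) ^ (j + 5)) ^ 5 = Cs * 2 ^ 25 * 32 ^ j"
  proof -
    have "((1 / 2 :: real) ^ (j + 5)) ^ 5 = 1 / (2 ^ 25 * 32 ^ j)"
    proof -
      have "((1 / 2 :: real) ^ (j + 5)) ^ 5 = (1 / 2) ^ (25 + 5 * j)"
        by (simp only: power_mult[symmetric]) (simp add: algebra_simps)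
      also have "\<dots> = (1 / 2) ^ 25 * ((1 / 2) ^ 5) ^ j" by (simp only: power_add power_mult)
      finally show ?thesis by (simp add: power_one_over)
    qed
    then show ?thesis by simp
  qed
  then have "Cs / ((1 / 2) ^ (j + 5)) ^ 5 * (F powr \<tau> * Y powr (1 - \<tau>) + Y)
     \<le> Cs * 2 ^ 25 * 32 ^ j * (2 * (Z * F powr ?e))"
    using 1 2 C by (simp only:) (intro mult_left_mono, auto)
  \<comment> \<open>The exponent 30 is made up of 25 from the fifth power of 32, of 4 from the
    factor 16 in \<open>Z\<close>, and of 1 from the two equal summands.\<close>
  also have "\<dots> = (2 ^ 30 * Cs * Cb) * (32 ^ j * 4 ^ j) * F powr ?e" by (simp add: Z_def)
  also have "(32 :: real) ^ j * 4 ^ j = 128 ^ j" by (simp flip: power_mult_distrib)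
  finally show ?thesis by (simp add: \<beta>_def)
qed

text \<open>The sequence \<open>\<epsilon> * (1 / a) ^ j\<close> survives the superlinear recursion:
  its surplus power \<open>\<alpha>\<close> decays with ratio \<open>a powr (- \<alpha>)\<close>,
  which beats the growth \<open>128 ^ j\<close>, while the smallness of \<open>\<epsilon>\<close>
  pays for \<open>C\<close> and for one more factor \<open>a\<close>.\<close>

lemma de_giorgi_decay:
  fixes a \<epsilon> \<alpha> C :: real
  assumes "0 < \<alpha>" "0 < \<epsilon>" "128 powr (1 / \<alpha>) \<le> a" "0 < C" "C * \<epsilon> powr \<alpha> * a \<le> 1"
  shows "C * 128 ^ j * (\<epsilon> * (1 / a) ^ j) powr (1 + \<alpha>) \<le> \<epsilon> * (1 / a) ^ Suc j"
proof -
  have a0: "0 < a" using assms(3) by (rule less_le_trans[rotated]) simp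
  have "128 = (128 powr (1 / \<alpha>)) powr \<alpha>" using assms(1) by (simp add: powr_powr)
  also have "\<dots> \<le> a powr \<alpha>" using assms by (intro powr_mono2) auto
  finally have a128: "128 \<le> a powr \<alpha>" .
  have "(128 :: real) ^ j * ((1 / a) ^ j) powr \<alpha> \<le> 1"
  proof -
    have "((1 / a) ^ j) powr \<alpha> = 1 / (a powr \<alpha>) ^ j"
      using a0 by (simp add: power_one_over powr_divide powr_powr powr_mult flip: powr_realpow) (simp add: mult.commute)
    moreover have "(128 :: real) ^ j \<le> (a powr \<alpha>) ^ j" using a128 by (intro power_mono) auto
    ultimately show ?thesis using a0 by simp
  qed
  then have "(C * \<epsilon> powr \<alpha>) * (128 ^ j * ((1 / a) ^ j) powr \<alpha>) \<le> (C * \<epsilon> powr \<alpha>) * 1"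
    using assms by (intro mult_left_mono) auto
  also have "\<dots> \<le> 1 / a" using assms(5) a0 by (simp add: field_simps)
  finally have "(\<epsilon> * (1 / a) ^ j) * ((C * \<epsilon> powr \<alpha>) * (128 ^ j * ((1 / a) ^ j) powr \<alpha>)) \<le> (\<epsilon> * (1 / a) ^ j) * (1 / a)"
    using assms(2) a0 by (intro mult_left_mono) auto
  moreover have "(\<epsilon> * (1 / a) ^ j) powr (1 + \<alpha>) = (\<epsilon> * (1 / a) ^ j) * (\<epsilon> powr \<alpha> * ((1 / a) ^ j) powr \<alpha>)"
    using assms(2) a0 by (simp add: powr_add powr_mult del: power_one_over)
  ultimately show ?thesis by (simp add: mult_ac)
qed

text \<open>After a first step from radius \<open>n div 2\<close>, the radii shrink from about
  \<open>n / 4\<close> towards \<open>n / 8\<close>, the time spans from \<open>n^2 / 4\<close>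
  towards \<open>n^2 / 8\<close>, and the levels rise from 0 towards 1/2. At the last step
  \<open>n ^ d\<close> is comparable to \<open>2 ^ (d * j)\<close>, so a decay of \<open>F j\<close>
  at least as fast as \<open>2 ^ (- d * j)\<close> turns the L^2 bound into a pointwise one.\<close>

lemma de_giorgi:
  fixes p q \<Lambda> \<kappa> \<tau> \<sigma> :: real
  assumes d: "2 \<le> CARD('d::finite)" and p: "1 < p" and q: "1 < q" and \<Lambda>: "1 \<le> \<Lambda>"
    and \<kappa>: "1 < \<kappa>" "\<kappa> * (real CARD('d) - 3 + (real CARD('d) - 1) / q) \<le> real CARD('d) - 1"
    and \<tau>: "\<tau> = \<kappa> / (p * (\<kappa> - 1))" "\<tau> < 1"
    and \<sigma>: "1 < \<sigma>" "\<sigma> * (real CARD('d) - 2 + real CARD('d) / q) \<le> real CARD('d)"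
  shows "\<exists>\<nu>>0. \<forall>(c :: int ^ 'd \<Rightarrow> 'd \<Rightarrow> real) x0 n t0 u.
    conductance_bound c x0 n p q \<Lambda> \<longrightarrow> 16 \<le> n \<longrightarrow> heat_sol c x0 n (t0 - (real n)\<^sup>2) t0 u \<longrightarrow>
    (\<forall>s\<in>{t0 - (real n)\<^sup>2..t0}. \<forall>x\<in>lbox x0 n. u s x \<le> 1) \<longrightarrow>
    integral {t0 - (real n)\<^sup>2 / 2..t0} (\<lambda>s. \<Sum>x\<in>lbox x0 (n div 2). (max 0 (u s x))\<^sup>2) \<le> \<nu> * real n ^ (CARD('d) + 2) \<longrightarrow>
    (\<forall>t\<in>{t0 - (real n)\<^sup>2 / 64..t0}. \<forall>x\<in>lbox x0 (n div 8). u t x \<le> 3 / 4)"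
proof -
  let ?d = "CARD('d)"
  define Cs where "Cs = 24 * real ?d * layer_const ?d q \<kappa> \<Lambda>"
  define Cb where "Cb = gain_const ?d q \<sigma> \<Lambda>"
  define C0 where "C0 = 2 * (3 ^ ?d + 32 * (real ?d * 3 ^ ?d + \<Lambda>))"
  define \<alpha> where "\<alpha> = (1 - 1 / \<sigma>) * (1 - \<tau>)"
  define C3 where "C3 = 2 ^ 30 * Cs * Cb"
  \<comment> \<open>The first factor is the ratio required by the recursion, the second one
    compensates the volume \<open>n ^ d\<close> at the last step.\<close>
  define a where "a = 128 powr (1 / \<alpha>) * 2 ^ ?d"
  \<comment> \<open>The last entry makes the squared truncation at the end at most 1/16, as
    \<open>n\<close> is then below \<open>32 * 2 ^ J\<close>; with levels below 1/2 this gives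
    3/4.\<close>
  define \<epsilon> where "\<epsilon> = Min {1, (1 / (C3 * a)) powr (1 / \<alpha>), 1 / (16 * 32 ^ ?d)}"
  define D where "D = Cs * 8 ^ 5"
  \<comment> \<open>Makes the first step, which starts from the energy bound \<open>C0\<close> and
    the mass \<open>\<nu>\<close> and has \<open>\<rho> = 1 / 8\<close>, end below
    \<open>\<epsilon>\<close>.\<close>
  define \<nu> where "\<nu> = Min {\<epsilon> / (2 * D), (\<epsilon> / (2 * D * C0 powr \<tau>)) powr (1 / (1 - \<tau>))}"
  have \<tau>0: "0 < \<tau>" using p \<kappa> by (simp add: \<tau>)
  have lc: "1 \<le> layer_const ?d q \<kappa> \<Lambda>" using \<Lambda> by (rule layer_const_ge_1)
  have Cs: "1 \<le> Cs"
  proof -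
    have "1 * 1 \<le> (24 * real ?d) * layer_const ?d q \<kappa> \<Lambda>" using lc d by (intro mult_mono) auto
    then show ?thesis by (simp add: Cs_def)
  qed
  have Cb: "1 \<le> Cb" unfolding Cb_def using \<Lambda> by (rule gain_const_ge_1)
  have C0: "0 < C0" using \<Lambda> by (simp add: C0_def add_pos_nonneg)
  have \<alpha>: "0 < \<alpha>" using \<sigma> \<tau> by (simp add: \<alpha>_def)
  have C3: "0 < C3" using Cs Cb by (simp add: C3_def)
  have a128: "128 powr (1 / \<alpha>) \<le> a"
  proof -
    have "128 powr (1 / \<alpha>) * 1 \<le> a" unfolding a_def by (intro mult_left_mono) auto
    then show ?thesis by simp
  qed
  have a2: "2 ^ ?d \<le> a"
  proof -
    have "1 * 2 ^ ?d \<le> a" unfolding a_def using \<alpha> by (intro mult_right_mono ge_one_powr_ge_zero) auto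
    then show ?thesis by simp
  qed
  have a0: "0 < a" using a2 by (rule less_le_trans[rotated]) simp
  have \<epsilon>: "0 < \<epsilon>" "\<epsilon> \<le> 1" "\<epsilon> \<le> (1 / (C3 * a)) powr (1 / \<alpha>)" "\<epsilon> \<le> 1 / (16 * 32 ^ ?d)"
  proof -
    show "0 < \<epsilon>" using C3 a0 by (simp add: \<epsilon>_def)
    show "\<epsilon> \<le> 1" "\<epsilon> \<le> (1 / (C3 * a)) powr (1 / \<alpha>)" "\<epsilon> \<le> 1 / (16 * 32 ^ ?d)"
      unfolding \<epsilon>_def by (intro Min_le; simp)+
  qed
  have \<epsilon>a: "C3 * \<epsilon> powr \<alpha> * a \<le> 1"
  proof -
    have "\<epsilon> powr \<alpha> \<le> ((1 / (C3 * a)) powr (1 / \<alpha>)) powr \<alpha>" using \<epsilon> \<alpha> by (intro powr_mono2) auto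
    also have "\<dots> = 1 / (C3 * a)" using \<alpha> C3 a0 by (simp add: powr_powr)
    finally show ?thesis using C3 a0 by (simp add: field_simps)
  qed
  have D: "0 < D" using Cs by (simp add: D_def)
  have \<nu>: "0 < \<nu>" "\<nu> \<le> \<epsilon> / (2 * D)" "\<nu> \<le> (\<epsilon> / (2 * D * C0 powr \<tau>)) powr (1 / (1 - \<tau>))"
  proof -
    show "0 < \<nu>" using \<epsilon> D C0 by (simp add: \<nu>_def)
    show "\<nu> \<le> \<epsilon> / (2 * D)" "\<nu> \<le> (\<epsilon> / (2 * D * C0 powr \<tau>)) powr (1 / (1 - \<tau>))"
      unfolding \<nu>_def by (intro Min_le; simp)+
  qed
  have \<nu>\<epsilon>: "D * (C0 powr \<tau> * \<nu> powr (1 - \<tau>) + \<nu>) \<le> \<epsilon>"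
  proof -
    have "\<nu> powr (1 - \<tau>) \<le> ((\<epsilon> / (2 * D * C0 powr \<tau>)) powr (1 / (1 - \<tau>))) powr (1 - \<tau>)"
      using \<nu> \<tau> by (intro powr_mono2) auto
    also have "\<dots> = \<epsilon> / (2 * D * C0 powr \<tau>)" using \<tau>(2) \<epsilon>(1) D C0 by (simp add: powr_powr)
    finally have "D * (C0 powr \<tau> * \<nu> powr (1 - \<tau>)) \<le> \<epsilon> / 2" using D C0 by (simp add: field_simps)
    moreover have "D * \<nu> \<le> \<epsilon> / 2" using \<nu>(2) D by (simp add: field_simps)
    ultimately show ?thesis by (simp add: distrib_left)
  qed
  have main: "u t x \<le> 3 / 4"
    if cb: "conductance_bound c x0 n p q \<Lambda>" and n16: "16 \<le> n" and sol: "heat_sol c x0 n (t0 - (real n)\<^sup>2) t0 u"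
      and u1: "\<forall>s\<in>{t0 - (real n)\<^sup>2..t0}. \<forall>x\<in>lbox x0 n. u s x \<le> 1"
      and small: "integral {t0 - (real n)\<^sup>2 / 2..t0} (\<lambda>s. \<Sum>x\<in>lbox x0 (n div 2). (max 0 (u s x))\<^sup>2) \<le> \<nu> * real n ^ (?d + 2)"
      and t: "t \<in> {t0 - (real n)\<^sup>2 / 64..t0}" and x: "x \<in> lbox x0 (n div 8)"
    for c :: "int ^ 'd \<Rightarrow> 'd \<Rightarrow> real" and x0 n t0 u t x
  proof -
    define R where "R j = nat \<lfloor>real n / 8 * (1 + (1 / 2) ^ j)\<rfloor>" for j :: nat
    define T where "T j = (real n)\<^sup>2 / 8 * (1 + (1 / 2) ^ j)" for j :: nat
    define k where "k j = (1 - (1 / 2) ^ j) / (2 :: real)" for j :: nat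
    define F where "F j = \<epsilon> * (1 / a) ^ j" for j :: nat
    have c: "0 < c x j" for x j using cb by (simp add: conductance_bound_def)
    have n0: "0 < real n" "1 \<le> n" using n16 by auto
    have R: "real (R j) \<le> real n / 8 * (1 + (1 / 2) ^ j)" "real n / 8 * (1 + (1 / 2) ^ j) < real (R j) + 1" for j
    proof -
      have "0 \<le> real n / 8 * (1 + (1 / 2) ^ j)" by simp
      then have "real (R j) = of_int \<lfloor>real n / 8 * (1 + (1 / 2) ^ j)\<rfloor>" by (simp add: R_def)
      then show "real (R j) \<le> real n / 8 * (1 + (1 / 2) ^ j)" "real n / 8 * (1 + (1 / 2) ^ j) < real (R j) + 1"
        by linarith+
    qed
    have half: "(1 / 2 :: real) ^ j \<le> 1" for j by (simp add: power_le_one)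
    have Rn: "R j \<le> n" for j
    proof -
      have "real n / 8 * (1 + (1 / 2) ^ j) \<le> real n / 8 * 2" using half[of j] by (intro mult_left_mono) auto
      then have "real (R j) \<le> real n" using R(1)[of j] by simp
      then show ?thesis by simp
    qed
    \<comment> \<open>Rounding the radius costs less than one lattice spacing, which is made up for
      by \<open>n / 8 * (1 / 2) ^ j \<ge> 1\<close>.\<close>
    have nR: "n \<le> 8 * R j" if "2 ^ (j + 4) \<le> n" for j
    proof -
      have "real (2 ^ (j + 4)) \<le> real n" using that by (simp only: of_nat_le_iff)
      then have "2 ^ (j + 4) \<le> real n" by (simp only: of_nat_power of_nat_numeral)
      then have "8 \<le> real n * (1 / 2) ^ j" by (simp add: power_add power_one_over field_simps)
      then have "real n \<le> 8 * real (R j)" using R(2)[of j] by (simp add: distrib_left)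
      then show ?thesis by linarith
    qed
    have Tn: "T j \<le> (real n)\<^sup>2 / 4" "0 \<le> T j" "(real n)\<^sup>2 / 8 \<le> T j" for j
    proof -
      have "(real n)\<^sup>2 / 8 * (1 + (1 / 2) ^ j) \<le> (real n)\<^sup>2 / 8 * 2" using half[of j] by (intro mult_left_mono) auto
      then show "T j \<le> (real n)\<^sup>2 / 4" by (simp add: T_def)
      have "(real n)\<^sup>2 / 8 * 1 \<le> (real n)\<^sup>2 / 8 * (1 + (1 / 2) ^ j)" by (intro mult_left_mono) auto
      then show "(real n)\<^sup>2 / 8 \<le> T j" by (simp add: T_def)
      then show "0 \<le> T j" by (rule order_trans[rotated]) simp
    qed
    have F: "0 < F j" "F j \<le> 1" for j
    proof -
      show "0 < F j" using \<epsilon> a0 by (simp add: F_def)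
      have "1 \<le> a" using a2 one_le_power[of "2::real" ?d] by linarith
      then have "(1 / a) ^ j \<le> 1" using a0 by (intro power_le_one) auto
      then have "F j \<le> 1 * 1" unfolding F_def using \<epsilon> a0 by (intro mult_mono) auto
      then show "F j \<le> 1" by simp
    qed
    have E: "energy_bound c x0 n (R j) (t0 - T j) t0 (\<lambda>s x. max 0 (u s x - k j)) (F j)" if "2 ^ (j + 4) \<le> n" for j
      using that
    proof (induction j)
      case 0
      have eb0: "energy_bound c x0 n (n div 2) (t0 - (real n)\<^sup>2 / 2) t0 (\<lambda>s x. max 0 (u s x - 0)) C0"
        unfolding C0_def by (rule initial_energy_bound[OF cb n0(2) _ _ _ _ sol]) (use p q \<Lambda> u1 n0 in auto)
      have "energy_bound c x0 n (R 0) (t0 - T 0) t0 (\<lambda>s x. max 0 (u s x - 0))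
          (24 * real ?d * layer_const ?d q \<kappa> \<Lambda> / (1 / 8) ^ 5 * (C0 powr \<tau> * \<nu> powr (1 - \<tau>) + \<nu>))"
      proof (rule energy_step[where R = "n div 2", OF cb d _ _ _ n0(2) _ _ _ \<Lambda> p q \<kappa> \<tau> sol _ _ _ _ eb0 C0 _ \<nu>(1)])
        have R0: "real (R 0) \<le> real n / 4" using R(1)[of 0] by simp
        define m where "m = n div 2"
        have "n \<le> 2 * m + 1" unfolding m_def by linarith
        then have "real n \<le> real (2 * m + 1)" by (simp only: of_nat_le_iff)
        then have "(real n - 1) / 2 \<le> real m" by simp
        then have "1 / 8 * real n \<le> real m - real (R 0)" using R0 n16 by simp
        then show "1 / 8 * real n \<le> real (n div 2) - real (R 0)" by (simp only: m_def)
        then have "real (R 0) < real (n div 2)" using n0 by simp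
        then show "R 0 < n div 2" by simp
        show "integral {t0 - (real n)\<^sup>2 / 2..t0} (\<lambda>s. \<Sum>x\<in>lbox x0 (n div 2). (max 0 (u s x - 0))\<^sup>2) \<le> \<nu> * real n ^ (?d + 2)"
          using small by simp
        show "n \<le> 8 * (n div 2)" using n16 by linarith
      qed (use n0 in \<open>auto simp: T_def\<close>)
      moreover have "24 * real ?d * layer_const ?d q \<kappa> \<Lambda> / (1 / 8) ^ 5 * (C0 powr \<tau> * \<nu> powr (1 - \<tau>) + \<nu>) \<le> F 0"
        using \<nu>\<epsilon> by (simp add: F_def D_def Cs_def power_one_over)
      ultimately show ?case using energy_bound_mono by (fastforce simp: k_def)
    next
      case (Suc j)
      have "(2 :: nat) ^ (j + 4) \<le> 2 ^ (Suc j + 4)" by (intro power_increasing) auto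
      then have nj: "2 ^ (j + 4) \<le> n" using Suc.prems by (rule order_trans)
      have "Suc j + 4 = j + 5" by simp
      then have "2 ^ (j + 5) \<le> n" using Suc.prems by (simp only:)
      then have "real (2 ^ (j + 5)) \<le> real n" by (simp only: of_nat_le_iff)
      then have nj5: "2 ^ (j + 5) \<le> real n" by (simp only: of_nat_power of_nat_numeral)
      define g where "g = (1 / 2 :: real) ^ (j + 2)"
      define \<rho> where "\<rho> = (1 / 2 :: real) ^ (j + 5)"
      define Y where "Y = Cb * g powr (- 2 * (1 - 1 / \<sigma>)) * F j powr (2 - 1 / \<sigma>)"
      have g0: "0 < g" by (simp add: g_def)
      have kg: "k j + g = k (Suc j)" by (simp add: k_def g_def field_simps)
      have eb: "energy_bound c x0 n (R j) (t0 - T j) t0 (\<lambda>s x. max 0 (u s x - k j)) (F j)"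
        using Suc.IH[OF nj] .
      have Tj: "t0 - (real n)\<^sup>2 \<le> t0 - T j" "t0 - T j \<le> t0" "t0 - (t0 - T j) \<le> (real n)\<^sup>2"
        using Tn[of j] zero_le_power2[of "real n"] by linarith+
      have Y: "integral {t0 - T j..t0} (\<lambda>s. \<Sum>x\<in>lbox x0 (R j). (max 0 (u s x - k (Suc j)))\<^sup>2) \<le> Y * real n ^ (?d + 2)"
        using level_gain[OF cb Rn nR[OF nj] n0(2) \<Lambda> q \<sigma> sol Tj eb F(1) g0]
        by (simp only: kg Y_def Cb_def)
      have Y0: "0 < Y" using Cb F(1)[of j] g0 by (simp add: Y_def)
      have eb': "energy_bound c x0 n (R j) (t0 - T j) t0 (\<lambda>s x. max 0 (u s x - k (Suc j))) (F j)"
      proof (rule energy_bound_truncate[OF eb _ c])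
        show "k j \<le> k (Suc j)" using kg g0 by linarith
        show "continuous_on {t0 - T j..t0} (\<lambda>s. u s x)" if "x \<in> lbox x0 (R j)" for x
          using that Tj(1) lbox_mono[OF Rn[of j], of x0] by (intro heat_sol_continuous[OF sol]) auto
      qed
      \<comment> \<open>Before rounding, consecutive radii differ by \<open>2 * \<rho> * n\<close>;
        rounding takes away less than 1 and thus at most \<open>\<rho> * n\<close>.\<close>
      have \<rho>n: "1 \<le> \<rho> * real n" using nj5 by (simp add: \<rho>_def power_one_over field_simps)
      have "energy_bound c x0 n (R (Suc j)) (t0 - T (Suc j)) t0 (\<lambda>s x. max 0 (u s x - k (Suc j)))
          (24 * real ?d * layer_const ?d q \<kappa> \<Lambda> / \<rho> ^ 5 * (F j powr \<tau> * Y powr (1 - \<tau>) + Y))"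
      proof (rule energy_step[OF cb d _ Rn nR[OF nj] n0(2) _ _ _ \<Lambda> p q \<kappa> \<tau> sol Tj(1) _ _ Tj(3) eb' F(1) Y Y0])
        have "real n / 8 * (1 + (1 / 2) ^ j) - real n / 8 * (1 + (1 / 2) ^ Suc j) = 2 * (\<rho> * real n)"
          by (simp add: \<rho>_def power_add power_one_over field_simps)
        then show d: "\<rho> * real n \<le> real (R j) - real (R (Suc j))"
          using R(2)[of j] R(1)[of "Suc j"] \<rho>n by linarith
        then show "R (Suc j) < R j" using \<rho>n by simp
        show "0 < \<rho>" "\<rho> \<le> 1" by (auto simp: \<rho>_def power_le_one)
        have "T j - T (Suc j) = 2 * (\<rho> * (real n)\<^sup>2)"
          by (simp add: T_def \<rho>_def power_add power_one_over field_simps)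
        moreover have "0 \<le> \<rho> * (real n)\<^sup>2" by (simp add: \<rho>_def)
        ultimately show "\<rho> * (real n)\<^sup>2 \<le> t0 - T (Suc j) - (t0 - T j)" by linarith
        show "t0 - T (Suc j) \<le> t0" using Tn(2) by simp
      qed
      moreover have "24 * real ?d * layer_const ?d q \<kappa> \<Lambda> / \<rho> ^ 5 * (F j powr \<tau> * Y powr (1 - \<tau>) + Y) \<le> F (Suc j)"
      proof -
        have "Cs / \<rho> ^ 5 * (F j powr \<tau> * Y powr (1 - \<tau>) + Y) \<le> C3 * 128 ^ j * F j powr (1 + \<alpha>)"
          unfolding \<rho>_def Y_def g_def C3_def \<alpha>_def
          by (rule de_giorgi_numeric[OF F Cs Cb \<sigma>(1) \<tau>0 \<tau>(2)])
        also have "\<dots> \<le> F (Suc j)"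
          unfolding F_def by (rule de_giorgi_decay[OF \<alpha> \<epsilon>(1) a128 C3 \<epsilon>a])
        finally show ?thesis by (simp add: Cs_def)
      qed
      ultimately show ?case by (rule energy_bound_mono)
    qed
    obtain m where m: "2 ^ m \<le> n" "n < 2 ^ (m + 1)"
      using ex_power_ivl1[of 2 n] n0 by auto
    have "4 \<le> m"
    proof (rule ccontr)
      assume "\<not> 4 \<le> m"
      then have "(2::nat) ^ (m + 1) \<le> 2 ^ 4" by (intro power_increasing) auto
      then show False using m n16 by simp
    qed
    \<comment> \<open>The last admissible step: \<open>n\<close> lies between
      \<open>2 ^ (J + 4)\<close> and \<open>2 ^ (J + 5)\<close>.\<close>
    define J where "J = m - 4"
    have J: "2 ^ (J + 4) \<le> n" "n < 2 ^ (J + 5)" using m \<open>4 \<le> m\<close> by (auto simp: J_def)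
    have tJ: "t \<in> {t0 - T J..t0}"
    proof -
      have "(real n)\<^sup>2 / 64 \<le> (real n)\<^sup>2 / 8" by simp
      then show ?thesis using t Tn(3)[of J] by auto
    qed
    have "n div 8 \<le> R J" using nR[OF J(1)] by linarith
    then have xJ: "x \<in> lbox x0 (R J)" using x lbox_mono by blast
    \<comment> \<open>One term of a sum of squares is at most the whole sum; the price is the volume
      factor \<open>n ^ d\<close>.\<close>
    have "(max 0 (u t x - k J))\<^sup>2 \<le> (\<Sum>x\<in>lbox x0 (R J). (max 0 (u t x - k J))\<^sup>2)"
      using xJ by (intro member_le_sum[where f = "\<lambda>x. (max 0 (u t x - k J))\<^sup>2"]) auto
    also have "\<dots> \<le> F J * real n ^ ?d" using E[OF J(1)] tJ by (auto simp: energy_bound_def)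
    also have "\<dots> \<le> (\<epsilon> * (1 / 2 ^ ?d) ^ J) * (2 ^ (J + 5)) ^ ?d"
      unfolding F_def
    proof (intro mult_mono power_mono)
      show "1 / a \<le> 1 / 2 ^ ?d" using a2 a0 by (intro divide_left_mono) auto
      have "real n \<le> real (2 ^ (J + 5))" using less_imp_le[OF J(2)] by (simp only: of_nat_le_iff)
      then show "real n \<le> 2 ^ (J + 5)" by simp
    qed (use \<epsilon> a0 in auto)
    also have "\<dots> = \<epsilon> * 32 ^ ?d"
    proof -
      have "((2::real) ^ (J + 5)) ^ ?d = (2 ^ ?d) ^ J * 32 ^ ?d"
        by (simp add: power_add power_mult_distrib mult.commute flip: power_mult)
      then show ?thesis by (simp add: power_one_over)
    qed
    also have "\<dots> \<le> 1 / 16"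
    proof -
      have "\<epsilon> * 32 ^ ?d \<le> 1 / (16 * 32 ^ ?d) * 32 ^ ?d" using \<epsilon>(4) by (intro mult_right_mono) auto
      then show ?thesis by simp
    qed
    finally have "(max 0 (u t x - k J))\<^sup>2 \<le> (1 / 4)\<^sup>2" by (simp add: power2_eq_square)
    then have "max 0 (u t x - k J) \<le> 1 / 4" by (rule power2_le_imp_le) simp
    moreover have "k J \<le> 1 / 2" by (simp add: k_def)
    ultimately show ?thesis by linarith
  qed
  show ?thesis using \<nu>(1) main by blast
qed

section \<open>Logarithmic estimates\<close>

text \<open>On \<open>Z\<close> the deviation of \<open>f\<close> from its mean is the mean itself.
  As \<open>Z\<close> fills a fixed fraction of the box, the L^1 Poincare inequality therefore
  bounds the mean.\<close>

lemma poincare_zero_set: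
  fixes x0 :: "int ^ 'd::finite" and f :: "int ^ 'd \<Rightarrow> real"
  assumes f: "\<And>x. 0 \<le> f x" and Z: "\<And>x. x \<in> lbox x0 R \<Longrightarrow> x \<in> Z \<Longrightarrow> f x = 0"
    and C: "real (card (lbox x0 R)) \<le> C * real (card (lbox x0 R \<inter> Z))" "0 \<le> C"
  shows "(\<Sum>x\<in>lbox x0 R. f x) \<le> C * (2 * real R + 1) * (\<Sum>(x, j)\<in>edges (lbox x0 R). \<bar>grad f x j\<bar>)"
proof -
  let ?B = "lbox x0 R"
  define m where "m = mean ?B f"
  define D where "D = (\<Sum>(x, j)\<in>edges ?B. \<bar>grad f x j\<bar>)"
  define V where "V = real (card ?B)"
  have V0: "0 < V" unfolding V_def by (simp add: card_gt_0_iff)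
  have m0: "0 \<le> m" unfolding m_def using f by (intro mean_nonneg)
  have "real (card (?B \<inter> Z)) * m = (\<Sum>x\<in>?B \<inter> Z. \<bar>f x - m\<bar>)" using Z m0 by simp
  also have "\<dots> \<le> (\<Sum>x\<in>?B. \<bar>f x - m\<bar>)" by (intro sum_mono2) auto
  also have "\<dots> = V * mean ?B (\<lambda>x. \<bar>f x - m\<bar>)" unfolding V_def by (rule sum_eq_card_mean) auto
  also have "mean ?B (\<lambda>x. \<bar>f x - m\<bar>) \<le> (2 * real R + 1) * (D / V)"
    unfolding m_def D_def V_def lbox_def by (rule poincare_L1) (auto simp: less_eq_vec_def)
  finally have "real (card (?B \<inter> Z)) * m \<le> (2 * real R + 1) * D" using V0 by (simp add: mult_left_mono)
  then have "C * (real (card (?B \<inter> Z)) * m) \<le> C * ((2 * real R + 1) * D)" using C by (intro mult_left_mono)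
  moreover have "V * m \<le> C * real (card (?B \<inter> Z)) * m" using C m0 unfolding V_def by (intro mult_right_mono)
  moreover have "(\<Sum>x\<in>?B. f x) = V * m" unfolding V_def m_def by (rule sum_eq_card_mean) auto
  ultimately show ?thesis unfolding D_def by (simp add: mult.assoc)
qed

lemma heat_sol_subinterval:
  assumes "heat_sol c x0 n a b u" "a \<le> a'" "b' \<le> b"
  shows "heat_sol c x0 n a' b' u"
  unfolding heat_sol_def
  using heat_sol_continuous[OF assms(1) _ assms(2,3)] heat_sol_derivative[OF assms(1) _ assms(2,3)] by auto

lemma cutoff_energy_le:
  fixes x0 :: "int ^ 'd::finite" and c :: "int ^ 'd \<Rightarrow> 'd \<Rightarrow> real"
  assumes cb: "conductance_bound c x0 n p q \<Lambda>" "1 \<le> n" "1 \<le> p" "1 \<le> q" "R \<le> n"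
    and \<eta>: "\<And>x j. (grad \<eta> x j)\<^sup>2 \<le> K"
  shows "(\<Sum>(x, j)\<in>edges (lbox x0 R). c x j * (grad \<eta> x j)\<^sup>2)
    \<le> K * ((real CARD('d) * 3 ^ CARD('d) + \<Lambda>) * real n ^ CARD('d))"
proof -
  have c: "0 < c x j" for x j using cb by (simp add: conductance_bound_def)
  have K: "0 \<le> K" using order_trans[OF zero_le_power2 \<eta>] .
  have "(\<Sum>(x, j)\<in>edges (lbox x0 R). c x j * (grad \<eta> x j)\<^sup>2) \<le> (\<Sum>(x, j)\<in>edges (lbox x0 R). c x j * K)"
    unfolding split_def using c \<eta> by (intro sum_mono mult_left_mono) (auto simp: less_imp_le)
  also have "\<dots> = K * (\<Sum>(x, j)\<in>edges (lbox x0 R). c x j)" by (simp add: sum_distrib_left split_def mult.commute)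
  also have "\<dots> \<le> K * ((real CARD('d) * 3 ^ CARD('d) + \<Lambda>) * real n ^ CARD('d))"
    using sum_edge_weights_le(1)[OF cb] K by (intro mult_left_mono)
  finally show ?thesis .
qed

text \<open>The bound is \<open>(16 / n)\<^sup>2\<close>: for \<open>R = n div 2\<close> and
  \<open>n \<ge> 16\<close> the gap between the two boxes is at least \<open>n / 8\<close>, and the
  slope is at most 2 divided by the gap.\<close>

definition scaled_cutoff :: "int ^ 'd::finite \<Rightarrow> nat \<Rightarrow> nat \<Rightarrow> (int ^ 'd \<Rightarrow> real) \<Rightarrow> bool"
  where "scaled_cutoff x0 n R \<eta> \<longleftrightarrow> (\<forall>x. 0 \<le> \<eta> x \<and> \<eta> x \<le> 1) \<and> (\<forall>x\<in>lbox x0 (R div 2). \<eta> x = 1) \<and>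
    (\<forall>x. x \<notin> lbox x0 (R - 1) \<longrightarrow> \<eta> x = 0) \<and> (\<forall>x j. (grad \<eta> x j)\<^sup>2 \<le> 256 / (real n)\<^sup>2)"

text \<open>The weighted sum of \<open>- ln (h + \<sigma> ^ 4)\<close> can only increase by an
  amount that does not depend on \<open>\<sigma>\<close>. If \<open>h\<close> were below
  \<open>\<delta>\<close> on too much of the box at a later time, the increase would be a multiple
  of \<open>- ln \<sigma>\<close>.\<close>

lemma persistence:
  fixes p q \<Lambda> :: real
  assumes p: "1 \<le> p" and q: "1 \<le> q" and \<Lambda>: "1 \<le> \<Lambda>"
  shows "\<exists>\<delta>. 0 < \<delta> \<and> \<delta> < 1 \<and> (\<forall>(c :: int ^ 'd \<Rightarrow> 'd::finite \<Rightarrow> real) x0 n R a b h \<eta>.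
    conductance_bound c x0 n p q \<Lambda> \<longrightarrow> 1 \<le> n \<longrightarrow> n \<le> 4 * R \<longrightarrow> R \<le> n \<longrightarrow> b - a \<le> (real n)\<^sup>2 \<longrightarrow> heat_sol c x0 n a b h \<longrightarrow>
    (\<forall>s\<in>{a..b}. \<forall>x\<in>lbox x0 n. 0 \<le> h s x \<and> h s x \<le> 1) \<longrightarrow>
    scaled_cutoff x0 n R \<eta> \<longrightarrow>
    (\<Sum>x\<in>lbox x0 R. (\<eta> x)\<^sup>2) \<le> 2 * (\<Sum>x\<in>{x \<in> lbox x0 R. 1 / 2 \<le> h a x}. (\<eta> x)\<^sup>2) \<longrightarrow>
    (\<forall>t\<in>{a..b}. real (card (lbox x0 R)) \<le> 4 * 12 ^ CARD('d) * real (card (lbox x0 R \<inter> {x. \<delta> \<le> h t x}))))"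
proof -
  let ?d = "CARD('d)"
  define M where "M = real ?d * 3 ^ ?d + \<Lambda>"
  define K where "K = M * 4 ^ ?d"
  \<comment> \<open>Large enough that the constants, namely 2 from the bounds by \<open>ln 2\<close>
    at both times and \<open>512 * K\<close> from the cutoff, amount to \<open>l / 4\<close>
    only.\<close>
  define l where "l = 4 * (2 + 512 * K)"
  define \<sigma> where "\<sigma> = exp (- l)"
  \<comment> \<open>The logarithm is capped at about \<open>4 * l\<close> and is about
    \<open>3 * l\<close> at the threshold \<open>\<delta>\<close>. Half of the weight at the cap
    gives a mean of \<open>2 * l\<close> initially, which leaves a margin to
    \<open>3 * l\<close>.\<close>
  define \<delta> where "\<delta> = \<sigma> ^ 3"
  have M0: "0 \<le> M" using \<Lambda> by (simp add: M_def)
  have K0: "0 \<le> K" using M0 by (simp add: K_def)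
  have l0: "0 < l" using K0 by (simp add: l_def)
  have \<sigma>: "0 < \<sigma>" "\<sigma> < 1" using l0 by (auto simp: \<sigma>_def)
  have \<delta>: "0 < \<delta>" "\<delta> < 1" using \<sigma> power_strict_decreasing[of 0 3 \<sigma>] by (auto simp: \<delta>_def)
  have \<sigma>4: "\<sigma> ^ 4 \<le> \<delta>" using \<sigma> unfolding \<delta>_def by (intro power_decreasing) auto
  have ln\<sigma>: "ln (\<sigma> ^ k) = - (real k * l)" for k using \<sigma> by (simp add: ln_realpow \<sigma>_def)
  have ln2: "0 \<le> ln (2 :: real)" "ln (2 :: real) \<le> 1" using ln_2_less_1 by auto
  have main: "real (card (lbox x0 R)) \<le> 4 * 12 ^ ?d * real (card (lbox x0 R \<inter> {x. \<delta> \<le> h t x}))"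
    if cb: "conductance_bound c x0 n p q \<Lambda>" and n: "1 \<le> n" "n \<le> 4 * R" "R \<le> n" and ab: "b - a \<le> (real n)\<^sup>2"
      and sol: "heat_sol c x0 n a b h" and h: "\<forall>s\<in>{a..b}. \<forall>x\<in>lbox x0 n. 0 \<le> h s x \<and> h s x \<le> 1"
      and cut: "scaled_cutoff x0 n R \<eta>"
      and half: "(\<Sum>x\<in>lbox x0 R. (\<eta> x)\<^sup>2) \<le> 2 * (\<Sum>x\<in>{x \<in> lbox x0 R. 1 / 2 \<le> h a x}. (\<eta> x)\<^sup>2)"
      and t: "t \<in> {a..b}"
    for c :: "int ^ 'd \<Rightarrow> 'd \<Rightarrow> real" and x0 n R a b h \<eta> t
  proof -
    let ?B = "lbox x0 R"
    have \<eta>: "\<forall>x. 0 \<le> \<eta> x \<and> \<eta> x \<le> 1" "\<forall>x\<in>lbox x0 (R div 2). \<eta> x = 1" "\<forall>x. x \<notin> lbox x0 (R - 1) \<longrightarrow> \<eta> x = 0"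
      "\<forall>x j. (grad \<eta> x j)\<^sup>2 \<le> 256 / (real n)\<^sup>2"
      using cut by (simp_all add: scaled_cutoff_def)
    define S where "S = (\<Sum>x\<in>?B. (\<eta> x)\<^sup>2)"
    define G where "G s x = - ln (h s x + \<sigma> ^ 4)" for s x
    have n0: "0 < real n" using n by simp
    have R1: "1 \<le> R" using n by simp
    have c: "0 < c x j" for x j using cb by (simp add: conductance_bound_def)
    have BN: "?B \<subseteq> lbox x0 n" using n by (intro lbox_mono)
    have tab: "a \<le> t" "t \<le> b" using t by auto
    have hs: "0 \<le> h s x" "h s x \<le> 1" if "s \<in> {a..b}" "x \<in> ?B" for s x using h that BN by auto
    have SR: "real R ^ ?d \<le> S"
    proof -
      have "real R ^ ?d \<le> real (2 * (R div 2) + 1) ^ ?d"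
      proof (intro power_mono of_nat_0_le_iff)
        have "R \<le> 2 * (R div 2) + 1" by linarith
        then show "real R \<le> real (2 * (R div 2) + 1)" by (simp only: of_nat_le_iff)
      qed
      also have "\<dots> = (\<Sum>x\<in>lbox x0 (R div 2). 1)" by (simp add: card_lbox)
      also have "\<dots> = (\<Sum>x\<in>lbox x0 (R div 2). (\<eta> x)\<^sup>2)" using \<eta>(2) by (intro sum.cong) auto
      also have "\<dots> \<le> S" unfolding S_def using lbox_mono[of "R div 2" R x0] by (intro sum_mono2) auto
      finally show ?thesis .
    qed
    have "0 < real R ^ ?d" using R1 by simp
    then have S0: "0 < S" using SR by linarith
    have MS: "M * real n ^ ?d \<le> K * S"
    proof -
      have "real n ^ ?d \<le> (4 * real R) ^ ?d" using n by (intro power_mono) auto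
      also have "\<dots> \<le> 4 ^ ?d * S" unfolding power_mult_distrib using SR by (intro mult_left_mono) auto
      finally have "M * real n ^ ?d \<le> M * (4 ^ ?d * S)" using M0 by (intro mult_left_mono)
      then show ?thesis by (simp add: K_def)
    qed
    have "(\<Sum>x\<in>?B. (\<eta> x)\<^sup>2 * G t x)
        + integral {a..t} (\<lambda>s. \<Sum>(x, j)\<in>edges ?B. c x j * (\<eta> x * \<eta> (x + axis j 1) * (grad (G s) x j)\<^sup>2)) / 2
        \<le> (\<Sum>x\<in>?B. (\<eta> x)\<^sup>2 * G a x) + 2 * (t - a) * (\<Sum>(x, j)\<in>edges ?B. c x j * (grad \<eta> x j)\<^sup>2)"
      unfolding G_def by (rule log_estimate[OF sol R1 n(3) tab c]) (use \<eta> h \<sigma> in auto)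
    moreover have "0 \<le> integral {a..t} (\<lambda>s. \<Sum>(x, j)\<in>edges ?B. c x j * (\<eta> x * \<eta> (x + axis j 1) * (grad (G s) x j)\<^sup>2))"
    proof (rule integral_nonneg)
      show "0 \<le> (\<Sum>(x, j)\<in>edges ?B. c x j * (\<eta> x * \<eta> (x + axis j 1) * (grad (G s) x j)\<^sup>2))" for s
        using \<eta>(1) c by (auto intro!: sum_nonneg mult_nonneg_nonneg simp: less_imp_le)
      have "continuous_on {a..t} (\<lambda>s. G s x)" if "x \<in> ?B" for x
      proof -
        have "continuous_on {a..t} (\<lambda>s. h s x)" using that BN tab by (intro heat_sol_continuous[OF sol]) auto
        moreover have "h s x + \<sigma> ^ 4 \<noteq> 0" if "s \<in> {a..t}" for s
        proof -
          have "0 \<le> h s x" using \<open>x \<in> ?B\<close> that tab by (intro hs) auto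
          then show ?thesis using zero_less_power[OF \<sigma>(1), of 4] by linarith
        qed
        ultimately show ?thesis unfolding G_def by (intro continuous_intros) auto
      qed
      then show "(\<lambda>s. \<Sum>(x, j)\<in>edges ?B. c x j * (\<eta> x * \<eta> (x + axis j 1) * (grad (G s) x j)\<^sup>2)) integrable_on {a..t}"
        unfolding split_def by (intro integrable_continuous_real continuous_intros) (auto simp: edges_def)
    qed
    moreover have "2 * (t - a) * (\<Sum>(x, j)\<in>edges ?B. c x j * (grad \<eta> x j)\<^sup>2) \<le> 512 * K * S"
    proof -
      have "(\<Sum>(x, j)\<in>edges ?B. c x j * (grad \<eta> x j)\<^sup>2) \<le> 256 / (real n)\<^sup>2 * (M * real n ^ ?d)"
        unfolding M_def using \<eta>(4) by (intro cutoff_energy_le[OF cb n(1) p q n(3)]) auto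
      also have "\<dots> \<le> 256 / (real n)\<^sup>2 * (K * S)" using MS by (intro mult_left_mono) auto
      finally have "2 * (t - a) * (\<Sum>(x, j)\<in>edges ?B. c x j * (grad \<eta> x j)\<^sup>2)
          \<le> 2 * (real n)\<^sup>2 * (256 / (real n)\<^sup>2 * (K * S))"
        using tab ab c by (intro mult_mono) (auto intro!: sum_nonneg simp: less_imp_le)
      then show ?thesis using n0 by simp
    qed
    moreover have "(\<Sum>x\<in>?B. (\<eta> x)\<^sup>2 * G a x) \<le> S + 2 * l * S"
    proof -
      have "(\<Sum>x\<in>?B. (\<eta> x)\<^sup>2 * G a x) \<le> (\<Sum>x\<in>?B. (\<eta> x)\<^sup>2 * (1 + 4 * l) - 4 * l * (if 1 / 2 \<le> h a x then (\<eta> x)\<^sup>2 else 0))"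
      proof (intro sum_mono)
        fix x assume x: "x \<in> ?B"
        have pos: "0 < \<sigma> ^ 4" using \<sigma> by simp
        have ha: "0 \<le> h a x" using hs[of a x] x t by auto
        have "G a x \<le> (if 1 / 2 \<le> h a x then 1 else 1 + 4 * l)"
        proof (cases "1 / 2 \<le> h a x")
          case True
          then have "ln (1 / 2) \<le> ln (h a x + \<sigma> ^ 4)" using pos by (intro ln_le_cancel_iff[THEN iffD2]) linarith+
          then show ?thesis using True ln2 by (simp add: G_def ln_div)
        next
          case False
          have "ln (\<sigma> ^ 4) \<le> ln (h a x + \<sigma> ^ 4)" using pos ha by (intro ln_le_cancel_iff[THEN iffD2]) linarith+
          then show ?thesis using False ln\<sigma>[of 4] by (simp add: G_def)
        qed
        then have "(\<eta> x)\<^sup>2 * G a x \<le> (\<eta> x)\<^sup>2 * (if 1 / 2 \<le> h a x then 1 else 1 + 4 * l)" by (intro mult_left_mono) auto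
        then show "(\<eta> x)\<^sup>2 * G a x \<le> (\<eta> x)\<^sup>2 * (1 + 4 * l) - 4 * l * (if 1 / 2 \<le> h a x then (\<eta> x)\<^sup>2 else 0)"
          by (auto simp: algebra_simps split: if_splits)
      qed
      also have "\<dots> = S * (1 + 4 * l) - 4 * l * (\<Sum>x\<in>{x \<in> ?B. 1 / 2 \<le> h a x}. (\<eta> x)\<^sup>2)"
        by (simp only: sum_subtractf sum_distrib_right[symmetric] sum_distrib_left[symmetric] S_def)
          (simp add: sum.inter_filter)
      also have "\<dots> \<le> S * (1 + 4 * l) - 4 * l * (S / 2)"
        using half l0 by (intro diff_left_mono mult_left_mono) (auto simp: S_def)
      finally show ?thesis by (simp add: algebra_simps)
    qed
    moreover have "(\<Sum>x\<in>?B. (\<eta> x)\<^sup>2 * G t x) \<ge> 3 * l * (S - (\<Sum>x\<in>{x \<in> ?B. \<delta> \<le> h t x}. (\<eta> x)\<^sup>2)) - S"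
    proof -
      have "3 * l * (S - (\<Sum>x\<in>{x \<in> ?B. \<delta> \<le> h t x}. (\<eta> x)\<^sup>2)) - S
          = (\<Sum>x\<in>?B. (3 * l - 1) * (\<eta> x)\<^sup>2 - 3 * l * (if \<delta> \<le> h t x then (\<eta> x)\<^sup>2 else 0))"
        by (simp only: sum_subtractf sum_distrib_left[symmetric] S_def) (simp add: sum.inter_filter algebra_simps)
      also have "\<dots> \<le> (\<Sum>x\<in>?B. (\<eta> x)\<^sup>2 * G t x)"
      proof (intro sum_mono)
        fix x assume x: "x \<in> ?B"
        have pos: "0 < \<sigma> ^ 4" "\<sigma> ^ 4 \<le> 1" using \<sigma> by (auto simp: power_le_one)
        have ht: "0 \<le> h t x" "h t x \<le> 1" using hs[OF t x] by auto
        have "(if \<delta> \<le> h t x then - 1 else 3 * l - 1) \<le> G t x"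
        proof (cases "\<delta> \<le> h t x")
          case True
          have "ln (h t x + \<sigma> ^ 4) \<le> ln 2" using pos ht by (intro ln_le_cancel_iff[THEN iffD2]) linarith+
          then show ?thesis using True ln2 by (simp add: G_def)
        next
          case False
          then have "ln (h t x + \<sigma> ^ 4) \<le> ln (2 * \<delta>)" using pos ht \<sigma>4 \<delta> by (intro ln_le_cancel_iff[THEN iffD2]) linarith+
          also have "\<dots> = ln 2 - 3 * l" using \<delta> ln\<sigma>[of 3] by (simp add: ln_mult \<delta>_def)
          finally show ?thesis using False ln2 by (simp add: G_def)
        qed
        then have "(\<eta> x)\<^sup>2 * (if \<delta> \<le> h t x then - 1 else 3 * l - 1) \<le> (\<eta> x)\<^sup>2 * G t x" by (intro mult_left_mono) auto
        then show "(3 * l - 1) * (\<eta> x)\<^sup>2 - 3 * l * (if \<delta> \<le> h t x then (\<eta> x)\<^sup>2 else 0) \<le> (\<eta> x)\<^sup>2 * G t x"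
          by (auto simp: algebra_simps split: if_splits)
      qed
      finally show ?thesis .
    qed
    ultimately have "3 * l * (S - (\<Sum>x\<in>{x \<in> ?B. \<delta> \<le> h t x}. (\<eta> x)\<^sup>2)) \<le> 2 * S + 2 * l * S + 512 * K * S"
      by linarith
    also have "\<dots> = (2 * l + l / 4) * S" by (simp add: l_def algebra_simps)
    finally have "l * (3 * (S - (\<Sum>x\<in>{x \<in> ?B. \<delta> \<le> h t x}. (\<eta> x)\<^sup>2))) \<le> l * (9 / 4 * S)" by (simp add: algebra_simps)
    \<comment> \<open>The sites below the threshold carry at most three quarters of the total
      weight.\<close>
    then have "S \<le> 4 * (\<Sum>x\<in>{x \<in> ?B. \<delta> \<le> h t x}. (\<eta> x)\<^sup>2)" using l0 by simp
    also have "(\<Sum>x\<in>{x \<in> ?B. \<delta> \<le> h t x}. (\<eta> x)\<^sup>2) \<le> (\<Sum>x\<in>{x \<in> ?B. \<delta> \<le> h t x}. 1)"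
      using \<eta>(1) by (intro sum_mono power_le_one) auto
    also have "\<dots> = real (card (?B \<inter> {x. \<delta> \<le> h t x}))" 
    proof -
      have "{x \<in> ?B. \<delta> \<le> h t x} = ?B \<inter> {x. \<delta> \<le> h t x}" by auto
      then show ?thesis by simp
    qed
    finally have "12 ^ ?d * S \<le> 12 ^ ?d * (4 * real (card (?B \<inter> {x. \<delta> \<le> h t x})))"
      by (intro mult_left_mono) auto
    moreover have "real (card ?B) \<le> 12 ^ ?d * S"
    proof -
      have "real (card ?B) = real (2 * R + 1) ^ ?d" by (simp add: card_lbox)
      also have "\<dots> \<le> (12 * real R) ^ ?d" using R1 by (intro power_mono) auto
      also have "\<dots> \<le> 12 ^ ?d * S" unfolding power_mult_distrib using SR by (intro mult_left_mono) auto
      finally show ?thesis .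
    qed
    ultimately have "real (card ?B) \<le> 12 ^ ?d * (4 * real (card (?B \<inter> {x. \<delta> \<le> h t x})))"
      by (rule order_trans[rotated])
    then show ?thesis by (simp add: mult.assoc mult.left_commute)
  qed
  show ?thesis using \<delta> main by blast
qed

text \<open>The truncated logarithm \<open>f\<close> vanishes where \<open>\<delta>' \<le> h\<close>
  and is at least \<open>P\<close>, nearly \<open>- ln \<delta>\<close>, where
  \<open>h < \<delta>\<close>; its sum is bounded through the Poincare inequality. The energy also
  grows linearly in \<open>l = - ln \<delta>\<close>, so a large \<open>l\<close> alone does not
  suffice: the Young parameter \<open>\<mu>\<close> first makes the coefficient of \<open>l\<close>
  small, and then \<open>l\<close> is taken large depending on \<open>\<mu>\<close>.\<close>

lemma measure_decay:
  fixes p q \<Lambda> \<delta>' \<nu> C :: real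
  assumes p: "1 \<le> p" and q: "1 \<le> q" and \<Lambda>: "1 \<le> \<Lambda>" and \<delta>': "0 < \<delta>'" "\<delta>' < 1" and \<nu>: "0 < \<nu>" and C: "0 \<le> C"
  shows "\<exists>\<delta>. 0 < \<delta> \<and> \<delta> < 1 \<and> (\<forall>(c :: int ^ 'd \<Rightarrow> 'd::finite \<Rightarrow> real) x0 n R a b h.
    conductance_bound c x0 n p q \<Lambda> \<longrightarrow> 1 \<le> n \<longrightarrow> 2 * R \<le> n \<longrightarrow> a \<le> b \<longrightarrow> b - a \<le> (real n)\<^sup>2 \<longrightarrow> heat_sol c x0 n a b h \<longrightarrow>
    (\<forall>s\<in>{a..b}. \<forall>x\<in>lbox x0 n. 0 \<le> h s x \<and> h s x \<le> 1) \<longrightarrow>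
    (\<forall>t\<in>{a..b}. real (card (lbox x0 R)) \<le> C * real (card (lbox x0 R \<inter> {x. \<delta>' \<le> h t x}))) \<longrightarrow>
    integral {a..b} (\<lambda>s. \<Sum>x\<in>lbox x0 R. (max 0 (1 - h s x / \<delta>))\<^sup>2) \<le> \<nu> * real n ^ (CARD('d) + 2))"
proof -
  let ?d = "CARD('d)"
  define M where "M = real ?d * 3 ^ ?d + \<Lambda>"
  define K where "K = 3 ^ ?d + 32 * M"
  \<comment> \<open>Reduces the contribution of the energy to at most
    \<open>\<nu> / 4 * (l + 1)\<close>; with \<open>C + 1\<close> instead of \<open>C\<close> the
    case \<open>C = 0\<close> is covered.\<close>
  define \<mu> where "\<mu> = \<nu> / (8 * K * (C + 1))"
  define \<theta> where "\<theta> = - ln \<delta>'"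
  \<comment> \<open>Chosen such that \<open>C * M / \<mu>\<close> equals
    \<open>\<nu> * (l / 2 - 2 - \<theta>)\<close>; together with the energy this stays below
    \<open>\<nu> * P\<close>.\<close>
  define l where "l = 2 * (2 + \<theta> + C * M / \<mu> / \<nu>)"
  define \<delta> where "\<delta> = exp (- l)"
  have M0: "0 \<le> M" using \<Lambda> by (simp add: M_def)
  have K0: "0 < K" unfolding K_def using M0 by (intro add_pos_nonneg) auto
  have \<mu>0: "0 < \<mu>" using \<nu> K0 C by (simp add: \<mu>_def)
  have \<theta>0: "0 \<le> \<theta>" using \<delta>' by (simp add: \<theta>_def)
  have l4: "4 \<le> l" using \<theta>0 C M0 \<mu>0 \<nu> by (simp add: l_def)
  have \<delta>: "0 < \<delta>" "\<delta> < 1" using l4 by (auto simp: \<delta>_def)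
  have ln\<delta>: "ln \<delta> = - l" by (simp add: \<delta>_def)
  have ln2: "0 \<le> ln (2 :: real)" "ln (2 :: real) \<le> 1" using ln_2_less_1 by auto
  \<comment> \<open>A lower bound for \<open>f\<close> where \<open>h < \<delta>\<close>; the 1
    accounts for \<open>ln 2\<close> from \<open>h + \<delta> \<le> 2 * \<delta>\<close>.\<close>
  define P where "P = l - 1 - \<theta>"
  have P0: "0 < P"
  proof -
    have "0 \<le> C * M / \<mu> / \<nu>" using C M0 \<mu>0 \<nu> by simp
    then show ?thesis using \<theta>0 by (simp add: P_def l_def)
  qed
  have CP: "C * (2 * K * \<mu> * (l + 1) + M / \<mu>) \<le> \<nu> * P"
  proof -
    have "C * (2 * K * \<mu>) \<le> \<nu> / 4"
    proof -
      have "C * (2 * K * (\<nu> / (8 * K * D))) = (C / D) * (\<nu> / 4)" if "0 < D" for D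
        using K0 that by (simp add: field_simps)
      from this[of "C + 1"] have "C * (2 * K * \<mu>) = (C / (C + 1)) * (\<nu> / 4)" using C by (simp add: \<mu>_def)
      also have "\<dots> \<le> 1 * (\<nu> / 4)" using C \<nu> by (intro mult_right_mono) auto
      finally show ?thesis by simp
    qed
    then have "C * (2 * K * \<mu>) * (l + 1) \<le> \<nu> / 4 * (l + 1)" using l4 by (intro mult_right_mono) auto
    moreover have "C * (M / \<mu>) = \<nu> * (l / 2 - 2 - \<theta>)"
    proof -
      have "l / 2 = 2 + \<theta> + C * M / \<mu> / \<nu>" unfolding l_def by simp
      then have "l / 2 - 2 - \<theta> = C * M / \<mu> / \<nu>" by linarith
      then show ?thesis using \<nu> by simp
    qed
    ultimately have "C * (2 * K * \<mu> * (l + 1) + M / \<mu>) \<le> \<nu> / 4 * (l + 1) + \<nu> * (l / 2 - 2 - \<theta>)"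
      by (simp add: distrib_left mult.assoc)
    also have "\<dots> = \<nu> * (3 / 4 * l - 7 / 4 - \<theta>)" by (simp add: algebra_simps)
    also have "\<dots> \<le> \<nu> * P" using \<nu> l4 by (intro mult_left_mono) (auto simp: P_def)
    finally show ?thesis .
  qed
  have main: "integral {a..b} (\<lambda>s. \<Sum>x\<in>lbox x0 R. (max 0 (1 - h s x / \<delta>))\<^sup>2) \<le> \<nu> * real n ^ (?d + 2)"
    if cb: "conductance_bound c x0 n p q \<Lambda>" and n: "1 \<le> n" "2 * R \<le> n" and ab: "a \<le> b" "b - a \<le> (real n)\<^sup>2"
      and sol: "heat_sol c x0 n a b h" and h: "\<forall>s\<in>{a..b}. \<forall>x\<in>lbox x0 n. 0 \<le> h s x \<and> h s x \<le> 1"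
      and Z: "\<forall>t\<in>{a..b}. real (card (lbox x0 R)) \<le> C * real (card (lbox x0 R \<inter> {x. \<delta>' \<le> h t x}))"
    for c :: "int ^ 'd \<Rightarrow> 'd \<Rightarrow> real" and x0 n R a b h
  proof -
    let ?B = "lbox x0 R" and ?N = "lbox x0 n"
    define G where "G s x = - ln (h s x + \<delta>)" for s x
    define f where "f s x = max 0 (G s x - \<theta>)" for s x
    define w where "w s x = max 0 (1 - h s x / \<delta>)" for s x
    have n0: "0 < real n" using n by simp
    have c: "0 < c x j" for x j using cb by (simp add: conductance_bound_def)
    have BN: "?B \<subseteq> ?N" using n by (intro lbox_mono) simp
    have hs: "0 \<le> h s x" "h s x \<le> 1" if "s \<in> {a..b}" "x \<in> ?N" for s x using h that by auto
    have Gs: "- 1 \<le> G s x" "G s x \<le> l" if "s \<in> {a..b}" "x \<in> ?N" for s x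
    proof -
      have "ln (h s x + \<delta>) \<le> ln 2" using hs[OF that] \<delta> by (intro ln_le_cancel_iff[THEN iffD2]) linarith+
      then show "- 1 \<le> G s x" using ln2 by (simp add: G_def)
      have "ln \<delta> \<le> ln (h s x + \<delta>)" using hs[OF that] \<delta> by (intro ln_le_cancel_iff[THEN iffD2]) linarith+
      then show "G s x \<le> l" using ln\<delta> by (simp add: G_def)
    qed
    have cont: "continuous_on {a..b} (\<lambda>s. h s x)" if "x \<in> ?N" for x
      using that by (intro heat_sol_continuous[OF sol]) auto
    have cG: "continuous_on {a..b} (\<lambda>s. G s x)" if "x \<in> ?N" for x
    proof -
      have "h s x + \<delta> \<noteq> 0" if "s \<in> {a..b}" for s using hs[OF that \<open>x \<in> ?N\<close>] \<delta> by linarith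
      then show ?thesis unfolding G_def using cont[OF that] by (intro continuous_intros) auto
    qed
    have "R < n" using n by simp
    then obtain \<eta> where \<eta>: "\<And>x. 0 \<le> \<eta> x" "\<And>x. \<eta> x \<le> 1" "\<And>x. x \<in> ?B \<Longrightarrow> \<eta> x = 1"
      "\<And>x. x \<notin> lbox x0 (n - 1) \<Longrightarrow> \<eta> x = 0" and \<eta>D: "\<And>x j. (grad \<eta> x j)\<^sup>2 \<le> (2 / (real n - real R))\<^sup>2"
      using exists_cutoff[of R n x0] by metis
    have "2 / (real n - real R) \<le> 4 / real n" using n n0 by (simp add: field_simps)
    then have "(2 / (real n - real R))\<^sup>2 \<le> (4 / real n)\<^sup>2" using \<open>R < n\<close> by (intro power_mono) auto
    also have "(4 / real n)\<^sup>2 = 16 / (real n)\<^sup>2" by (simp add: power_divide)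
    finally have \<eta>D': "(grad \<eta> x j)\<^sup>2 \<le> 16 / (real n)\<^sup>2" for x j
      using \<eta>D[of x j] by linarith
    define E where "E s = (\<Sum>(x, j)\<in>edges ?N. c x j * (\<eta> x * \<eta> (x + axis j 1) * (grad (G s) x j)\<^sup>2))" for s
    have cE: "continuous_on {a..b} E" unfolding E_def split_def by (intro continuous_intros cG) (auto simp: edges_def)
    have card_le: "real (card ?N) \<le> 3 ^ ?d * real n ^ ?d"
    proof -
      have "real (card ?N) = real (2 * n + 1) ^ ?d" by (simp add: card_lbox)
      also have "\<dots> \<le> (3 * real n) ^ ?d" using n by (intro power_mono) auto
      finally show ?thesis by (simp add: power_mult_distrib)
    qed
    have IE: "integral {a..b} E \<le> 2 * K * (l + 1) * real n ^ ?d"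
    proof -
      have "(\<Sum>x\<in>?N. (\<eta> x)\<^sup>2 * G b x) + integral {a..b} E / 2
          \<le> (\<Sum>x\<in>?N. (\<eta> x)\<^sup>2 * G a x) + 2 * (b - a) * (\<Sum>(x, j)\<in>edges ?N. c x j * (grad \<eta> x j)\<^sup>2)"
        unfolding G_def E_def[abs_def] by (rule log_estimate[OF sol n(1) order_refl ab(1) order_refl c \<eta>(4,1) _ \<delta>(1)]) (use h in auto)
      moreover have "(\<Sum>x\<in>?N. (\<eta> x)\<^sup>2 * G a x) - (\<Sum>x\<in>?N. (\<eta> x)\<^sup>2 * G b x) \<le> (\<Sum>x\<in>?N. l + 1)"
        unfolding sum_subtractf[symmetric]
      proof (intro sum_mono)
        fix x assume x: "x \<in> ?N"
        have "(\<eta> x)\<^sup>2 * G a x - (\<eta> x)\<^sup>2 * G b x = (\<eta> x)\<^sup>2 * (G a x - G b x)" by (simp add: algebra_simps)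
        also have "\<dots> \<le> (\<eta> x)\<^sup>2 * (l + 1)"
          using Gs(2)[of a x] Gs(1)[of b x] x ab by (intro mult_left_mono) auto
        also have "\<dots> \<le> 1 * (l + 1)" using \<eta>(1,2) l4 by (intro mult_right_mono power_le_one) auto
        finally show "(\<eta> x)\<^sup>2 * G a x - (\<eta> x)\<^sup>2 * G b x \<le> l + 1" by simp
      qed
      moreover have "(\<Sum>x\<in>?N. l + 1) \<le> (3 ^ ?d * real n ^ ?d) * (l + 1)"
        using mult_right_mono[OF card_le, of "l + 1"] l4 by simp
      moreover have "2 * (b - a) * (\<Sum>(x, j)\<in>edges ?N. c x j * (grad \<eta> x j)\<^sup>2) \<le> 32 * (M * real n ^ ?d) * (l + 1)"
      proof -
        have "(\<Sum>(x, j)\<in>edges ?N. c x j * (grad \<eta> x j)\<^sup>2) \<le> 16 / (real n)\<^sup>2 * (M * real n ^ ?d)"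
          unfolding M_def by (rule cutoff_energy_le[OF cb n(1) p q order_refl \<eta>D'])
        then have "2 * (b - a) * (\<Sum>(x, j)\<in>edges ?N. c x j * (grad \<eta> x j)\<^sup>2)
            \<le> 2 * (real n)\<^sup>2 * (16 / (real n)\<^sup>2 * (M * real n ^ ?d))"
          using ab c by (intro mult_mono) (auto intro!: sum_nonneg simp: less_imp_le)
        also have "\<dots> = 32 * (M * real n ^ ?d) * 1" using n0 by simp
        also have "\<dots> \<le> 32 * (M * real n ^ ?d) * (l + 1)" using M0 l4 by (intro mult_left_mono) auto
        finally show ?thesis .
      qed
      ultimately have "integral {a..b} E / 2 \<le> (3 ^ ?d * real n ^ ?d) * (l + 1) + 32 * (M * real n ^ ?d) * (l + 1)"
        by linarith
      then show ?thesis by (simp add: K_def algebra_simps)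
    qed
    have point: "P * (\<Sum>x\<in>?B. (w s x)\<^sup>2) \<le> C * (\<mu> * (real n)\<^sup>2 * E s + M * real n ^ ?d / \<mu>)"
      if s: "s \<in> {a..b}" for s
    proof -
      have "P * (\<Sum>x\<in>?B. (w s x)\<^sup>2) \<le> (\<Sum>x\<in>?B. f s x)"
        unfolding sum_distrib_left
      proof (intro sum_mono)
        fix x assume "x \<in> ?B"
        then have x: "x \<in> ?N" using BN by auto
        show "P * (w s x)\<^sup>2 \<le> f s x"
        proof (cases "h s x < \<delta>")
          case True
          have "w s x \<le> 1" "0 \<le> w s x" using hs[OF s x] \<delta> by (auto simp: w_def)
          then have "P * (w s x)\<^sup>2 \<le> P * 1" using P0 by (intro mult_left_mono power_le_one) auto
          moreover have "ln (h s x + \<delta>) \<le> ln (2 * \<delta>)"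
            using True hs[OF s x] \<delta> by (intro ln_le_cancel_iff[THEN iffD2]) linarith+
          then have "P \<le> G s x - \<theta>" using \<delta> ln\<delta> ln2 by (simp add: G_def P_def ln_mult)
          ultimately show ?thesis by (simp add: f_def)
        next
          case False
          then have "1 \<le> h s x / \<delta>" using \<delta> by simp
          then have "w s x = 0" by (simp add: w_def)
          then show ?thesis by (simp add: f_def)
        qed
      qed
      also have "\<dots> \<le> C * (2 * real R + 1) * (\<Sum>(x, j)\<in>edges ?B. \<bar>f s (x + axis j 1) - f s x\<bar>)"
      proof (rule poincare_zero_set[where Z = "{x. \<delta>' \<le> h s x}"])
        fix x assume "x \<in> ?B" "x \<in> {x. \<delta>' \<le> h s x}"
        then have "ln \<delta>' \<le> ln (h s x + \<delta>)"
          using \<delta>' \<delta> by (intro ln_le_cancel_iff[THEN iffD2]) auto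
        then show "f s x = 0" by (simp add: f_def G_def \<theta>_def)
      qed (use Z s C in \<open>auto simp: f_def\<close>)
      also have "\<dots> \<le> C * (2 * real n) * (\<mu> * real n / 2 * E s + M * real n ^ ?d / (2 * \<mu> * real n))"
      proof (intro mult_mono mult_left_mono C)
        have "(\<Sum>(x, j)\<in>edges ?B. \<bar>f s (x + axis j 1) - f s x\<bar>)
           \<le> (\<Sum>(x, j)\<in>edges ?B. \<mu> * real n / 2 * (c x j * (grad (G s) x j)\<^sup>2) + 1 / (2 * \<mu> * real n) * (1 / c x j))"
        proof (intro sum_mono, clarify)
          fix x j
          let ?y = "\<bar>G s (x + axis j 1) - G s x\<bar>"
          define z where "z = \<mu> * real n * c x j"
          have z: "0 < z" using \<mu>0 n0 c by (simp add: z_def)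
          \<comment> \<open>Completing the square splits the difference into energy and inverse
            weight, with the Young parameter \<open>\<mu> * n\<close>.\<close>
          have "0 \<le> (z * ?y - 1)\<^sup>2 / (2 * z)" using z by simp
          also have "\<dots> = z / 2 * ?y\<^sup>2 + 1 / (2 * z) - ?y"
            using z by (simp add: power2_eq_square field_simps)
          finally have "?y \<le> z / 2 * ?y\<^sup>2 + 1 / (2 * z)" by simp
          moreover have "\<bar>f s (x + axis j 1) - f s x\<bar> \<le> ?y" by (auto simp: f_def max_def)
          ultimately have "\<bar>f s (x + axis j 1) - f s x\<bar> \<le> z / 2 * ?y\<^sup>2 + 1 / (2 * z)" by linarith
          also have "?y\<^sup>2 = (grad (G s) x j)\<^sup>2" by simp
          finally show "\<bar>f s (x + axis j 1) - f s x\<bar>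
              \<le> \<mu> * real n / 2 * (c x j * (grad (G s) x j)\<^sup>2) + 1 / (2 * \<mu> * real n) * (1 / c x j)"
            by (simp add: z_def mult_ac)
        qed
        also have "\<dots> = \<mu> * real n / 2 * grad_energy c ?B (G s) + 1 / (2 * \<mu> * real n) * (\<Sum>(x, j)\<in>edges ?B. 1 / c x j)"
          unfolding grad_energy_def split_def by (simp only: sum.distrib sum_distrib_left)
        also have "\<dots> \<le> \<mu> * real n / 2 * E s + 1 / (2 * \<mu> * real n) * (M * real n ^ ?d)"
        proof (intro add_mono mult_left_mono)
          have "grad_energy c ?B (G s) = (\<Sum>(x, j)\<in>edges ?B. c x j * (\<eta> x * \<eta> (x + axis j 1) * (grad (G s) x j)\<^sup>2))"
            unfolding grad_energy_def by (intro sum.cong refl) (auto simp: edges_def \<eta>(3))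
          also have "\<dots> \<le> E s" unfolding E_def using edges_mono[OF BN] c \<eta>(1)
            by (intro sum_mono2 finite_edges) (auto simp: less_imp_le)
          finally show "grad_energy c ?B (G s) \<le> E s" .
          show "(\<Sum>(x, j)\<in>edges ?B. 1 / c x j) \<le> M * real n ^ ?d"
            unfolding M_def using n by (intro sum_edge_weights_le(2)[OF cb n(1) p q]) simp
        qed (use \<mu>0 in auto)
        finally show "(\<Sum>(x, j)\<in>edges ?B. \<bar>f s (x + axis j 1) - f s x\<bar>)
            \<le> \<mu> * real n / 2 * E s + M * real n ^ ?d / (2 * \<mu> * real n)" by simp
      next
        have "2 * R + 1 \<le> 2 * n" using n by linarith
        then have "real (2 * R + 1) \<le> real (2 * n)" by (simp only: of_nat_le_iff)
        then show "2 * real R + 1 \<le> 2 * real n" by simp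
      qed (use C in \<open>auto intro!: sum_nonneg\<close>)
      also have "\<dots> = C * (\<mu> * (real n)\<^sup>2 * E s + M * real n ^ ?d / \<mu>)"
        using n0 \<mu>0 by (simp add: field_simps power2_eq_square)
      finally show ?thesis .
    qed
    have cw: "continuous_on {a..b} (\<lambda>s. \<Sum>x\<in>?B. (w s x)\<^sup>2)"
    proof -
      have "continuous_on {a..b} (\<lambda>s. w s x)" if "x \<in> ?B" for x
        using that BN \<delta> unfolding w_def by (intro continuous_intros cont) auto
      then show ?thesis by (intro continuous_intros)
    qed
    have "P * integral {a..b} (\<lambda>s. \<Sum>x\<in>?B. (w s x)\<^sup>2) = integral {a..b} (\<lambda>s. P * (\<Sum>x\<in>?B. (w s x)\<^sup>2))" by simp
    also have "\<dots> \<le> integral {a..b} (\<lambda>s. C * (\<mu> * (real n)\<^sup>2 * E s + M * real n ^ ?d / \<mu>))"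
      using \<mu>0 by (intro integral_mono_continuous point continuous_intros cw cE) auto
    also have "\<dots> = C * (\<mu> * (real n)\<^sup>2 * integral {a..b} E + (b - a) * (M * real n ^ ?d / \<mu>))"
    proof -
      have iE: "(E has_integral integral {a..b} E) {a..b}"
        using cE by (auto intro: integrable_integral integrable_continuous_real)
      have iC: "((\<lambda>s. M * real n ^ ?d / \<mu>) has_integral (b - a) * (M * real n ^ ?d / \<mu>)) {a..b}"
        using has_integral_const_real[of "M * real n ^ ?d / \<mu>" a b] ab by simp
      show ?thesis by (intro integral_unique has_integral_mult_right has_integral_add iE iC)
    qed
    also have "\<dots> \<le> C * (\<mu> * (real n)\<^sup>2 * (2 * K * (l + 1) * real n ^ ?d) + (real n)\<^sup>2 * (M * real n ^ ?d / \<mu>))"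
      using IE ab M0 \<mu>0 C by (intro mult_left_mono add_mono mult_right_mono) auto
    also have "\<dots> = C * (2 * K * \<mu> * (l + 1) + M / \<mu>) * real n ^ (?d + 2)"
      by (simp add: power_add power2_eq_square algebra_simps)
    also have "\<dots> \<le> \<nu> * P * real n ^ (?d + 2)" using CP by (intro mult_right_mono) auto
    finally have "P * integral {a..b} (\<lambda>s. \<Sum>x\<in>?B. (w s x)\<^sup>2) \<le> P * (\<nu> * real n ^ (?d + 2))"
      by (simp only: mult.commute mult.left_commute mult.assoc)
    then show ?thesis using P0 unfolding w_def by simp
  qed
  show ?thesis using \<delta> main by blast
qed

section \<open>Decay of the oscillation\<close>

lemma lattice_op_affine: "lattice_op c (\<lambda>x. \<alpha> * u x + \<beta>) x = \<alpha> * lattice_op c u x"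
  unfolding lattice_op_def sum_distrib_left by (intro sum.cong refl) (simp add: algebra_simps)

lemma heat_sol_affine:
  assumes "heat_sol c x0 n a b u"
  shows "heat_sol c x0 n a b (\<lambda>s x. \<alpha> * u s x + \<beta>)"
  unfolding heat_sol_def
proof (intro conjI ballI)
  show "continuous_on {a..b} (\<lambda>s. \<alpha> * u s x + \<beta>)" if "x \<in> lbox x0 n" for x
    using assms that unfolding heat_sol_def by (intro continuous_intros) auto
  show "((\<lambda>s. \<alpha> * u s x + \<beta>) has_real_derivative lattice_op c (\<lambda>x. \<alpha> * u s x + \<beta>) x) (at s within {a..b})"
    if "x \<in> lbox x0 (n - 1)" "s \<in> {a..b}" for x s
  proof -
    have "((\<lambda>s. u s x) has_real_derivative lattice_op c (u s) x) (at s within {a..b})"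
      using assms that unfolding heat_sol_def by auto
    from DERIV_add[OF DERIV_cmult[OF this, of \<alpha>] DERIV_const[of \<beta>]]
    show ?thesis by (simp add: lattice_op_affine)
  qed
qed

text \<open>The exponents are fixed here. \<open>\<tau> < 1\<close> asks for
  \<open>p / (p - 1) < \<kappa>\<close>, and the Sobolev inequality on layers for
  \<open>\<kappa> * A \<le> d - 1\<close>; the two are compatible because the condition on
  \<open>1 / p + 1 / q\<close> says \<open>A < (d - 1) * (1 - 1 / p)\<close>. Likewise
  \<open>q > d / 2\<close> permits some \<open>\<sigma> > 1\<close> for the whole box.\<close>

lemma half_mass_lower_bound:
  fixes p q \<Lambda> :: real
  assumes d: "2 \<le> CARD('d::finite)" and p: "1 < p" and q: "real CARD('d) / 2 < q"
    and pq: "1 / p + 1 / q < 2 / (real CARD('d) - 1)" and \<Lambda>: "1 \<le> \<Lambda>"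
  shows "\<exists>\<epsilon>. 0 < \<epsilon> \<and> \<epsilon> < 1 \<and> (\<forall>(c :: int ^ 'd \<Rightarrow> 'd \<Rightarrow> real) x0 n t0 h \<eta>.
    conductance_bound c x0 n p q \<Lambda> \<longrightarrow> 16 \<le> n \<longrightarrow> heat_sol c x0 n (t0 - (real n)\<^sup>2) t0 h \<longrightarrow>
    (\<forall>s\<in>{t0 - (real n)\<^sup>2..t0}. \<forall>x\<in>lbox x0 n. 0 \<le> h s x \<and> h s x \<le> 1) \<longrightarrow>
    scaled_cutoff x0 n (n div 2) \<eta> \<longrightarrow>
    (\<Sum>x\<in>lbox x0 (n div 2). (\<eta> x)\<^sup>2)
      \<le> 2 * (\<Sum>x\<in>{x \<in> lbox x0 (n div 2). 1 / 2 \<le> h (t0 - (real n)\<^sup>2 / 2) x}. (\<eta> x)\<^sup>2) \<longrightarrow>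
    (\<forall>t\<in>{t0 - (real n)\<^sup>2 / 64..t0}. \<forall>x\<in>lbox x0 (n div 8). \<epsilon> \<le> h t x))"
proof -
  let ?d = "real CARD('d)"
  have d2: "2 \<le> ?d" using d by simp
  have q1: "1 < q" using q d2 by linarith
  define A where "A = ?d - 3 + (?d - 1) / q"
  have Ap: "A < (?d - 1) * (1 - 1 / p)"
  proof -
    have "(?d - 1) * (1 / p + 1 / q) < (?d - 1) * (2 / (?d - 1))" using pq d2 by (intro mult_strict_left_mono) auto
    also have "\<dots> = 2"
    proof -
      have "?d - 1 \<noteq> 0" using d2 by linarith
      then show ?thesis by (simp only: times_divide_eq_right nonzero_mult_div_cancel_left not_False_eq_True)
    qed
    finally show ?thesis by (simp add: A_def algebra_simps diff_divide_distrib)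
  qed
  \<comment> \<open>For \<open>A \<le> 0\<close>, as in dimension 2, the upper bound on
    \<open>\<kappa>\<close> is void and a value above \<open>p / (p - 1)\<close> will do; otherwise
    the largest admissible value is taken.\<close>
  define \<kappa> where "\<kappa> = (if A \<le> 0 then p / (p - 1) + 1 else (?d - 1) / A)"
  have \<kappa>p: "p / (p - 1) < \<kappa>"
  proof (cases "A \<le> 0")
    case False
    have "A * p < (?d - 1) * (p - 1)"
      using mult_strict_right_mono[OF Ap, of p] p by (simp add: algebra_simps)
    then show ?thesis using False p by (simp add: \<kappa>_def field_simps)
  qed (simp add: \<kappa>_def)
  have \<kappa>1: "1 < \<kappa>"
  proof -
    have "1 < p / (p - 1)" using p by simp
    then show ?thesis using \<kappa>p by linarith
  qed
  have \<kappa>A: "\<kappa> * (?d - 3 + (?d - 1) / q) \<le> ?d - 1"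
  proof (cases "A \<le> 0")
    case True
    then have "\<kappa> * A \<le> 0" using \<kappa>1 by (simp add: mult_nonneg_nonpos)
    then show ?thesis using d2 by (simp add: A_def)
  qed (simp add: \<kappa>_def A_def)
  define \<tau> where "\<tau> = \<kappa> / (p * (\<kappa> - 1))"
  have \<tau>1: "\<tau> < 1"
  proof -
    have "p < \<kappa> * (p - 1)" using \<kappa>p p by (simp add: field_simps)
    then have "\<kappa> < p * (\<kappa> - 1)" by (simp add: algebra_simps)
    then show ?thesis using \<kappa>1 p by (simp add: \<tau>_def)
  qed
  define \<sigma> where "\<sigma> = ?d / (?d - 2 + ?d / q)"
  have B: "0 < ?d - 2 + ?d / q" "?d - 2 + ?d / q < ?d" 
  proof -
    have "?d / q < 2" "0 < ?d / q" using q q1 d2 by (auto simp: field_simps)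
    then show "0 < ?d - 2 + ?d / q" "?d - 2 + ?d / q < ?d" using d2 by linarith+
  qed
  have \<sigma>: "1 < \<sigma>" "\<sigma> * (?d - 2 + ?d / q) \<le> ?d" using B by (auto simp: \<sigma>_def)
  obtain \<nu> where \<nu>: "0 < \<nu>" and dg: "\<And>(c :: int ^ 'd \<Rightarrow> 'd \<Rightarrow> real) x0 n t0 u.
    \<lbrakk>conductance_bound c x0 n p q \<Lambda>; 16 \<le> n; heat_sol c x0 n (t0 - (real n)\<^sup>2) t0 u;
    \<forall>s\<in>{t0 - (real n)\<^sup>2..t0}. \<forall>x\<in>lbox x0 n. u s x \<le> 1;
    integral {t0 - (real n)\<^sup>2 / 2..t0} (\<lambda>s. \<Sum>x\<in>lbox x0 (n div 2). (max 0 (u s x))\<^sup>2) \<le> \<nu> * real n ^ (CARD('d) + 2)\<rbrakk> \<Longrightarrow>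
    \<forall>t\<in>{t0 - (real n)\<^sup>2 / 64..t0}. \<forall>x\<in>lbox x0 (n div 8). u t x \<le> 3 / 4"
    using de_giorgi[OF d p q1 \<Lambda> \<kappa>1 \<kappa>A \<tau>_def \<tau>1 \<sigma>] by blast
  have p1: "1 \<le> p" "1 \<le> q" using p q1 by auto
  obtain \<delta>' where \<delta>': "0 < \<delta>'" "\<delta>' < 1" and pers: "\<And>(c :: int ^ 'd \<Rightarrow> 'd \<Rightarrow> real) x0 n R a b h \<eta>.
    \<lbrakk>conductance_bound c x0 n p q \<Lambda>; 1 \<le> n; n \<le> 4 * R; R \<le> n; b - a \<le> (real n)\<^sup>2; heat_sol c x0 n a b h;
    \<forall>s\<in>{a..b}. \<forall>x\<in>lbox x0 n. 0 \<le> h s x \<and> h s x \<le> 1;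
    scaled_cutoff x0 n R \<eta>;
    (\<Sum>x\<in>lbox x0 R. (\<eta> x)\<^sup>2) \<le> 2 * (\<Sum>x\<in>{x \<in> lbox x0 R. 1 / 2 \<le> h a x}. (\<eta> x)\<^sup>2)\<rbrakk> \<Longrightarrow>
    \<forall>t\<in>{a..b}. real (card (lbox x0 R)) \<le> 4 * 12 ^ CARD('d) * real (card (lbox x0 R \<inter> {x. \<delta>' \<le> h t x}))"
    using persistence[OF p1 \<Lambda>] by blast
  have C: "(0 :: real) \<le> 4 * 12 ^ CARD('d)" by simp
  obtain \<delta> where \<delta>: "0 < \<delta>" "\<delta> < 1" and decay: "\<And>(c :: int ^ 'd \<Rightarrow> 'd \<Rightarrow> real) x0 n R a b h.
    \<lbrakk>conductance_bound c x0 n p q \<Lambda>; 1 \<le> n; 2 * R \<le> n; a \<le> b; b - a \<le> (real n)\<^sup>2; heat_sol c x0 n a b h;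
    \<forall>s\<in>{a..b}. \<forall>x\<in>lbox x0 n. 0 \<le> h s x \<and> h s x \<le> 1;
    \<forall>t\<in>{a..b}. real (card (lbox x0 R)) \<le> 4 * 12 ^ CARD('d) * real (card (lbox x0 R \<inter> {x. \<delta>' \<le> h t x}))\<rbrakk> \<Longrightarrow>
    integral {a..b} (\<lambda>s. \<Sum>x\<in>lbox x0 R. (max 0 (1 - h s x / \<delta>))\<^sup>2) \<le> \<nu> * real n ^ (CARD('d) + 2)"
    using measure_decay[OF p1 \<Lambda> \<delta>' \<nu> C] by blast
  have main: "\<delta> / 4 \<le> h t x"
    if cb: "conductance_bound c x0 n p q \<Lambda>" and n: "16 \<le> n" and sol: "heat_sol c x0 n (t0 - (real n)\<^sup>2) t0 h"
      and h: "\<forall>s\<in>{t0 - (real n)\<^sup>2..t0}. \<forall>x\<in>lbox x0 n. 0 \<le> h s x \<and> h s x \<le> 1"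
      and \<eta>: "scaled_cutoff x0 n (n div 2) \<eta>"
      and half: "(\<Sum>x\<in>lbox x0 (n div 2). (\<eta> x)\<^sup>2)
        \<le> 2 * (\<Sum>x\<in>{x \<in> lbox x0 (n div 2). 1 / 2 \<le> h (t0 - (real n)\<^sup>2 / 2) x}. (\<eta> x)\<^sup>2)"
      and tx: "t \<in> {t0 - (real n)\<^sup>2 / 64..t0}" "x \<in> lbox x0 (n div 8)"
    for c :: "int ^ 'd \<Rightarrow> 'd \<Rightarrow> real" and x0 n t0 h \<eta> t x
  proof -
    let ?a = "t0 - (real n)\<^sup>2 / 2"
    have n1: "1 \<le> n" "n \<le> 4 * (n div 2)" "n div 2 \<le> n" "2 * (n div 2) \<le> n" using n by linarith+
    have a: "t0 - (real n)\<^sup>2 \<le> ?a" "?a \<le> t0" "t0 - ?a \<le> (real n)\<^sup>2" by (auto simp: field_simps)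
    have sol': "heat_sol c x0 n ?a t0 h" by (rule heat_sol_subinterval[OF sol a(1) order_refl])
    have h': "\<forall>s\<in>{?a..t0}. \<forall>x\<in>lbox x0 n. 0 \<le> h s x \<and> h s x \<le> 1" using h a(1) by auto
    have Z: "\<forall>t\<in>{?a..t0}. real (card (lbox x0 (n div 2)))
        \<le> 4 * 12 ^ CARD('d) * real (card (lbox x0 (n div 2) \<inter> {x. \<delta>' \<le> h t x}))"
      by (rule pers[OF cb n1(1-3) a(3) sol' h' \<eta> half])
    have I: "integral {?a..t0} (\<lambda>s. \<Sum>x\<in>lbox x0 (n div 2). (max 0 (1 - h s x / \<delta>))\<^sup>2) \<le> \<nu> * real n ^ (CARD('d) + 2)"
      by (rule decay[OF cb n1(1,4) a(2,3) sol' h' Z])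
    have "(- 1 / \<delta>) * h s x + 1 = 1 - h s x / \<delta>" for s x by simp
    then have sol1: "heat_sol c x0 n (t0 - (real n)\<^sup>2) t0 (\<lambda>s x. 1 - h s x / \<delta>)"
      using heat_sol_affine[OF sol, of "- 1 / \<delta>" 1] by presburger
    have "\<forall>s\<in>{t0 - (real n)\<^sup>2..t0}. \<forall>x\<in>lbox x0 n. 1 - h s x / \<delta> \<le> 1" using h \<delta> by simp
    from dg[OF cb n sol1 this I] tx have "1 - h t x / \<delta> \<le> 3 / 4" by blast
    then show ?thesis using \<delta> by (simp add: field_simps)
  qed
  show ?thesis
  proof (intro exI[of _ "\<delta> / 4"] conjI)
    show "0 < \<delta> / 4" "\<delta> / 4 < 1" using \<delta> by auto
  qed (use main in blast)
qed

lemma lower_or_upper_bound: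
  fixes p q \<Lambda> :: real
  assumes d: "2 \<le> CARD('d::finite)" and p: "1 < p" and q: "real CARD('d) / 2 < q"
    and pq: "1 / p + 1 / q < 2 / (real CARD('d) - 1)" and \<Lambda>: "1 \<le> \<Lambda>"
  shows "\<exists>\<epsilon>. 0 < \<epsilon> \<and> \<epsilon> < 1 \<and> (\<forall>(c :: int ^ 'd \<Rightarrow> 'd \<Rightarrow> real) x0 n t0 h.
    conductance_bound c x0 n p q \<Lambda> \<longrightarrow> 16 \<le> n \<longrightarrow> heat_sol c x0 n (t0 - (real n)\<^sup>2) t0 h \<longrightarrow>
    (\<forall>s\<in>{t0 - (real n)\<^sup>2..t0}. \<forall>x\<in>lbox x0 n. 0 \<le> h s x \<and> h s x \<le> 1) \<longrightarrow>
    (\<forall>t\<in>{t0 - (real n)\<^sup>2 / 64..t0}. \<forall>x\<in>lbox x0 (n div 8). \<epsilon> \<le> h t x) \<or>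
    (\<forall>t\<in>{t0 - (real n)\<^sup>2 / 64..t0}. \<forall>x\<in>lbox x0 (n div 8). h t x \<le> 1 - \<epsilon>))"
proof -
  obtain \<epsilon> where \<epsilon>: "0 < \<epsilon>" "\<epsilon> < 1" and lb: "\<And>(c :: int ^ 'd \<Rightarrow> 'd \<Rightarrow> real) x0 n t0 h \<eta>.
    \<lbrakk>conductance_bound c x0 n p q \<Lambda>; 16 \<le> n; heat_sol c x0 n (t0 - (real n)\<^sup>2) t0 h;
    \<forall>s\<in>{t0 - (real n)\<^sup>2..t0}. \<forall>x\<in>lbox x0 n. 0 \<le> h s x \<and> h s x \<le> 1;
    scaled_cutoff x0 n (n div 2) \<eta>;
    (\<Sum>x\<in>lbox x0 (n div 2). (\<eta> x)\<^sup>2)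
      \<le> 2 * (\<Sum>x\<in>{x \<in> lbox x0 (n div 2). 1 / 2 \<le> h (t0 - (real n)\<^sup>2 / 2) x}. (\<eta> x)\<^sup>2)\<rbrakk> \<Longrightarrow>
    \<forall>t\<in>{t0 - (real n)\<^sup>2 / 64..t0}. \<forall>x\<in>lbox x0 (n div 8). \<epsilon> \<le> h t x"
    using half_mass_lower_bound[OF assms] by blast
  have main: "(\<forall>t\<in>{t0 - (real n)\<^sup>2 / 64..t0}. \<forall>x\<in>lbox x0 (n div 8). \<epsilon> \<le> h t x) \<or>
    (\<forall>t\<in>{t0 - (real n)\<^sup>2 / 64..t0}. \<forall>x\<in>lbox x0 (n div 8). h t x \<le> 1 - \<epsilon>)"
    if cb: "conductance_bound c x0 n p q \<Lambda>" and n: "16 \<le> n" and sol: "heat_sol c x0 n (t0 - (real n)\<^sup>2) t0 h"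
      and h: "\<forall>s\<in>{t0 - (real n)\<^sup>2..t0}. \<forall>x\<in>lbox x0 n. 0 \<le> h s x \<and> h s x \<le> 1"
    for c :: "int ^ 'd \<Rightarrow> 'd \<Rightarrow> real" and x0 n t0 h
  proof -
    let ?R = "n div 2" and ?a = "t0 - (real n)\<^sup>2 / 2"
    let ?B = "lbox x0 ?R"
    have R: "?R div 2 < ?R" using n by linarith
    then obtain \<eta> where \<eta>: "\<And>x. 0 \<le> \<eta> x" "\<And>x. \<eta> x \<le> 1" "\<And>x. x \<in> lbox x0 (?R div 2) \<Longrightarrow> \<eta> x = 1"
      "\<And>x. x \<notin> lbox x0 (?R - 1) \<Longrightarrow> \<eta> x = 0"
      and \<eta>D: "\<And>x j. (grad \<eta> x j)\<^sup>2 \<le> (2 / (real ?R - real (?R div 2)))\<^sup>2"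
      using exists_cutoff[of "?R div 2" ?R x0] by metis
    have \<eta>D': "(grad \<eta> x j)\<^sup>2 \<le> 256 / (real n)\<^sup>2" for x j
    proof -
      define m where "m = ?R - ?R div 2"
      have "n \<le> 8 * m" unfolding m_def using n by linarith
      then have "real n \<le> real (8 * m)" by (simp only: of_nat_le_iff)
      then have m: "real n \<le> 8 * real m" by simp
      have "real ?R - real (?R div 2) = real m" using R unfolding m_def by (simp add: of_nat_diff)
      moreover have "2 / real m \<le> 16 / real n" using m n by (simp add: field_simps)
      then have "(2 / real m)\<^sup>2 \<le> (16 / real n)\<^sup>2" by (intro power_mono) auto
      ultimately show ?thesis using \<eta>D[of x j] by (simp add: power_divide)
    qed
    have cut: "scaled_cutoff x0 n ?R \<eta>" using \<eta> \<eta>D' by (simp add: scaled_cutoff_def)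
    have "(\<Sum>x\<in>?B. (\<eta> x)\<^sup>2) \<le> (\<Sum>x\<in>?B. (if 1 / 2 \<le> h ?a x then (\<eta> x)\<^sup>2 else 0) + (if 1 / 2 \<le> 1 - h ?a x then (\<eta> x)\<^sup>2 else 0))"
      by (intro sum_mono) auto
    also have "\<dots> = (\<Sum>x\<in>{x \<in> ?B. 1 / 2 \<le> h ?a x}. (\<eta> x)\<^sup>2) + (\<Sum>x\<in>{x \<in> ?B. 1 / 2 \<le> 1 - h ?a x}. (\<eta> x)\<^sup>2)"
      by (simp only: sum.distrib sum.inter_filter[OF finite_lbox])
    finally consider "(\<Sum>x\<in>?B. (\<eta> x)\<^sup>2) \<le> 2 * (\<Sum>x\<in>{x \<in> ?B. 1 / 2 \<le> h ?a x}. (\<eta> x)\<^sup>2)"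
      | "(\<Sum>x\<in>?B. (\<eta> x)\<^sup>2) \<le> 2 * (\<Sum>x\<in>{x \<in> ?B. 1 / 2 \<le> 1 - h ?a x}. (\<eta> x)\<^sup>2)"
      by linarith
    then show ?thesis
    proof cases
      case 1
      have "\<forall>t\<in>{t0 - (real n)\<^sup>2 / 64..t0}. \<forall>x\<in>lbox x0 (n div 8). \<epsilon> \<le> h t x"
        by (rule lb[OF cb n sol h cut 1])
      then show ?thesis by blast
    next
      case 2
      have "- 1 * h s x + 1 = 1 - h s x" for s x by simp
      then have sol1: "heat_sol c x0 n (t0 - (real n)\<^sup>2) t0 (\<lambda>s x. 1 - h s x)"
        using heat_sol_affine[OF sol, of "- 1" 1] by presburger
      have "\<forall>t\<in>{t0 - (real n)\<^sup>2 / 64..t0}. \<forall>x\<in>lbox x0 (n div 8). \<epsilon> \<le> 1 - h t x"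
        by (rule lb[OF cb n sol1 _ cut 2]) (use h in auto)
      then show ?thesis by fastforce
    qed
  qed
  show ?thesis using \<epsilon> main by blast
qed

section \<open>Translation of bonds and cubes into directed edges and boxes\<close>

lemma norm_of_lattice_axis: "norm (of_lattice (axis j 1 :: int ^ 'd::finite)) = 1"
proof -
  have "of_lattice (axis j 1 :: int ^ 'd) = axis j (1 :: real)"
    by (simp add: of_lattice_def vec_eq_iff axis_def)
  then show ?thesis by simp
qed

lemma of_lattice_diff: "of_lattice x - of_lattice y = of_lattice (x - y)"
  by (simp add: of_lattice_def vec_eq_iff)

lemma of_lattice_minus: "of_lattice (- x) = - of_lattice x"
  by (simp add: of_lattice_def vec_eq_iff)

text \<open>The squares of the coordinates are nonnegative integers with sum 1, so exactly one of
  them is 1.\<close>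

lemma unit_lattice_vector:
  fixes z :: "int ^ 'd::finite"
  assumes "norm (of_lattice z) = 1"
  shows "\<exists>j. z = axis j 1 \<or> z = - axis j 1"
proof -
  have "(norm (of_lattice z))\<^sup>2 = (\<Sum>i\<in>UNIV. (real_of_int (z $ i))\<^sup>2)"
    unfolding norm_vec_def L2_set_def by (simp add: of_lattice_def sum_nonneg)
  also have "\<dots> = real_of_int (\<Sum>i\<in>UNIV. (z $ i)\<^sup>2)" by simp
  finally have "real_of_int (\<Sum>i\<in>UNIV. (z $ i)\<^sup>2) = real_of_int 1" using assms by (simp del: of_int_sum)
  then have s1: "(\<Sum>i\<in>UNIV. (z $ i)\<^sup>2) = 1" by (simp only: of_int_eq_iff)
  then obtain j where j: "z $ j \<noteq> 0" by (metis (mono_tags, lifting) power_zero_numeral sum.neutral zero_neq_one)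
  have split: "(\<Sum>i\<in>UNIV. (z $ i)\<^sup>2) = (z $ j)\<^sup>2 + (\<Sum>i\<in>UNIV - {j}. (z $ i)\<^sup>2)" by (simp add: sum.remove)
  have "1 \<le> (z $ j)\<^sup>2" using j by (simp add: int_one_le_iff_zero_less)
  moreover have nn: "0 \<le> (\<Sum>i\<in>UNIV - {j}. (z $ i)\<^sup>2)" by (intro sum_nonneg) auto
  ultimately have "(z $ j)\<^sup>2 = 1" and zero: "(\<Sum>i\<in>UNIV - {j}. (z $ i)\<^sup>2) = 0" using s1 split by linarith+
  then have "z $ j = 1 \<or> z $ j = - 1" by (simp add: power2_eq_1_iff)
  moreover have "z $ i = 0" if "i \<noteq> j" for i
    using zero that sum_nonneg_eq_0_iff[of "UNIV - {j}" "\<lambda>i. (z $ i)\<^sup>2"] by simp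
  ultimately have "z = axis j 1 \<or> z = - axis j 1" by (auto simp: vec_eq_iff axis_def)
  then show ?thesis ..
qed

lemma mem_bonds_axis: "{x, y} \<in> bonds \<longleftrightarrow> (\<exists>j. y = x + axis j 1 \<or> y = x - axis j (1 :: int))"
  for x y :: "int ^ 'd::finite"
proof
  assume "{x, y} \<in> bonds"
  then have "norm (of_lattice (x - y)) = 1" by (simp add: mem_bonds_iff of_lattice_diff)
  then obtain j where "x - y = axis j 1 \<or> x - y = - axis j 1" using unit_lattice_vector by blast
  then have "y = x - axis j 1 \<or> y = x + axis j 1" by (auto simp: algebra_simps)
  then show "\<exists>j. y = x + axis j 1 \<or> y = x - axis j 1" by blast
next
  assume "\<exists>j. y = x + axis j 1 \<or> y = x - axis j 1"
  then show "{x, y} \<in> bonds"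
    by (auto simp: mem_bonds_iff of_lattice_diff of_lattice_minus norm_of_lattice_axis)
qed

definition edge_weight :: "((int ^ 'd) set \<Rightarrow> real) \<Rightarrow> int ^ 'd \<Rightarrow> 'd::finite \<Rightarrow> real"
  where "edge_weight \<omega> x j = \<omega> {x, x + axis j 1}"

lemma axis_ne [simp]: "axis i (1 :: int) \<noteq> - axis j 1" "- axis j (1 :: int) \<noteq> axis i 1"
proof -
  have "axis i (1 :: int) $ i \<noteq> (- axis j 1) $ i" by (simp add: axis_def)
  then show "axis i (1 :: int) \<noteq> - axis j 1" by metis
  then show "- axis j (1 :: int) \<noteq> axis i 1" by metis
qed

text \<open>Forward and backward neighbours form two disjoint families, so no bond at
  \<open>x\<close> is counted twice; a backward bond is indexed by its lower end point
  \<open>x - axis j 1\<close>.\<close>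

lemma generator_eq_lattice_op:
  fixes \<omega> :: "(int ^ 'd::finite) set \<Rightarrow> real"
  shows "generator \<omega> u x = lattice_op (edge_weight \<omega>) u x"
proof -
  let ?P = "range (\<lambda>j. x + axis j 1)" and ?M = "range (\<lambda>j. x - axis j 1)"
  let ?F = "\<lambda>y. \<omega> {x, y} * (u y - u x)"
  have nb: "{y. {x, y} \<in> bonds} = ?P \<union> ?M" by (auto simp: mem_bonds_axis)
  have disj: "?P \<inter> ?M = {}"
  proof -
    have "x + axis i 1 \<noteq> x - axis j (1 :: int)" for i j
      using axis_ne(1)[of i j] by (metis add_left_cancel diff_conv_add_uminus)
    then show ?thesis by auto
  qed
  have "generator \<omega> u x = sum ?F ?P + sum ?F ?M"
    unfolding generator_eq_sum nb by (rule sum.union_disjoint[OF _ _ disj]) auto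
  also have "sum ?F ?P = (\<Sum>j\<in>UNIV. edge_weight \<omega> x j * grad u x j)"
    by (subst sum.reindex) (auto simp: inj_on_def axis_eq_axis edge_weight_def)
  also have "sum ?F ?M = (\<Sum>j\<in>UNIV. edge_weight \<omega> (x - axis j 1) j * (u (x - axis j 1) - u x))"
    by (subst sum.reindex) (auto simp: inj_on_def axis_eq_axis edge_weight_def insert_commute)
  finally show ?thesis by (simp add: lattice_op_def sum.distrib)
qed

lemma cube_eq_lbox: "cube x0 (real n) = lbox x0 n"
proof -
  have *: "real_of_int z \<in> {- real n..real n} \<longleftrightarrow> \<bar>z\<bar> \<le> int n" for z
    by (simp add: abs_le_iff minus_le_iff) linarith
  show ?thesis unfolding cube_def set_eq_iff mem_Collect_eq mem_lbox * by simp
qed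

text \<open>Coordinate differences are integers, so a bound by \<open>n / 8\<close> is a bound by
  its integer part.\<close>

lemma cube_subset_lbox: "cube x0 (real n / 8) \<subseteq> lbox x0 (n div 8)"
proof
  fix x assume x: "x \<in> cube x0 (real n / 8)"
  have "\<bar>x $ i - x0 $ i\<bar> \<le> int (n div 8)" for i
  proof -
    have "- (real n / 8) \<le> real_of_int (x $ i - x0 $ i)" "real_of_int (x $ i - x0 $ i) \<le> real n / 8"
      using x by (auto simp: cube_def simp del: of_int_diff)
    then have "\<bar>real_of_int (x $ i - x0 $ i)\<bar> \<le> real n / 8" by linarith
    then have "real_of_int (8 * \<bar>x $ i - x0 $ i\<bar>) \<le> real_of_int (int n)" by simp
    then have "8 * \<bar>x $ i - x0 $ i\<bar> \<le> int n" by (simp only: of_int_le_iff)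
    from zdiv_mono1[OF this, of 8] have "\<bar>x $ i - x0 $ i\<bar> \<le> int n div 8" by simp
    then show ?thesis by (simp add: zdiv_int)
  qed
  then show "x \<in> lbox x0 (n div 8)" by (simp add: mem_lbox)
qed

lemma heat_sol_of_solves:
  fixes \<omega> :: "(int ^ 'd::finite) set \<Rightarrow> real"
  assumes "solves_heat_eq \<omega> u {a..b} (cube x0 (real n))"
  shows "heat_sol (edge_weight \<omega>) x0 n a b u"
proof -
  have der: "((\<lambda>s. u s x) has_real_derivative lattice_op (edge_weight \<omega>) (u t) x) (at t within {a..b})"
    if "x \<in> lbox x0 n" "t \<in> {a..b}" for x t
    using assms that unfolding solves_heat_eq_def cube_eq_lbox generator_eq_lattice_op by blast
  have "continuous_on {a..b} (\<lambda>t. u t x)" if "x \<in> lbox x0 n" for x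
    using der[OF that] by (intro DERIV_continuous_on) auto
  moreover have "lbox x0 (n - 1) \<subseteq> lbox x0 n" by (intro lbox_mono) simp
  ultimately show ?thesis using der unfolding heat_sol_def by blast
qed

text \<open>A bond determines its lower end point: if two edges gave the same bond with exchanged
  end points, one unit vector would be the negative of another.\<close>

lemma bij_betw_bonds_in:
  fixes S :: "(int ^ 'd::finite) set"
  shows "bij_betw (\<lambda>(x, j). {x, x + axis j 1}) (edges S) (bonds_in S)"
  unfolding bij_betw_def
proof
  show "inj_on (\<lambda>(x, j). {x, x + axis j 1}) (edges S)"
  proof (rule inj_onI, clarify)
    fix x y :: "int ^ 'd" and i j
    assume eq: "{x, x + axis i 1} = {y, y + axis j 1}"
    then consider "x = y" "x + axis i 1 = y + axis j 1" | "x = y + axis j 1" "x + axis i 1 = y"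
      by (auto simp: doubleton_eq_iff)
    then show "x = y \<and> i = j"
    proof cases
      case 1
      then show ?thesis by (simp add: axis_eq_axis)
    next
      case 2
      then have "axis i 1 = - axis j (1 :: int)" by (metis add.commute add_diff_cancel_left' diff_add_cancel minus_add_cancel uminus_add_conv_diff)
      then show ?thesis by simp
    qed
  qed
  show "(\<lambda>(x, j). {x, x + axis j 1}) ` edges S = bonds_in S"
  proof (intro equalityI subsetI)
    fix e assume "e \<in> bonds_in S"
    then have e: "e \<in> bonds" "e \<subseteq> S" by (auto simp: bonds_in_def)
    then obtain x y where xy: "e = {x, y}" by (auto simp: bonds_def)
    then obtain j where "y = x + axis j 1 \<or> y = x - axis j 1" using e mem_bonds_axis by blast
    then show "e \<in> (\<lambda>(x, j). {x, x + axis j 1}) ` edges S"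
    proof
      assume y: "y = x + axis j 1"
      then have "(x, j) \<in> edges S" using e xy by (auto simp: edges_def)
      then show ?thesis using xy y by force
    next
      assume y: "y = x - axis j 1"
      then have x: "x = y + axis j 1" by simp
      then have "(y, j) \<in> edges S" using e xy by (auto simp: edges_def)
      moreover have "e = {y, y + axis j 1}" using xy x by auto
      ultimately show ?thesis by force
    qed
  qed (auto simp: bonds_in_def edges_def mem_bonds_axis)
qed

lemma sum_bonds_in:
  fixes S :: "(int ^ 'd::finite) set"
  shows "(\<Sum>e\<in>bonds_in S. g e) = (\<Sum>(x, j)\<in>edges S. g {x, x + axis j 1})"
  using sum.reindex_bij_betw[OF bij_betw_bonds_in[of S], of g] by (simp add: split_def)

section \<open>Averaged norms and finite exponents\<close>

lemma finite_bonds_in: "finite S \<Longrightarrow> finite (bonds_in S)"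
  unfolding bonds_in_def by (rule finite_subset[of _ "Pow S"]) auto

lemma card_bonds_in_le:
  fixes x0 :: "int ^ 'd::finite"
  assumes "1 \<le> n"
  shows "real (card (bonds_in (lbox x0 n))) \<le> real CARD('d) * 3 ^ CARD('d) * real n ^ CARD('d)"
proof -
  have "real (card (bonds_in (lbox x0 n))) = (\<Sum>e\<in>bonds_in (lbox x0 n). 1)" by simp
  also have "\<dots> = (\<Sum>(x, j)\<in>edges (lbox x0 n). 1)" 
    using bij_betw_same_card[OF bij_betw_bonds_in[of "lbox x0 n"]] by (simp add: split_def)
  also have "\<dots> \<le> real CARD('d) * (\<Sum>x\<in>lbox x0 n. 1)" by (rule sum_edges_fst_le) auto
  also have "\<dots> = real CARD('d) * real (2 * n + 1) ^ CARD('d)" by (simp add: card_lbox)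
  also have "\<dots> \<le> real CARD('d) * (3 * real n) ^ CARD('d)" using assms by (intro mult_left_mono power_mono) auto
  finally show ?thesis by (simp add: power_mult_distrib)
qed

text \<open>
  An infinite exponent may be replaced by any finite one, since the average over the finitely many
  bonds is then bounded by the supremum.
\<close>

lemma sum_powr_le_avg_norm:
  assumes S: "finite S" and r: "0 < r" and p: "p = ereal r \<or> p = \<infinity>" and A: "avg_norm p S F \<le> A" and A0: "0 \<le> A"
  shows "(\<Sum>e\<in>bonds_in S. \<bar>F e\<bar> powr r) \<le> A powr r * real (card (bonds_in S))"
proof (cases "bonds_in S = {}")
  case False
  have fin: "finite (bonds_in S)" using S by (rule finite_bonds_in)
  from False fin have c0: "0 < real (card (bonds_in S))" by (simp add: card_gt_0_iff)
  from p show ?thesis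
  proof
    assume "p = ereal r"
    then have "(1 / real (card (bonds_in S)) * (\<Sum>e\<in>bonds_in S. \<bar>F e\<bar> powr r)) powr (1 / r) \<le> A"
      (is "?m powr _ \<le> A") using A by (simp add: avg_norm_def)
    then have "(?m powr (1 / r)) powr r \<le> A powr r" using r by (intro powr_mono2) auto
    moreover have "0 \<le> ?m" by (intro mult_nonneg_nonneg sum_nonneg) auto
    moreover have "(y powr (1 / r)) powr r = y" if "0 \<le> y" for y using that r by (simp add: powr_powr)
    ultimately have "?m \<le> A powr r" by metis
    then show ?thesis using c0 by (simp add: field_simps)
  next
    assume "p = \<infinity>"
    then have "(SUP e\<in>bonds_in S. \<bar>F e\<bar>) \<le> A" using A by (simp add: avg_norm_def)
    then have "\<bar>F e\<bar> \<le> A" if "e \<in> bonds_in S" for e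
      using cSUP_upper[OF that, of "\<lambda>e. \<bar>F e\<bar>"] fin by (auto intro: bdd_above_finite order_trans)
    then have "(\<Sum>e\<in>bonds_in S. \<bar>F e\<bar> powr r) \<le> (\<Sum>e\<in>bonds_in S. A powr r)"
      using r by (intro sum_mono powr_mono2) auto
    then show ?thesis by (simp add: mult.commute)
  qed
qed simp

text \<open>The conditions on the exponents are strict, which leaves room to replace an infinite
  exponent by a large finite one; if both are infinite, each reciprocal gets half of the
  bound.\<close>

lemma finite_exponents:
  fixes p q :: ereal and D :: real
  assumes D: "2 \<le> D" and p: "1 < p" and q: "ereal (D / 2) < q" and pq: "1 / p + 1 / q < ereal (2 / (D - 1))"
  obtains r s where "p = ereal r \<or> p = \<infinity>" "q = ereal s \<or> q = \<infinity>" "1 < r" "D / 2 < s" "1 / r + 1 / s < 2 / (D - 1)"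
proof -
  have large: "\<exists>t>b. 1 / t < g" if "0 < g" for b g :: real
  proof (intro exI conjI)
    let ?t = "max (b + 1) (2 / g)"
    have "0 < 2 / g" using that by simp
    then have t0: "0 < ?t" by (rule less_le_trans) simp
    show "b < ?t" by simp
    have "2 / g \<le> ?t" by simp
    then have "2 \<le> ?t * g" using that by (simp only: pos_divide_le_eq)
    then show "1 / ?t < g" using t0 by (simp add: divide_less_eq mult.commute)
  qed
  have g0: "0 < 2 / (D - 1)" using D by simp
  have one: "(1 :: ereal) = ereal 1" by simp
  consider (rr) r s where "p = ereal r" "q = ereal s" | (ri) r where "p = ereal r" "q = \<infinity>"
    | (ir) s where "p = \<infinity>" "q = ereal s" | (ii) "p = \<infinity>" "q = \<infinity>"
    using p q by (cases p; cases q) auto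
  then show ?thesis
  proof cases
    case rr
    then have "1 < r" "D / 2 < s" using p q by (auto simp: one)
    moreover have "1 / r + 1 / s < 2 / (D - 1)"
      using pq rr \<open>1 < r\<close> \<open>D / 2 < s\<close> D by (simp add: one)
    ultimately show ?thesis using that rr by blast
  next
    case ri
    then have r: "1 < r" using p by (simp add: one)
    then have "0 < 2 / (D - 1) - 1 / r" using pq ri by (simp add: one)
    then obtain s where "D / 2 < s" "1 / s < 2 / (D - 1) - 1 / r" using large by blast
    then show ?thesis using that ri r by fastforce
  next
    case ir
    then have s: "D / 2 < s" using q by simp
    then have "0 < 2 / (D - 1) - 1 / s" using pq ir D by (simp add: one)
    then obtain r where "1 < r" "1 / r < 2 / (D - 1) - 1 / s" using large by blast
    then show ?thesis using that ir s by fastforce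
  next
    case ii
    have g2: "0 < 2 / (D - 1) / 2" using g0 by simp
    obtain r where r: "1 < r" "1 / r < 2 / (D - 1) / 2" using large[OF g2] by blast
    obtain s where s: "D / 2 < s" "1 / s < 2 / (D - 1) / 2" using large[OF g2] by blast
    show ?thesis using that[of r s] ii r s by linarith
  qed
qed

text \<open>An inf-convolution: each function \<open>\<epsilon> m + max 0 (m - s)\<close> is
  1-Lipschitz and nonincreasing in \<open>s\<close>, and the infimum over \<open>m\<close> inherits
  both. It is positive since, for given \<open>s\<close>, all but finitely many of these values are
  at least 1; for \<open>m \<le> s\<close> the penalty vanishes.\<close>

lemma continuous_antimono_minorant:
  fixes \<epsilon> :: "nat \<Rightarrow> real"
  assumes "\<And>m. 0 < \<epsilon> m"
  obtains e :: "real \<Rightarrow> real" where "\<And>s. 0 < e s" "\<And>s s'. s \<le> s' \<Longrightarrow> e s' \<le> e s" "continuous_on UNIV e"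
    "\<And>m s. real m \<le> s \<Longrightarrow> e s \<le> \<epsilon> m"
proof -
  define f where "f m s = \<epsilon> m + max 0 (real m - s)" for m s
  define e where "e s = (INF m. f m s)" for s
  have f0: "0 \<le> f m s" for m s using less_imp_le[OF assms[of m]] by (simp add: f_def)
  have bdd: "bdd_below (range (\<lambda>m. f m s))" for s by (rule bdd_belowI[of _ 0]) (use f0 in auto)
  have le: "e s \<le> f m s" for m s unfolding e_def by (rule cINF_lower[OF bdd]) simp
  have ge: "y \<le> e s" if "\<And>m. y \<le> f m s" for y s unfolding e_def by (rule cINF_greatest) (use that in auto)
  have lip: "e s - \<bar>s - s'\<bar> \<le> e s'" for s s'
  proof (rule ge)
    fix m
    have "f m s \<le> f m s' + \<bar>s - s'\<bar>" by (auto simp: f_def)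
    then show "e s - \<bar>s - s'\<bar> \<le> f m s'" using le[of s m] by linarith
  qed
  show ?thesis
  proof
    show "0 < e s" for s
    proof -
      define M where "M = nat \<lceil>s\<rceil> + 1"
      define y where "y = min 1 (Min (\<epsilon> ` {..M}))"
      have "0 < y" using assms by (simp add: y_def)
      also have "y \<le> e s"
      proof (rule ge)
        fix m
        show "y \<le> f m s"
        proof (cases "m \<le> M")
          case True
          then have "Min (\<epsilon> ` {..M}) \<le> \<epsilon> m" by (intro Min_le) auto
          then show ?thesis by (simp add: y_def f_def)
        next
          case False
          then have "1 \<le> real m - s" unfolding M_def by linarith
          then show ?thesis using assms[of m] by (simp add: y_def f_def)
        qed
      qed
      finally show ?thesis .
    qed
    show "e s' \<le> e s" if "s \<le> s'" for s s'
    proof (rule ge)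
      fix m
      have "f m s' \<le> f m s" using that by (auto simp: f_def)
      then show "e s' \<le> f m s" using le[of s' m] by linarith
    qed
    show "continuous_on UNIV e"
      unfolding continuous_on_iff
    proof (intro ballI allI impI)
      fix s r :: real assume "0 < r"
      have "dist (e s') (e s) < r" if "dist s' s < r" for s'
        using lip[of s s'] lip[of s' s] that by (auto simp: dist_real_def abs_if split: if_splits)
      then show "\<exists>d>0. \<forall>s'\<in>UNIV. dist s' s < d \<longrightarrow> dist (e s') (e s) < r" using \<open>0 < r\<close> by blast
    qed
    show "e s \<le> \<epsilon> m" if "real m \<le> s" for m s using le[of s m] that by (simp add: f_def)
  qed
qed

text \<open>Guarantees that the supremum and the infimum in \<open>osc\<close> are taken over a
  bounded set.\<close>

lemma bounded_cylinder_image: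
  assumes "solves_heat_eq \<omega> u {t0 - (real n)\<^sup>2..t0} (cube (x0 :: int ^ 'd::finite) (real n))"
  shows "bounded ((\<lambda>(t, x). u t x) ` cylinder t0 x0 (real n))"
proof -
  let ?I = "{t0 - (real n)\<^sup>2..t0}"
  have "bounded (\<Union>x\<in>lbox x0 n. (\<lambda>t. u t x) ` ?I)"
  proof (intro bounded_UN ballI finite_lbox)
    fix x assume "x \<in> lbox x0 n"
    then have "continuous_on ?I (\<lambda>t. u t x)"
      by (intro heat_sol_continuous[OF heat_sol_of_solves[OF assms]]) auto
    then show "bounded ((\<lambda>t. u t x) ` ?I)" by (intro compact_imp_bounded compact_continuous_image) auto
  qed
  then show ?thesis by (rule bounded_subset) (auto simp: cylinder_def cube_eq_lbox)
qed

text \<open>The version with a constant factor for norms below \<open>A\<close>. The solution is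
  rescaled to values in the unit interval by its infimum and supremum over the large cylinder; a
  gain at either end of the range shortens it.\<close>

lemma oscillation_decay:
  fixes p q :: ereal and A :: real
  assumes d: "2 \<le> CARD('d::finite)" and p: "1 < p" and q: "ereal (real CARD('d) / 2) < q"
    and pq: "1 / p + 1 / q < ereal (2 / (real CARD('d) - 1))" and A: "0 \<le> A"
  shows "\<exists>\<epsilon>. 0 < \<epsilon> \<and> \<epsilon> < 1 \<and> (\<forall>\<omega>\<in>conductances. \<forall>t0 (x0 :: int ^ 'd) n u.
    16 \<le> n \<longrightarrow> solves_heat_eq \<omega> u {t0 - (real n)\<^sup>2..t0} (cube x0 (real n)) \<longrightarrow>
    avg_norm p (cube x0 (real n)) \<omega> \<le> A \<longrightarrow> avg_norm q (cube x0 (real n)) (\<lambda>e. inverse (\<omega> e)) \<le> A \<longrightarrow>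
    osc u (cylinder t0 x0 (real n / 8)) \<le> (1 - \<epsilon>) * osc u (cylinder t0 x0 (real n)))"
proof -
  let ?d = "CARD('d)"
  have "2 \<le> real ?d" using d by simp
  then obtain r s where rs: "p = ereal r \<or> p = \<infinity>" "q = ereal s \<or> q = \<infinity>" "1 < r" "real ?d / 2 < s"
      "1 / r + 1 / s < 2 / (real ?d - 1)"
    using finite_exponents[OF _ p q pq] by blast
  have s0: "0 < s" using rs(4) by (rule le_less_trans[rotated]) simp
  \<comment> \<open>\<open>d * 3 ^ d * n ^ d\<close> bounds the number of bonds, and the sum of the
    two powers of \<open>A\<close> covers both exponents.\<close>
  define \<Lambda> where "\<Lambda> = 1 + real ?d * 3 ^ ?d * (A powr r + A powr s)"
  have \<Lambda>: "1 \<le> \<Lambda>" by (simp add: \<Lambda>_def)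
  obtain \<epsilon> where \<epsilon>: "0 < \<epsilon>" "\<epsilon> < 1" and dich: "\<And>(c :: int ^ 'd \<Rightarrow> 'd \<Rightarrow> real) x0 n t0 h.
    \<lbrakk>conductance_bound c x0 n r s \<Lambda>; 16 \<le> n; heat_sol c x0 n (t0 - (real n)\<^sup>2) t0 h;
    \<forall>s\<in>{t0 - (real n)\<^sup>2..t0}. \<forall>x\<in>lbox x0 n. 0 \<le> h s x \<and> h s x \<le> 1\<rbrakk> \<Longrightarrow>
    (\<forall>t\<in>{t0 - (real n)\<^sup>2 / 64..t0}. \<forall>x\<in>lbox x0 (n div 8). \<epsilon> \<le> h t x) \<or>
    (\<forall>t\<in>{t0 - (real n)\<^sup>2 / 64..t0}. \<forall>x\<in>lbox x0 (n div 8). h t x \<le> 1 - \<epsilon>)"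
    using lower_or_upper_bound[OF d rs(3,4,5) \<Lambda>] by blast
  have main: "osc u (cylinder t0 x0 (real n / 8)) \<le> (1 - \<epsilon>) * osc u (cylinder t0 x0 (real n))"
    if \<omega>: "\<omega> \<in> conductances" and n: "16 \<le> n" and sol: "solves_heat_eq \<omega> u {t0 - (real n)\<^sup>2..t0} (cube x0 (real n))"
      and bp: "avg_norm p (cube x0 (real n)) \<omega> \<le> A" and bq: "avg_norm q (cube x0 (real n)) (\<lambda>e. inverse (\<omega> e)) \<le> A"
    for \<omega> t0 and x0 :: "int ^ 'd" and n u
  proof -
    let ?I = "{t0 - (real n)\<^sup>2..t0}"
    define c where "c = edge_weight \<omega>"
    have n1: "1 \<le> n" using n by simp
    have c: "0 < c x j" for x j
    proof -
      have "{x, x + axis j 1} \<in> bonds" unfolding mem_bonds_axis by blast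
      then show ?thesis using \<omega> by (auto simp: conductances_def c_def edge_weight_def)
    qed
    have cb: "conductance_bound c x0 n r s \<Lambda>"
      unfolding conductance_bound_def
    proof (intro conjI allI c)
      have *: "(\<Sum>(x, j)\<in>edges (lbox x0 n). \<bar>F {x, x + axis j 1}\<bar> powr z) \<le> \<Lambda> * real n ^ ?d"
        if "avg_norm P (cube x0 (real n)) F \<le> A" "P = ereal z \<or> P = \<infinity>" "0 < z" "z = r \<or> z = s" for P F z
      proof -
        have "(\<Sum>(x, j)\<in>edges (lbox x0 n). \<bar>F {x, x + axis j 1}\<bar> powr z) = (\<Sum>e\<in>bonds_in (lbox x0 n). \<bar>F e\<bar> powr z)"
          by (simp add: sum_bonds_in)
        also have "\<dots> \<le> A powr z * real (card (bonds_in (lbox x0 n)))"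
          using that(1) unfolding cube_eq_lbox by (intro sum_powr_le_avg_norm[OF _ that(3,2) _ A]) auto
        also have "\<dots> \<le> A powr z * (real ?d * 3 ^ ?d * real n ^ ?d)"
          by (intro mult_left_mono card_bonds_in_le n1) auto
        also have "\<dots> = (real ?d * 3 ^ ?d * A powr z) * real n ^ ?d" by (simp add: mult_ac)
        also have "\<dots> \<le> \<Lambda> * real n ^ ?d"
        proof (intro mult_right_mono)
          have "A powr z \<le> A powr r + A powr s" using that(4) by auto
          then have "real ?d * 3 ^ ?d * A powr z \<le> real ?d * 3 ^ ?d * (A powr r + A powr s)" by (intro mult_left_mono) auto
          then show "real ?d * 3 ^ ?d * A powr z \<le> \<Lambda>" unfolding \<Lambda>_def by linarith
        qed simp
        finally show ?thesis .
      qed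
      have "(\<Sum>(x, j)\<in>edges (lbox x0 n). \<bar>\<omega> {x, x + axis j 1}\<bar> powr r) \<le> \<Lambda> * real n ^ ?d"
        using rs by (intro *[OF bp]) auto
      moreover have "\<bar>\<omega> {x, x + axis j 1}\<bar> = c x j" for x j using c[of x j] by (simp add: c_def edge_weight_def)
      ultimately show "(\<Sum>(x, j)\<in>edges (lbox x0 n). c x j powr r) \<le> \<Lambda> * real n ^ ?d" by simp
      have "(\<Sum>(x, j)\<in>edges (lbox x0 n). \<bar>inverse (\<omega> {x, x + axis j 1})\<bar> powr s) \<le> \<Lambda> * real n ^ ?d"
        using rs s0 by (intro *[OF bq]) auto
      moreover have "\<bar>inverse (\<omega> {x, x + axis j 1})\<bar> = 1 / c x j" for x j
        using c[of x j] by (simp add: c_def edge_weight_def inverse_eq_divide)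
      ultimately show "(\<Sum>(x, j)\<in>edges (lbox x0 n). (1 / c x j) powr s) \<le> \<Lambda> * real n ^ ?d" by simp
    qed
    have hs: "heat_sol c x0 n (t0 - (real n)\<^sup>2) t0 u" unfolding c_def by (rule heat_sol_of_solves[OF sol])
    define Q where "Q = cylinder t0 x0 (real n)"
    define q where "q = cylinder t0 x0 (real n / 8)"
    have Q: "Q = ?I \<times> lbox x0 n" by (simp add: Q_def cylinder_def cube_eq_lbox)
    have q_sub: "(t, x) \<in> q \<Longrightarrow> t \<in> {t0 - (real n)\<^sup>2 / 64..t0} \<and> x \<in> lbox x0 (n div 8)" for t x
      using cube_subset_lbox[of x0 n] by (auto simp: q_def cylinder_def power_divide)
    have ne: "(t0, x0) \<in> q" "(t0, x0) \<in> Q" by (auto simp: q_def Q_def cylinder_def cube_def)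
    have bound: "bounded ((\<lambda>(t, x). u t x) ` Q)"
      unfolding Q_def by (rule bounded_cylinder_image[OF sol])
    define M where "M = (SUP (t, x)\<in>Q. u t x)"
    define m where "m = (INF (t, x)\<in>Q. u t x)"
    have um: "m \<le> u t x" "u t x \<le> M" if "(t, x) \<in> Q" for t x
      using cINF_lower[OF bounded_imp_bdd_below[OF bound] that] cSUP_upper[OF that bounded_imp_bdd_above[OF bound]]
      by (auto simp: m_def M_def)
    have osc_le: "osc u q \<le> \<beta> - \<alpha>" if "\<And>t x. (t, x) \<in> q \<Longrightarrow> \<alpha> \<le> u t x \<and> u t x \<le> \<beta>" for \<alpha> \<beta>
    proof -
      have "(SUP (t, x)\<in>q. u t x) \<le> \<beta>" by (rule cSUP_least) (use ne that in auto)
      moreover have "\<alpha> \<le> (INF (t, x)\<in>q. u t x)" by (rule cINF_greatest) (use ne that in auto)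
      ultimately show ?thesis by (simp add: osc_def)
    qed
    have qQ: "(t, x) \<in> Q" if "(t, x) \<in> q" for t x
    proof -
      have "(real n)\<^sup>2 / 64 \<le> (real n)\<^sup>2" by simp
      then have "t \<in> ?I" using q_sub[OF that] by auto
      moreover have "x \<in> lbox x0 n" using q_sub[OF that] lbox_mono[of "n div 8" n x0] by auto
      ultimately show ?thesis by (simp add: Q)
    qed
    have "osc u q \<le> (1 - \<epsilon>) * (M - m)"
    proof (cases "m < M")
      \<comment> \<open>A solution that is constant on the large cylinder cannot be rescaled to the
        unit interval.\<close>
      case False
      have Mm: "M = m" using False um[OF ne(2)] by linarith
      have "osc u q \<le> m - m" by (rule osc_le) (use um[OF qQ] Mm in auto)
      then show ?thesis using Mm by simp
    next
      case True
      define h where "h t x = (1 / (M - m)) * u t x + (- m / (M - m))" for t x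
      have h: "h t x = (u t x - m) / (M - m)" for t x by (simp add: h_def diff_divide_distrib)
      have "heat_sol c x0 n (t0 - (real n)\<^sup>2) t0 h" unfolding h_def by (rule heat_sol_affine[OF hs])
      moreover have "\<forall>s\<in>?I. \<forall>x\<in>lbox x0 n. 0 \<le> h s x \<and> h s x \<le> 1"
        using um True by (auto simp: h Q)
      ultimately consider "\<forall>t\<in>{t0 - (real n)\<^sup>2 / 64..t0}. \<forall>x\<in>lbox x0 (n div 8). \<epsilon> \<le> h t x"
        | "\<forall>t\<in>{t0 - (real n)\<^sup>2 / 64..t0}. \<forall>x\<in>lbox x0 (n div 8). h t x \<le> 1 - \<epsilon>"
        using dich[OF cb n] by blast
      then show ?thesis
      proof cases
        case 1
        have "osc u q \<le> M - (m + \<epsilon> * (M - m))"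
        proof (rule osc_le)
          fix t x assume tx: "(t, x) \<in> q"
          then have "\<epsilon> \<le> (u t x - m) / (M - m)" using 1 q_sub[OF tx] h by auto
          then have "\<epsilon> * (M - m) \<le> u t x - m" using True by (simp add: pos_le_divide_eq)
          then show "m + \<epsilon> * (M - m) \<le> u t x \<and> u t x \<le> M" using um[OF qQ[OF tx]] by linarith
        qed
        then show ?thesis by (simp add: algebra_simps)
      next
        case 2
        have "osc u q \<le> (m + (1 - \<epsilon>) * (M - m)) - m"
        proof (rule osc_le)
          fix t x assume tx: "(t, x) \<in> q"
          then have "(u t x - m) / (M - m) \<le> 1 - \<epsilon>" using 2 q_sub[OF tx] h by auto
          then have "u t x - m \<le> (1 - \<epsilon>) * (M - m)" using True by (simp add: pos_divide_le_eq)
          then show "m \<le> u t x \<and> u t x \<le> m + (1 - \<epsilon>) * (M - m)" using um[OF qQ[OF tx]] by linarith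
        qed
        then show ?thesis by simp
      qed
    qed
    then show ?thesis by (simp add: osc_def M_def m_def q_def Q_def)
  qed
  show ?thesis using \<epsilon> main by blast
qed

lemma osc_nonneg:
  assumes "solves_heat_eq \<omega> u {t0 - (real n)\<^sup>2..t0} (cube (x0 :: int ^ 'd::finite) (real n))"
  shows "0 \<le> osc u (cylinder t0 x0 (real n))"
proof -
  note bound = bounded_cylinder_image[OF assms]
  have ne: "(t0, x0) \<in> cylinder t0 x0 (real n)" by (auto simp: cylinder_def cube_def)
  show ?thesis
    using cINF_lower[OF bounded_imp_bdd_below[OF bound] ne] cSUP_upper[OF ne bounded_imp_bdd_above[OF bound]]
    by (simp add: osc_def)
qed

theorem theorem1:
  assumes "CARD('d::finite) \<ge> 2"
  shows "\<exists>N::nat. \<forall>p q::ereal.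
    1 < p \<longrightarrow> ereal (real CARD('d) / 2) < q \<longrightarrow> 1 / p + 1 / q < ereal (2 / (real CARD('d) - 1)) \<longrightarrow>
    (\<exists>\<theta>::real \<times> real \<Rightarrow> real.
       \<theta> \<in> {0<..} \<times> {0<..} \<rightarrow> {0<..<1} \<and>
       continuous_on ({0<..} \<times> {0<..}) \<theta> \<and>
       (\<forall>b>0. mono_on {0<..} (\<lambda>a. \<theta> (a, b))) \<and>
       (\<forall>a>0. mono_on {0<..} (\<lambda>b. \<theta> (a, b))) \<and>
       (\<forall>\<omega>\<in>conductances. \<forall>(t0::real) (x0::int ^ 'd). \<forall>n\<ge>N. \<forall>u.
          solves_heat_eq \<omega> u {t0 - (real n)\<^sup>2..t0} (cube x0 (real n)) \<longrightarrow>
          osc u (cylinder t0 x0 (real n / 8)) \<le>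
            \<theta> (avg_norm p (cube x0 (real n)) \<omega>,
               avg_norm q (cube x0 (real n)) (\<lambda>e. inverse (\<omega> e))) *
            osc u (cylinder t0 x0 (real n))))"
proof (intro exI[of _ 16] allI impI)
  fix p q :: ereal
  assume p: "1 < p" and q: "ereal (real CARD('d) / 2) < q" and pq: "1 / p + 1 / q < ereal (2 / (real CARD('d) - 1))"
  let ?bound = "\<lambda>m \<epsilon>. 0 < \<epsilon> \<and> \<epsilon> < 1 \<and> (\<forall>\<omega>\<in>conductances. \<forall>t0 (x0 :: int ^ 'd) n u.
    16 \<le> n \<longrightarrow> solves_heat_eq \<omega> u {t0 - (real n)\<^sup>2..t0} (cube x0 (real n)) \<longrightarrow>
    avg_norm p (cube x0 (real n)) \<omega> \<le> real (Suc m) \<longrightarrow>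
    avg_norm q (cube x0 (real n)) (\<lambda>e. inverse (\<omega> e)) \<le> real (Suc m) \<longrightarrow>
    osc u (cylinder t0 x0 (real n / 8)) \<le> (1 - \<epsilon>) * osc u (cylinder t0 x0 (real n)))"
  \<comment> \<open>The index \<open>m\<close> stands for norms up to \<open>Suc m\<close>, so that
    it covers every \<open>s \<ge> 0\<close> with integer part \<open>m\<close>, while
    \<open>e s \<le> \<epsilon> m\<close> asks for \<open>m \<le> s\<close>.\<close>
  have "\<forall>m. \<exists>\<epsilon>. ?bound m \<epsilon>"
    using oscillation_decay[OF assms p q pq] by (simp del: of_nat_Suc)
  then obtain \<epsilon> where \<epsilon>: "\<And>m. ?bound m (\<epsilon> m)" by metis
  then have "\<And>m. 0 < \<epsilon> m" by blast
  then obtain e where e: "\<And>s. 0 < e s" "\<And>s s'. s \<le> s' \<Longrightarrow> e s' \<le> e s" "continuous_on UNIV e"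
    "\<And>m s. real m \<le> s \<Longrightarrow> e s \<le> \<epsilon> m"
    using continuous_antimono_minorant by blast
  \<comment> \<open>Both norms enter through their maximum, so the monotonicity of \<open>e\<close>
    passes to each variable separately. The outer \<open>max 0\<close> keeps the argument of
    \<open>e\<close> nonnegative; thus \<open>e\<close> is at most \<open>\<epsilon> 0 < 1\<close>
    there and \<open>\<theta>\<close> is positive everywhere.\<close>
  define \<theta> :: "real \<times> real \<Rightarrow> real" where "\<theta> z = 1 - e (max 0 (max (fst z) (snd z)))" for z
  have \<theta>: "0 < \<theta> z" "\<theta> z < 1" for z
    using e(1)[of "max 0 (max (fst z) (snd z))"] e(4)[of 0 "max 0 (max (fst z) (snd z))"] \<epsilon>[of 0]
    by (auto simp: \<theta>_def)
  show "\<exists>\<theta>::real \<times> real \<Rightarrow> real.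
       \<theta> \<in> {0<..} \<times> {0<..} \<rightarrow> {0<..<1} \<and>
       continuous_on ({0<..} \<times> {0<..}) \<theta> \<and>
       (\<forall>b>0. mono_on {0<..} (\<lambda>a. \<theta> (a, b))) \<and>
       (\<forall>a>0. mono_on {0<..} (\<lambda>b. \<theta> (a, b))) \<and>
       (\<forall>\<omega>\<in>conductances. \<forall>(t0::real) (x0::int ^ 'd). \<forall>n\<ge>16. \<forall>u.
          solves_heat_eq \<omega> u {t0 - (real n)\<^sup>2..t0} (cube x0 (real n)) \<longrightarrow>
          osc u (cylinder t0 x0 (real n / 8)) \<le>
            \<theta> (avg_norm p (cube x0 (real n)) \<omega>,
               avg_norm q (cube x0 (real n)) (\<lambda>e. inverse (\<omega> e))) *
            osc u (cylinder t0 x0 (real n)))"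
  proof (intro exI[of _ \<theta>] conjI ballI allI impI)
    show "\<theta> \<in> {0<..} \<times> {0<..} \<rightarrow> {0<..<1}" using \<theta> by auto
    show "continuous_on ({0<..} \<times> {0<..}) \<theta>"
      unfolding \<theta>_def by (intro continuous_intros continuous_on_compose2[OF e(3)]) auto
    show "mono_on {0<..} (\<lambda>a. \<theta> (a, b))" for b by (auto simp: mono_on_def \<theta>_def intro!: e(2))
    show "mono_on {0<..} (\<lambda>b. \<theta> (a, b))" for a by (auto simp: mono_on_def \<theta>_def intro!: e(2))
    fix \<omega> :: "(int ^ 'd) set \<Rightarrow> real" and t0 :: real and x0 :: "int ^ 'd" and n :: nat and u
    assume \<omega>: "\<omega> \<in> conductances" and n: "16 \<le> n"
      and sol: "solves_heat_eq \<omega> u {t0 - (real n)\<^sup>2..t0} (cube x0 (real n))"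
    define a where "a = avg_norm p (cube x0 (real n)) \<omega>"
    define b where "b = avg_norm q (cube x0 (real n)) (\<lambda>e. inverse (\<omega> e))"
    define s where "s = max 0 (max a b)"
    define m where "m = nat \<lfloor>s\<rfloor>"
    have "0 \<le> s" by (simp add: s_def)
    then have m: "real m \<le> s" "s \<le> real (Suc m)" unfolding m_def by linarith+
    have ab: "a \<le> real (Suc m)" "b \<le> real (Suc m)" using m(2) by (auto simp: s_def)
    have "osc u (cylinder t0 x0 (real n / 8)) \<le> (1 - \<epsilon> m) * osc u (cylinder t0 x0 (real n))"
      using \<epsilon>[of m] \<omega> n sol ab unfolding a_def b_def by blast
    also have "\<dots> \<le> (1 - e s) * osc u (cylinder t0 x0 (real n))"
      using e(4)[OF m(1)] by (intro mult_right_mono osc_nonneg[OF sol]) auto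
    also have "1 - e s = \<theta> (a, b)" by (simp add: \<theta>_def s_def)
    finally show "osc u (cylinder t0 x0 (real n / 8)) \<le>
            \<theta> (avg_norm p (cube x0 (real n)) \<omega>, avg_norm q (cube x0 (real n)) (\<lambda>e. inverse (\<omega> e))) *
            osc u (cylinder t0 x0 (real n))"
      by (simp add: a_def b_def)
  qed
qed

end
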